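(* Let $C$ be the modular tensor category of a $2+1$D TQFT with 0-form symmetry group $G$, and suppose there is a gauge in which the $F$ and $R$ symbols of $C$ as well as the symmetry action matrices $U_g(a,b,c)$, $g\in G$, belong to a CM field. Then for every $q\in\mathrm{Gal}(K_C)$, $C$ and its Galois conjugate $q(C)$ have isomorphic 2-group symmetry $(G,\mathcal{A},\rho,[\beta])$.
   Context: A modular tensor category (MTC) $C$ (simple objects $a,b,\dots$ called anyons, unit $1$, fusion rules $a\otimes b=\sum_c N_{ab}^c c$, modular matrix $S$) is described, after choosing bases $|a,b,c;\mu\rangle$ of the fusion spaces $V_{ab}^c$ (such a choice is called a gauge), by its $F$ symbols $(F_{abc}^d)_{(e,\alpha,\beta)}^{(f,\mu,\nu)}$ ($e\in a\otimes b$, $f\in b\otimes c$), $R$ symbols $(R_{ab}^c)_{\mu\nu}$ and pivotal coefficients $\epsilon_a\in\{\pm1\}$. Gauges are chosen so that all entries of $F$ and $R$ lie in a number field; $K_C$ is the normal closure over $\mathbb{Q}$ of $\mathbb{Q}(F,R)$. For $q\in\mathrm{Gal}(K_C):=\mathrm{Gal}(K_C/\mathbb{Q})$, $q(C)$ is the MTC with the same anyons, fusion rules and $\epsilon_a$, and with data $q(F),q(R)$. A CM field is a totally imaginary quadratic extension of a totally real number field. 0-form symmetry: a symmetry $g$ is declared unitary or anti-unitary and consists of a permutation $a\mapsto g(a)$ of the anyons preserving fusion rules together with unitary matrices $U_g(a,b,c)$ acting by $g|a,b,c;\mu\rangle=\sum_{\mu'}U_g(g(a),g(b),g(c))_{\mu\mu'}K^g|g(a),g(b),g(c);\mu'\rangle$,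 where $K^gxK^g:=x$ for $g$ unitary and $:=\bar x$ for $g$ anti-unitary, such that $$\sum_{\mu',\nu'}[U_g(g(b),g(a),g(c))]_{\mu\mu'}(R^{g(c)}_{g(a)g(b)})_{\mu'\nu'}[U_g(g(a),g(b),g(c))^{-1}]_{\nu'\nu}=K^g(R_{ab}^c)_{\mu\nu}K^g,$$ $$\sum_{\alpha',\beta',\mu',\nu'}[U_g(g(a),g(b),g(e))]_{\alpha\alpha'}[U_g(g(e),g(c),g(d))]_{\beta\beta'}(F^{g(d)}_{g(a)g(b)g(c)})^{(g(f),\mu',\nu')}_{(g(e),\alpha',\beta')}[U_g(g(b),g(c),g(f))^{-1}]_{\mu'\mu}[U_g(g(a),g(f),g(d))^{-1}]_{\nu'\nu}=K^g(F^d_{abc})^{(f,\mu,\nu)}_{(e,\alpha,\beta)}K^g.$$ $G$ is the group of such maps modulo natural isomorphisms, i.e. modulo maps fixing all anyons and acting as $|a,b,c;\mu\rangle\mapsto\frac{\gamma_a\gamma_b}{\gamma_c}|a,b,c;\mu\rangle$ for phases $\gamma_a$. 1-form symmetry: $\mathcal{A}$ is the abelian group (under fusion) of invertible (abelian) anyons; $\rho:G\to\mathrm{Aut}(\mathcal{A})$ is the restriction of the permutation action. Postnikov class: choose representatives with $U_e=1$, $U_g(1,b,c)=U_g(a,1,c)=1$. There are phases $\gamma_a(g,h)$, with $\gamma_1(g,h)=\gamma_a(e,h)=\gamma_a(g,e)=1$, such that whenever $N_{ab}^c\neq0$ $$\frac{\gamma_a(g,h)\gamma_b(g,h)}{\gamma_c(g,h)}\delta_{\mu\nu}=\sum_{\alpha,\beta}[U_g(a,b,c)^{-1}]_{\mu\alpha}\,K^g[U_h(g^{-1}(a),g^{-1}(b),g^{-1}(c))^{-1}]_{\alpha\beta}K^g\,[U_{gh}(a,b,c)]_{\beta\nu}.$$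 Set $\Omega_a(g,h,k)=\dfrac{K^g\gamma_{g^{-1}(a)}(h,k)K^g\,\gamma_a(g,hk)}{\gamma_a(gh,k)\gamma_a(g,h)}$. Then there is a unique $\beta(g,h,k)\in\mathcal{A}$ with $\Omega_a(g,h,k)=\frac{S_{a\beta(g,h,k)}S_{11}}{S_{1\beta(g,h,k)}S_{1a}}$ for all $a$; $\beta$ is a twisted 3-cocycle whose class $[\beta]\in H^3_{[\rho]}(G,\mathcal{A})$ is well defined and is called the Postnikov class. The 2-group symmetry of the theory is the quadruple $(G,\mathcal{A},\rho,[\beta])$; two such are isomorphic if there are group isomorphisms of the $G$'s and of the $\mathcal{A}$'s compatible with $\rho$ and matching the classes $[\beta]$. *)

theory Defs
  imports
    "HOL-Computational_Algebra.Computational_Algebra"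
    "HOL-Algebra.Algebraic_Closure_Type"
    "HOL-Algebra.Generated_Fields"
    "HOL-Algebra.Product_Groups"
    "HOL-Algebra.QuotRing"
    "HOL-Algebra.Bij"
    "Jordan_Normal_Form.Schur_Decomposition"
    "Jordan_Normal_Form.Gauss_Jordan_Elimination"
begin

section \<open>Number fields inside the complex numbers\<close>

abbreviation CC :: "complex ring" where
  "CC \<equiv> ring_of_type_algebra"

definition number_field :: "complex set \<Rightarrow> bool" where
  "number_field L \<longleftrightarrow> subfield L CC \<and> ring.finite_dimension CC \<rat> L"

definition embeddings :: "complex set \<Rightarrow> (complex \<Rightarrow> complex) set" where
  "embeddings L = Ring.ring_hom (CC\<lparr>carrier := L\<rparr>) CC"

definition totally_real :: "complex set \<Rightarrow> bool" where
  "totally_real L \<longleftrightarrow> (\<forall>\<sigma>\<in>embeddings L. \<sigma> ` L \<subseteq> \<real>)"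

definition totally_imaginary :: "complex set \<Rightarrow> bool" where
  "totally_imaginary L \<longleftrightarrow> (\<forall>\<sigma>\<in>embeddings L. \<not> \<sigma> ` L \<subseteq> \<real>)"

definition CM_field :: "complex set \<Rightarrow> bool" where
  "CM_field L \<longleftrightarrow> number_field L \<and> totally_imaginary L \<and>
     (\<exists>L0 \<subseteq> L. number_field L0 \<and> totally_real L0 \<and> ring.dimension CC 2 L0 L)"

definition normal_over_rat :: "complex set \<Rightarrow> bool" where
  "normal_over_rat K \<longleftrightarrow> subfield K CC \<and> (\<forall>x\<in>K. algebraic x) \<and>
     (\<forall>p :: rat poly. Factorial_Ring.irreducible p \<longrightarrow>
        (\<exists>x\<in>K. poly (map_poly of_rat p) x = 0) \<longrightarrow>
        (\<forall>z. poly (map_poly of_rat p) z = 0 \<longrightarrow> z \<in> K))"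

definition normal_closure :: "complex set \<Rightarrow> complex set" where
  "normal_closure L = \<Inter>{K. normal_over_rat K \<and> L \<subseteq> K}"

text \<open>Every field automorphism of \<open>K\<close> fixes the prime field \<open>\<rat>\<close>. Elements are taken as functions
  on all of \<open>\<complex>\<close>, whose values outside \<open>K\<close> carry no meaning.\<close>

definition Gal :: "complex set \<Rightarrow> (complex \<Rightarrow> complex) set" where
  "Gal K = ring_iso (CC\<lparr>carrier := K\<rparr>) (CC\<lparr>carrier := K\<rparr>)"

section \<open>Matrices\<close>

definition mat_inv :: "complex mat \<Rightarrow> complex mat" where
  "mat_inv A = the (mat_inverse A)"

definition unitary_mat :: "nat \<Rightarrow> complex mat \<Rightarrow> bool" where
  "unitary_mat n A \<longleftrightarrow> A \<in> carrier_mat n n \<and>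
     mat_adjoint A * A = 1\<^sub>m n \<and> A * mat_adjoint A = 1\<^sub>m n"

text \<open>Invertibility of a matrix with rows indexed by \<open>I\<close> and columns indexed by \<open>J\<close>.\<close>

definition invertible_on :: "'i set \<Rightarrow> 'j set \<Rightarrow> ('i \<Rightarrow> 'j \<Rightarrow> complex) \<Rightarrow> bool" where
  "invertible_on I J M \<longleftrightarrow> (\<exists>W.
     (\<forall>i\<in>I. \<forall>i'\<in>I. (\<Sum>j\<in>J. M i j * W j i') = of_bool (i = i')) \<and>
     (\<forall>j\<in>J. \<forall>j'\<in>J. (\<Sum>i\<in>I. W j i * M i j') = of_bool (j = j')))"

section \<open>Modular tensor categories in terms of F and R symbols\<close>

text \<open>
  Anyons are the elements of a finite type. The vectors \<open>|a,b,c;\<mu>\<rangle>\<close> with \<open>\<mu> < N\<^sub>a\<^sub>b\<^sup>c\<close> form the chosen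
  basis of the fusion space of \<open>a, b, c\<close>. Conventions:

  \<^item> \<open>|a,b,e;\<alpha>\<rangle>|e,c,d;\<beta>\<rangle> = \<Sum> (F\<^sub>a\<^sub>b\<^sub>c\<^sup>d) (e,\<alpha>,\<beta>) (f,\<mu>,\<nu>) |b,c,f;\<mu>\<rangle>|a,f,d;\<nu>\<rangle>\<close>, summed over \<open>f, \<mu>, \<nu>\<close>;
  \<^item> the braiding sends \<open>|b,a,c;\<mu>\<rangle>\<close> to \<open>\<Sum> (R\<^sub>a\<^sub>b\<^sup>c) (\<mu>,\<nu>) |a,b,c;\<nu>\<rangle>\<close>, summed over \<open>\<nu>\<close>.

  These are forced by the index structure of the symmetry equations below. Values of \<open>Fsym\<close>
  outside the admissible indices carry no meaning.
\<close>

record 'a mtc_data =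
  fus  :: "'a \<Rightarrow> 'a \<Rightarrow> 'a \<Rightarrow> nat"
  unt  :: 'a
  Fsym :: "'a \<Rightarrow> 'a \<Rightarrow> 'a \<Rightarrow> 'a \<Rightarrow> 'a \<times> nat \<times> nat \<Rightarrow> 'a \<times> nat \<times> nat \<Rightarrow> complex"
  Rsym :: "'a \<Rightarrow> 'a \<Rightarrow> 'a \<Rightarrow> complex mat"
  piv  :: "'a \<Rightarrow> int"

definition left_idx :: "'a mtc_data \<Rightarrow> 'a \<Rightarrow> 'a \<Rightarrow> 'a \<Rightarrow> 'a \<Rightarrow> ('a \<times> nat \<times> nat) set" where
  "left_idx C a b c d = {(e, \<alpha>, \<beta>). \<alpha> < fus C a b e \<and> \<beta> < fus C e c d}"

definition right_idx :: "'a mtc_data \<Rightarrow> 'a \<Rightarrow> 'a \<Rightarrow> 'a \<Rightarrow> 'a \<Rightarrow> ('a \<times> nat \<times> nat) set" where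
  "right_idx C a b c d = {(f, \<mu>, \<nu>). \<mu> < fus C b c f \<and> \<nu> < fus C a f d}"

definition dual :: "'a mtc_data \<Rightarrow> 'a \<Rightarrow> 'a" where
  "dual C a = (THE b. fus C a b (unt C) = 1)"

definition fusion_rules :: "'a::finite mtc_data \<Rightarrow> bool" where
  "fusion_rules C \<longleftrightarrow>
     (\<forall>a b. fus C (unt C) a b = of_bool (a = b) \<and> fus C a (unt C) b = of_bool (a = b)) \<and>
     (\<forall>a b c d. (\<Sum>e\<in>UNIV. fus C a b e * fus C e c d) = (\<Sum>f\<in>UNIV. fus C b c f * fus C a f d)) \<and>
     (\<forall>a b c. fus C a b c = fus C b a c) \<and>
     (\<forall>a. \<exists>b. \<forall>c. fus C a c (unt C) = of_bool (c = b))"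

definition pentagon :: "'a::finite mtc_data \<Rightarrow> bool" where
  "pentagon C \<longleftrightarrow> (\<forall>a b c d e f g k l \<alpha> \<beta> \<gamma> \<delta> \<eta> \<kappa>.
     \<alpha> < fus C a b f \<longrightarrow> \<beta> < fus C f c g \<longrightarrow> \<gamma> < fus C g d e \<longrightarrow>
     \<delta> < fus C c d l \<longrightarrow> \<eta> < fus C b l k \<longrightarrow> \<kappa> < fus C a k e \<longrightarrow>
     (\<Sum>\<nu><fus C f l e. Fsym C f c d e (g, \<beta>, \<gamma>) (l, \<delta>, \<nu>) * Fsym C a b l e (f, \<alpha>, \<nu>) (k, \<eta>, \<kappa>)) =
     (\<Sum>h\<in>UNIV. \<Sum>\<sigma><fus C b c h. \<Sum>\<psi><fus C a h g. \<Sum>\<rho><fus C h d k.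
        Fsym C a b c g (f, \<alpha>, \<beta>) (h, \<sigma>, \<psi>) * Fsym C a h d e (g, \<psi>, \<gamma>) (k, \<rho>, \<kappa>) *
        Fsym C b c d k (h, \<sigma>, \<rho>) (l, \<delta>, \<eta>)))"

text \<open>The basis vectors \<open>|1,a,a\<rangle>\<close> and \<open>|a,1,a\<rangle>\<close> are the unit isomorphisms, so that F symbols with a
  unit among \<open>a, b, c\<close> are trivial.\<close>

definition unit_triangle :: "'a mtc_data \<Rightarrow> bool" where
  "unit_triangle C \<longleftrightarrow> (\<forall>a b d. \<forall>i < fus C a b d. \<forall>j < fus C a b d.
     Fsym C (unt C) a b d (a, 0, i) (d, j, 0) = of_bool (i = j) \<and>
     Fsym C a (unt C) b d (a, 0, i) (b, 0, j) = of_bool (i = j) \<and>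
     Fsym C a b (unt C) d (d, i, 0) (b, 0, j) = of_bool (i = j))"

definition hexagon :: "'a::finite mtc_data \<Rightarrow> ('a \<Rightarrow> 'a \<Rightarrow> 'a \<Rightarrow> complex mat) \<Rightarrow> bool" where
  "hexagon C B \<longleftrightarrow> (\<forall>a b c d e g \<alpha> \<beta> \<mu> \<nu>.
     \<alpha> < fus C c a e \<longrightarrow> \<beta> < fus C e b d \<longrightarrow> \<mu> < fus C b c g \<longrightarrow> \<nu> < fus C a g d \<longrightarrow>
     (\<Sum>\<eta><fus C a c e. \<Sum>\<gamma><fus C c b g.
        B a c e $$ (\<alpha>, \<eta>) * Fsym C a c b d (e, \<eta>, \<beta>) (g, \<gamma>, \<nu>) * B b c g $$ (\<gamma>, \<mu>)) =
     (\<Sum>f\<in>UNIV. \<Sum>\<delta><fus C a b f. \<Sum>\<sigma><fus C c f d. \<Sum>\<psi><fus C f c d.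
        Fsym C c a b d (e, \<alpha>, \<beta>) (f, \<delta>, \<sigma>) * B f c d $$ (\<sigma>, \<psi>) *
        Fsym C a b c d (f, \<delta>, \<psi>) (g, \<mu>, \<nu>)))"

text \<open>The \<open>(1,1)\<close> entry of \<open>F\<close> for the triple \<open>a, a*, a\<close>; its nonvanishing says that \<open>a*\<close> is a dual of \<open>a\<close>.\<close>

definition F11 :: "'a mtc_data \<Rightarrow> 'a \<Rightarrow> complex" where
  "F11 C a = Fsym C a (dual C a) a a (unt C, 0, 0) (unt C, 0, 0)"

definition qdim :: "'a mtc_data \<Rightarrow> 'a \<Rightarrow> complex" where
  "qdim C a = of_int (piv C a) / F11 C a"

text \<open>The product of three F matrices is the action on \<open>V\<^sub>a\<^sub>b\<^sup>c\<close> of the double dual functor (rotation of a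
  trivalent vertex by a full turn), which the pivotal coefficients have to trivialize. In general
  this reads \<open>\<epsilon>\<^sub>a\<^sup>-\<^sup>1 \<epsilon>\<^sub>b\<^sup>-\<^sup>1 \<epsilon>\<^sub>c\<close>. Sphericality is the equality of the dimensions of \<open>a\<close> and \<open>a*\<close>.\<close>

definition spherical_pivotal :: "'a mtc_data \<Rightarrow> bool" where
  "spherical_pivotal C \<longleftrightarrow>
     (\<forall>a. piv C a \<in> {1, -1}) \<and>
     (\<forall>a. F11 C a \<noteq> 0) \<and>
     (\<forall>a b c. \<forall>\<alpha> < fus C a b c. \<forall>\<alpha>' < fus C a b c.
        (\<Sum>\<mu><fus C b (dual C c) (dual C a). \<Sum>\<nu><fus C (dual C c) a (dual C b).
           Fsym C a b (dual C c) (unt C) (c, \<alpha>, 0) (dual C a, \<mu>, 0) *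
           Fsym C b (dual C c) a (unt C) (dual C a, \<mu>, 0) (dual C b, \<nu>, 0) *
           Fsym C (dual C c) a b (unt C) (dual C b, \<nu>, 0) (c, \<alpha>', 0)) =
        of_int (piv C a * piv C b * piv C c) * of_bool (\<alpha> = \<alpha>')) \<and>
     (\<forall>a. qdim C (dual C a) = qdim C a)"

text \<open>The S matrix is the quantum trace of the double braiding of \<open>a\<close> and \<open>b\<close>, divided by the total
  quantum dimension.\<close>

definition Smat :: "'a::finite mtc_data \<Rightarrow> 'a \<Rightarrow> 'a \<Rightarrow> complex" where
  "Smat C a b = (\<Sum>c\<in>UNIV. qdim C c * (\<Sum>i<fus C b a c. (Rsym C a b c * Rsym C b a c) $$ (i, i))) /
     csqrt (\<Sum>c\<in>UNIV. (qdim C c)\<^sup>2)"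

definition modular_tensor_category :: "'a::finite mtc_data \<Rightarrow> bool" where
  "modular_tensor_category C \<longleftrightarrow>
     fusion_rules C \<and>
     (\<forall>a b c d. invertible_on (left_idx C a b c d) (right_idx C a b c d) (Fsym C a b c d)) \<and>
     pentagon C \<and> unit_triangle C \<and>
     (\<forall>a b c. Rsym C a b c \<in> carrier_mat (fus C b a c) (fus C a b c) \<and> invertible_mat (Rsym C a b c)) \<and>
     hexagon C (Rsym C) \<and> hexagon C (\<lambda>a b c. mat_inv (Rsym C b a c)) \<and>
     spherical_pivotal C \<and>
     invertible_on UNIV UNIV (Smat C)"

definition FR_entries :: "'a mtc_data \<Rightarrow> complex set" where
  "FR_entries C =
     {Fsym C a b c d i j | a b c d i j. i \<in> left_idx C a b c d \<and> j \<in> right_idx C a b c d} \<union>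
     (\<Union>a b c. elements_mat (Rsym C a b c))"

definition Galois_field :: "'a mtc_data \<Rightarrow> complex set" where
  "Galois_field C = normal_closure (generate_field CC (FR_entries C))"

definition Galois_conjugate :: "(complex \<Rightarrow> complex) \<Rightarrow> 'a mtc_data \<Rightarrow> 'a mtc_data" where
  "Galois_conjugate q C = C\<lparr>
     Fsym := \<lambda>a b c d i j. q (Fsym C a b c d i j),
     Rsym := \<lambda>a b c. map_mat q (Rsym C a b c)\<rparr>"

section \<open>0-form symmetry\<close>

record 'a sym =
  anti  :: bool
  sperm :: "'a \<Rightarrow> 'a"
  smat  :: "'a \<Rightarrow> 'a \<Rightarrow> 'a \<Rightarrow> complex mat"

definition Kc :: "'a sym \<Rightarrow> complex \<Rightarrow> complex" where
  "Kc g x = (if anti g then cnj x else x)"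

definition preserves_R :: "'a mtc_data \<Rightarrow> 'a sym \<Rightarrow> bool" where
  "preserves_R C g \<longleftrightarrow> (\<forall>a b c.
     smat g (sperm g b) (sperm g a) (sperm g c) * Rsym C (sperm g a) (sperm g b) (sperm g c) *
       mat_inv (smat g (sperm g a) (sperm g b) (sperm g c)) =
     map_mat (Kc g) (Rsym C a b c))"

definition preserves_F :: "'a mtc_data \<Rightarrow> 'a sym \<Rightarrow> bool" where
  "preserves_F C g \<longleftrightarrow> (\<forall>a b c d e f \<alpha> \<beta> \<mu> \<nu>.
     (e, \<alpha>, \<beta>) \<in> left_idx C a b c d \<longrightarrow> (f, \<mu>, \<nu>) \<in> right_idx C a b c d \<longrightarrow>
     (let ga = sperm g a; gb = sperm g b; gc = sperm g c; gd = sperm g d; ge = sperm g e; gf = sperm g f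
      in \<Sum>\<alpha>'<fus C ga gb ge. \<Sum>\<beta>'<fus C ge gc gd. \<Sum>\<mu>'<fus C gb gc gf. \<Sum>\<nu>'<fus C ga gf gd.
           smat g ga gb ge $$ (\<alpha>, \<alpha>') * smat g ge gc gd $$ (\<beta>, \<beta>') *
           Fsym C ga gb gc gd (ge, \<alpha>', \<beta>') (gf, \<mu>', \<nu>') *
           mat_inv (smat g gb gc gf) $$ (\<mu>', \<mu>) * mat_inv (smat g ga gf gd) $$ (\<nu>', \<nu>)) =
     Kc g (Fsym C a b c d (e, \<alpha>, \<beta>) (f, \<mu>, \<nu>)))"

definition syms :: "'a mtc_data \<Rightarrow> 'a sym set" where
  "syms C = {g. bij (sperm g) \<and>
     (\<forall>a b c. fus C (sperm g a) (sperm g b) (sperm g c) = fus C a b c) \<and>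
     (\<forall>a b c. unitary_mat (fus C a b c) (smat g a b c)) \<and>
     preserves_R C g \<and> preserves_F C g}"

definition sym_id :: "'a mtc_data \<Rightarrow> 'a sym" where
  "sym_id C = \<lparr>anti = False, sperm = id, smat = \<lambda>a b c. 1\<^sub>m (fus C a b c)\<rparr>"

text \<open>Composition of the (anti)linear maps \<open>g|a,b,c;\<mu>\<rangle> = \<Sum> U\<^sub>g(g a, g b, g c)\<^sub>\<mu>\<^sub>\<mu>\<^sub>' K\<^sup>g |g a,g b,g c;\<mu>'\<rangle>\<close>, \<open>h\<close> acting first.\<close>

definition sym_comp :: "'a sym \<Rightarrow> 'a sym \<Rightarrow> 'a sym" where
  "sym_comp g h = \<lparr>anti = (anti g \<noteq> anti h), sperm = sperm g \<circ> sperm h,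
     smat = \<lambda>a b c.
       map_mat (Kc g) (smat h (inv_into UNIV (sperm g) a) (inv_into UNIV (sperm g) b) (inv_into UNIV (sperm g) c)) * smat g a b c\<rparr>"

definition nat_iso :: "'a mtc_data \<Rightarrow> ('a sym \<times> 'a sym) set" where
  "nat_iso C = {(g, h). g \<in> syms C \<and> h \<in> syms C \<and> anti g = anti h \<and> sperm g = sperm h \<and>
     (\<exists>\<gamma>. (\<forall>a. cmod (\<gamma> a) = 1) \<and>
          (\<forall>a b c. smat h a b c = (\<gamma> a * \<gamma> b / \<gamma> c) \<cdot>\<^sub>m smat g a b c))}"

definition zero_form_group :: "'a mtc_data \<Rightarrow> 'a sym set monoid" where
  "zero_form_group C = \<lparr>
     carrier = syms C // nat_iso C,
     monoid.mult = (\<lambda>x y. \<Union>g\<in>x. \<Union>h\<in>y. nat_iso C `` {sym_comp g h}),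
     one = nat_iso C `` {sym_id C}\<rparr>"

section \<open>1-form symmetry\<close>

definition one_form_group :: "'a mtc_data \<Rightarrow> 'a monoid" where
  "one_form_group C = \<lparr>
     carrier = {a. \<exists>b. \<forall>c. fus C a b c = of_bool (c = unt C)},
     monoid.mult = (\<lambda>a b. THE c. fus C a b c \<noteq> 0),
     one = unt C\<rparr>"

text \<open>All members of a class in \<open>G\<close> have the same underlying permutation.\<close>

definition perm_action :: "'a mtc_data \<Rightarrow> 'a sym set \<Rightarrow> 'a \<Rightarrow> 'a" where
  "perm_action C x = restrict (the_elem (sperm ` x)) (carrier (one_form_group C))"

section \<open>Twisted group cohomology in degree three\<close>

definition cochains2 :: "'g monoid \<Rightarrow> 'b monoid \<Rightarrow> ('g \<times> 'g \<Rightarrow> 'b) monoid" where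
  "cochains2 G A = product_group (carrier G \<times> carrier G) (\<lambda>_. A)"

definition cochains3 :: "'g monoid \<Rightarrow> 'b monoid \<Rightarrow> ('g \<times> 'g \<times> 'g \<Rightarrow> 'b) monoid" where
  "cochains3 G A = product_group (carrier G \<times> carrier G \<times> carrier G) (\<lambda>_. A)"

definition cochains4 :: "'g monoid \<Rightarrow> 'b monoid \<Rightarrow> ('g \<times> 'g \<times> 'g \<times> 'g \<Rightarrow> 'b) monoid" where
  "cochains4 G A = product_group (carrier G \<times> carrier G \<times> carrier G \<times> carrier G) (\<lambda>_. A)"

definition coboundary2 ::
  "'g monoid \<Rightarrow> 'b monoid \<Rightarrow> ('g \<Rightarrow> 'b \<Rightarrow> 'b) \<Rightarrow> ('g \<times> 'g \<Rightarrow> 'b) \<Rightarrow> 'g \<times> 'g \<times> 'g \<Rightarrow> 'b" where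
  "coboundary2 G A \<rho> b = (\<lambda>(g, h, k) \<in> carrier G \<times> carrier G \<times> carrier G.
     \<rho> g (b (h, k)) \<otimes>\<^bsub>A\<^esub> inv\<^bsub>A\<^esub> b (g \<otimes>\<^bsub>G\<^esub> h, k) \<otimes>\<^bsub>A\<^esub> b (g, h \<otimes>\<^bsub>G\<^esub> k) \<otimes>\<^bsub>A\<^esub> inv\<^bsub>A\<^esub> b (g, h))"

definition coboundary3 ::
  "'g monoid \<Rightarrow> 'b monoid \<Rightarrow> ('g \<Rightarrow> 'b \<Rightarrow> 'b) \<Rightarrow> ('g \<times> 'g \<times> 'g \<Rightarrow> 'b) \<Rightarrow> 'g \<times> 'g \<times> 'g \<times> 'g \<Rightarrow> 'b" where
  "coboundary3 G A \<rho> b = (\<lambda>(g, h, k, l) \<in> carrier G \<times> carrier G \<times> carrier G \<times> carrier G.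
     \<rho> g (b (h, k, l)) \<otimes>\<^bsub>A\<^esub> inv\<^bsub>A\<^esub> b (g \<otimes>\<^bsub>G\<^esub> h, k, l) \<otimes>\<^bsub>A\<^esub> b (g, h \<otimes>\<^bsub>G\<^esub> k, l)
       \<otimes>\<^bsub>A\<^esub> inv\<^bsub>A\<^esub> b (g, h, k \<otimes>\<^bsub>G\<^esub> l) \<otimes>\<^bsub>A\<^esub> b (g, h, k))"

definition H3 ::
  "'g monoid \<Rightarrow> 'b monoid \<Rightarrow> ('g \<Rightarrow> 'b \<Rightarrow> 'b) \<Rightarrow> ('g \<times> 'g \<times> 'g \<Rightarrow> 'b) set monoid" where
  "H3 G A \<rho> =
     (cochains3 G A)\<lparr>carrier := kernel (cochains3 G A) (cochains4 G A) (coboundary3 G A \<rho>)\<rparr>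
       Mod (coboundary2 G A \<rho> ` carrier (cochains2 G A))"

section \<open>The Postnikov class\<close>

definition normalized_section :: "'a mtc_data \<Rightarrow> ('a sym set \<Rightarrow> 'a sym) \<Rightarrow> bool" where
  "normalized_section C s \<longleftrightarrow>
     (\<forall>x \<in> carrier (zero_form_group C). s x \<in> x \<and>
        (\<forall>a c. smat (s x) (unt C) a c = 1\<^sub>m (fus C (unt C) a c) \<and>
               smat (s x) a (unt C) c = 1\<^sub>m (fus C a (unt C) c))) \<and>
     s \<one>\<^bsub>zero_form_group C\<^esub> = sym_id C"

definition normalized_phases ::
  "'a mtc_data \<Rightarrow> ('a sym set \<Rightarrow> 'a sym) \<Rightarrow> ('a \<Rightarrow> 'a sym set \<Rightarrow> 'a sym set \<Rightarrow> complex) \<Rightarrow> bool" where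
  "normalized_phases C s \<gamma> \<longleftrightarrow> (let G = zero_form_group C in
     \<forall>g \<in> carrier G. \<forall>h \<in> carrier G.
       \<gamma> (unt C) g h = 1 \<and>
       (\<forall>a. cmod (\<gamma> a g h) = 1 \<and> \<gamma> a \<one>\<^bsub>G\<^esub> h = 1 \<and> \<gamma> a g \<one>\<^bsub>G\<^esub> = 1) \<and>
       (\<forall>a b c. fus C a b c \<noteq> 0 \<longrightarrow>
         (\<gamma> a g h * \<gamma> b g h / \<gamma> c g h) \<cdot>\<^sub>m 1\<^sub>m (fus C a b c) =
         mat_inv (smat (s g) a b c) *
         map_mat (Kc (s g)) (mat_inv (smat (s h) (inv_into UNIV (sperm (s g)) a) (inv_into UNIV (sperm (s g)) b) (inv_into UNIV (sperm (s g)) c))) *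
         smat (s (g \<otimes>\<^bsub>G\<^esub> h)) a b c))"

definition Omega ::
  "'a mtc_data \<Rightarrow> ('a sym set \<Rightarrow> 'a sym) \<Rightarrow> ('a \<Rightarrow> 'a sym set \<Rightarrow> 'a sym set \<Rightarrow> complex) \<Rightarrow>
   'a \<Rightarrow> 'a sym set \<Rightarrow> 'a sym set \<Rightarrow> 'a sym set \<Rightarrow> complex" where
  "Omega C s \<gamma> a g h k = (let G = zero_form_group C in
     Kc (s g) (\<gamma> (inv_into UNIV (sperm (s g)) a) h k) * \<gamma> a g (h \<otimes>\<^bsub>G\<^esub> k) /
     (\<gamma> a (g \<otimes>\<^bsub>G\<^esub> h) k * \<gamma> a g h))"

text \<open>The functions \<open>\<beta>\<close> arising from all possible choices of representatives and phases.\<close>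

definition postnikov_cocycles :: "'a::finite mtc_data \<Rightarrow> ('a sym set \<times> 'a sym set \<times> 'a sym set \<Rightarrow> 'a) set" where
  "postnikov_cocycles C = (let G = zero_form_group C; A = one_form_group C; S = Smat C; u = unt C in
     {\<beta> \<in> carrier (cochains3 G A). \<exists>s \<gamma>. normalized_section C s \<and> normalized_phases C s \<gamma> \<and>
        (\<forall>g \<in> carrier G. \<forall>h \<in> carrier G. \<forall>k \<in> carrier G. \<forall>a.
           Omega C s \<gamma> a g h k =
           S a (\<beta> (g, h, k)) * S u u / (S u (\<beta> (g, h, k)) * S u a))})"

text \<open>All admissible choices give rise to the same element \<open>[\<beta>]\<close> of \<open>H3\<close>. As elements of \<open>H3\<close> are cosets,
  the union below is just this element.\<close>

definition postnikov_class :: "'a::finite mtc_data \<Rightarrow> ('a sym set \<times> 'a sym set \<times> 'a sym set \<Rightarrow> 'a) set" where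
  "postnikov_class C =
     \<Union>{c \<in> carrier (H3 (zero_form_group C) (one_form_group C) (perm_action C)).
         \<exists>\<beta> \<in> postnikov_cocycles C. \<beta> \<in> c}"

section \<open>2-group symmetry\<close>

record ('g, 'b) two_group =
  zero_form :: "'g monoid"
  one_form :: "'b monoid"
  act :: "'g \<Rightarrow> 'b \<Rightarrow> 'b"
  postnikov :: "('g \<times> 'g \<times> 'g \<Rightarrow> 'b) set"

definition two_group_symmetry :: "'a::finite mtc_data \<Rightarrow> ('a sym set, 'a) two_group" where
  "two_group_symmetry C = \<lparr>zero_form = zero_form_group C, one_form = one_form_group C,
     act = perm_action C, postnikov = postnikov_class C\<rparr>"

text \<open>Transport of a 3-cochain along isomorphisms \<open>\<phi> : G \<rightarrow> G'\<close> and \<open>\<psi> : A \<rightarrow> A'\<close>.\<close>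

definition transport3 ::
  "'g monoid \<Rightarrow> 'h monoid \<Rightarrow> ('g \<Rightarrow> 'h) \<Rightarrow> ('b \<Rightarrow> 'c) \<Rightarrow> ('g \<times> 'g \<times> 'g \<Rightarrow> 'b) \<Rightarrow> 'h \<times> 'h \<times> 'h \<Rightarrow> 'c" where
  "transport3 G G' \<phi> \<psi> \<beta> = (let \<phi>' = inv_into (carrier G) \<phi> in
     (\<lambda>(g, h, k) \<in> carrier G' \<times> carrier G' \<times> carrier G'. \<psi> (\<beta> (\<phi>' g, \<phi>' h, \<phi>' k))))"

definition two_group_isomorphic :: "('g, 'b) two_group \<Rightarrow> ('h, 'c) two_group \<Rightarrow> bool" where
  "two_group_isomorphic T T' \<longleftrightarrow>
     (\<exists>\<phi> \<in> iso (zero_form T) (zero_form T'). \<exists>\<psi> \<in> iso (one_form T) (one_form T').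
        (\<forall>g \<in> carrier (zero_form T). \<forall>a \<in> carrier (one_form T).
           \<psi> (act T g a) = act T' (\<phi> g) (\<psi> a)) \<and>
        transport3 (zero_form T) (zero_form T') \<phi> \<psi> ` postnikov T = postnikov T')"

end

theory Submission
  imports Defs "HOL-Analysis.Continuum_Not_Denumerable"
begin

text \<open>The automorphism \<open>q\<close> extends to an automorphism \<open>\<sigma>\<close> of the algebraic numbers, which commutes with complex
  conjugation on CM numbers. Hence \<open>\<sigma>\<close> applied to CM representatives turns unitary and anti-unitary symmetries
  of \<open>C\<close> into symmetries of \<open>q(C)\<close>, giving an injective homomorphism of 0-form symmetry groups.

  Surjectivity is not formal, since nothing is assumed about representatives for \<open>q(C)\<close>. A symmetry of \<open>q(C)\<close> is
  pulled back along an embedding of a larger field to a possibly non-unitary solution \<open>U\<close> of the equations for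
  \<open>C\<close>. The imaginary powers of \<open>Q = U\<^sup>* U\<close> are unitary symmetries of \<open>C\<close>. As there are uncountably many of them,
  but only countably many CM matrices, \<open>Q\<close> must be a gauge transformation, so \<open>U\<close> can be rescaled to a unitary.

  Given a CM section of the symmetries, the phases \<open>\<gamma>\<close> are CM numbers as well, because the fusion rules make
  them torsion modulo any field containing their coboundaries. So \<open>\<sigma>\<close> maps \<open>\<Omega>\<close> for \<open>C\<close> to \<open>\<Omega>\<close> for \<open>q(C)\<close>, as it
  does with the braiding phases in which \<open>\<Omega>\<close> is expressed, and the same \<open>\<beta>\<close> works for both.\<close>

section \<open>Embeddings of subfields of the complex numbers\<close>

text \<open>The entries of the matrices \<open>U_g\<close> lie in a CM field that need not be
  contained in K_C, so q itself cannot be applied to them; hence its extension to all algebraic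
  numbers, any choice of which will do. A fixed CM field is too small as well, since the phases
  \<gamma> are only known to be roots of its elements; the union of all CM fields is closed under
  roots of modulus one. A symmetry of q(C) may have transcendental entries. Embeddings are therefore
  extended over countable fields: there are only finitely many entries, and over a countable field a
  transcendental number can be sent to any number outside a countable set of forbidden roots. The
  price is that such embeddings need not commute with complex conjugation, so unitarity is lost and
  has to be restored. Once the symmetries of q(C) are known to have CM representatives, the
  hypotheses are symmetric in C and q(C); the inverse map of groups and the reverse inclusion of
  Postnikov classes come from the exchanged pair. Anyons are not moved, so the isomorphism of 1-form
  groups is the identity.\<close>

locale complex_embedding =
  fixes E :: "complex set" and \<tau> :: "complex \<Rightarrow> complex"
  assumes one_mem: "1 \<in> E"
    and add_mem: "\<And>x y. x \<in> E \<Longrightarrow> y \<in> E \<Longrightarrow> x + y \<in> E"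
    and uminus_mem: "\<And>x. x \<in> E \<Longrightarrow> - x \<in> E"
    and mult_mem: "\<And>x y. x \<in> E \<Longrightarrow> y \<in> E \<Longrightarrow> x * y \<in> E"
    and inverse_mem: "\<And>x. x \<in> E \<Longrightarrow> inverse x \<in> E"
    and hom_add: "\<And>x y. x \<in> E \<Longrightarrow> y \<in> E \<Longrightarrow> \<tau> (x + y) = \<tau> x + \<tau> y"
    and hom_mult: "\<And>x y. x \<in> E \<Longrightarrow> y \<in> E \<Longrightarrow> \<tau> (x * y) = \<tau> x * \<tau> y"
    and hom_one: "\<tau> 1 = 1"
begin

lemma zero_mem: "0 \<in> E"
  using add_mem[OF one_mem uminus_mem[OF one_mem]] by simp

lemma diff_mem: "x \<in> E \<Longrightarrow> y \<in> E \<Longrightarrow> x - y \<in> E"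
  using add_mem[OF _ uminus_mem] by simp

lemma divide_mem: "x \<in> E \<Longrightarrow> y \<in> E \<Longrightarrow> x / y \<in> E"
  using mult_mem[OF _ inverse_mem] by (simp add: divide_inverse)

lemma power_mem: "x \<in> E \<Longrightarrow> x ^ n \<in> E"
  by (induction n) (auto intro: one_mem mult_mem)

lemma sum_mem: "(\<And>i. i \<in> I \<Longrightarrow> f i \<in> E) \<Longrightarrow> sum f I \<in> E"
  by (induction I rule: infinite_finite_induct) (auto intro: zero_mem add_mem)

lemma of_nat_mem: "of_nat n \<in> E"
  by (induction n) (auto intro: zero_mem one_mem add_mem)

lemma of_int_mem: "of_int n \<in> E"
  by (cases n) (auto intro!: of_nat_mem uminus_mem diff_mem one_mem simp del: of_nat_Suc)

lemma Rats_subset: "\<rat> \<subseteq> E"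
  by (auto elim!: Rats_cases' intro!: divide_mem of_int_mem)

lemmas closed = zero_mem one_mem add_mem uminus_mem mult_mem inverse_mem diff_mem divide_mem
  power_mem sum_mem of_nat_mem of_int_mem

lemma hom_zero: "\<tau> 0 = 0"
  using hom_add[OF zero_mem zero_mem] by simp

lemma hom_uminus: "x \<in> E \<Longrightarrow> \<tau> (- x) = - \<tau> x"
  using hom_add[of x "- x"] uminus_mem[of x] hom_zero by (simp add: eq_neg_iff_add_eq_0 add.commute)

lemma hom_diff: "x \<in> E \<Longrightarrow> y \<in> E \<Longrightarrow> \<tau> (x - y) = \<tau> x - \<tau> y"
  using hom_add[of x "- y"] uminus_mem[of y] hom_uminus[of y] by simp

lemma hom_eq_0_iff: "x \<in> E \<Longrightarrow> \<tau> x = 0 \<longleftrightarrow> x = 0"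
  using hom_mult[of x "inverse x"] inverse_mem[of x] hom_zero hom_one by (cases "x = 0") auto

lemma inj: "inj_on \<tau> E"
  by (rule inj_onI) (metis diff_mem eq_iff_diff_eq_0 hom_diff hom_eq_0_iff)

lemma hom_inverse: "x \<in> E \<Longrightarrow> \<tau> (inverse x) = inverse (\<tau> x)"
  using hom_mult[of x "inverse x"] inverse_mem[of x] hom_zero hom_one
  by (cases "x = 0") (auto simp: inverse_unique)

lemma hom_divide: "x \<in> E \<Longrightarrow> y \<in> E \<Longrightarrow> \<tau> (x / y) = \<tau> x / \<tau> y"
  by (simp add: divide_inverse hom_mult inverse_mem hom_inverse)

lemma hom_power: "x \<in> E \<Longrightarrow> \<tau> (x ^ n) = \<tau> x ^ n"
  by (induction n) (auto simp: hom_one hom_mult power_mem)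

lemma hom_sum: "(\<And>i. i \<in> I \<Longrightarrow> f i \<in> E) \<Longrightarrow> \<tau> (sum f I) = (\<Sum>i\<in>I. \<tau> (f i))"
  by (induction I rule: infinite_finite_induct) (auto simp: hom_zero hom_add sum_mem)

lemma hom_of_nat: "\<tau> (of_nat n) = of_nat n"
  by (induction n) (auto simp: hom_zero hom_one hom_add one_mem of_nat_mem)

lemma hom_of_int: "\<tau> (of_int n) = of_int n"
  by (cases n)
    (auto simp: hom_of_nat hom_uminus of_nat_mem hom_one one_mem hom_diff uminus_mem simp del: of_nat_Suc)

lemma hom_Rats: "x \<in> \<rat> \<Longrightarrow> \<tau> x = x"
  by (auto elim!: Rats_cases' simp: hom_divide of_int_mem hom_of_int)

lemmas homs = hom_zero hom_one hom_add hom_uminus hom_mult hom_inverse hom_diff hom_divide hom_power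
  hom_sum hom_of_nat hom_of_int

text \<open>Values of \<tau> outside \<open>E\<close> are unconstrained, so an embedding may be
  replaced by any function agreeing with it on \<open>E\<close>. This lets a single glued function
  serve all stages of a tower.\<close>

lemma cong: "(\<And>x. x \<in> E \<Longrightarrow> \<tau>' x = \<tau> x) \<Longrightarrow> complex_embedding E \<tau>'"
  by unfold_locales (auto simp: closed homs)

lemma restrict_domain:
  assumes "complex_embedding F \<rho>" "F \<subseteq> E" shows "complex_embedding F \<tau>"
proof -
  interpret F: complex_embedding F \<rho> by fact
  show ?thesis using assms(2) by unfold_locales (auto simp: F.closed homs subset_iff)
qed

lemma compose:
  assumes "complex_embedding F \<rho>" "\<tau> ` E \<subseteq> F" shows "complex_embedding E (\<rho> \<circ> \<tau>)"
proof -
  interpret F: complex_embedding F \<rho> by fact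
  show ?thesis using assms(2) by unfold_locales (auto simp: closed homs F.homs image_subset_iff)
qed

lemma inverse_embedding: "complex_embedding (\<tau> ` E) (inv_into E \<tau>)"
proof unfold_locales
  show "1 \<in> \<tau> ` E" using hom_one one_mem by (metis imageI)
  fix x y assume "x \<in> \<tau> ` E" "y \<in> \<tau> ` E"
  then obtain a b where ab: "a \<in> E" "b \<in> E" "x = \<tau> a" "y = \<tau> b" by auto
  then have *: "x + y = \<tau> (a + b)" "x * y = \<tau> (a * b)" "a + b \<in> E" "a * b \<in> E" by (auto simp: homs closed)
  then show "x + y \<in> \<tau> ` E" "x * y \<in> \<tau> ` E" by auto
  show "inv_into E \<tau> (x + y) = inv_into E \<tau> x + inv_into E \<tau> y"
    "inv_into E \<tau> (x * y) = inv_into E \<tau> x * inv_into E \<tau> y"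
    using * ab inj by (simp_all only: inv_into_f_f)
next
  fix x assume "x \<in> \<tau> ` E"
  then obtain a where a: "a \<in> E" "x = \<tau> a" by auto
  then have "- x = \<tau> (- a)" "inverse x = \<tau> (inverse a)" "- a \<in> E" "inverse a \<in> E" by (auto simp: homs closed)
  then show "- x \<in> \<tau> ` E" "inverse x \<in> \<tau> ` E" by auto
next
  show "inv_into E \<tau> 1 = 1" using inv_into_f_f[OF inj one_mem] hom_one by simp
qed

text \<open>Where \<tau> commutes with conjugation this twist changes nothing; elsewhere it is in
  general a different embedding. It produces the second solution of the symmetry equations in the
  surjectivity proof, because applying it to an adjoint matrix gives the adjoint of the image under
  \<tau>.\<close>

lemma conjugate_embedding: "complex_embedding (cnj ` E) (\<lambda>x. cnj (\<tau> (cnj x)))"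
  by unfold_locales (auto simp: closed homs one_mem image_iff
      intro: closed bexI[of _ 1] simp flip: complex_cnj_add complex_cnj_mult complex_cnj_minus complex_cnj_inverse)

end

section \<open>Comparison with subfields and ring homomorphisms of \<open>CC\<close>\<close>

lemma CC_sel [simp]:
  "carrier CC = UNIV" "x \<otimes>\<^bsub>CC\<^esub> y = x * y" "\<one>\<^bsub>CC\<^esub> = 1" "\<zero>\<^bsub>CC\<^esub> = 0" "x \<oplus>\<^bsub>CC\<^esub> y = x + y"
  by (auto simp: ring_of_type_algebra_def)

lemma field_CC: "field CC"
  by (rule field_from_type_algebra)

interpretation CC: Ring.domain CC
  by (rule field.axioms(1)[OF field_CC])

lemma CC_a_inv [simp]: "\<ominus>\<^bsub>CC\<^esub> x = - x"
  using CC.minus_equality[of "- x" x] by simp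

lemma CC_m_inv: "x \<noteq> 0 \<Longrightarrow> inv\<^bsub>CC\<^esub> x = inverse x"
  using CC.inv_char[of x "inverse x"] by simp

text \<open>Connects the locale with \<open>embeddings\<close> from the definitions. A subfield
  provides inverses of nonzero elements; the locale asks for all of them, which is harmless as
  \<open>inverse 0 = 0\<close>.\<close>

lemma complex_embedding_iff:
  assumes "subfield E CC"
  shows "complex_embedding E \<tau> \<longleftrightarrow> \<tau> \<in> embeddings E"
proof
  note cl = subringE[OF subfieldE(1)[OF assms], simplified]
  have inv: "inverse x \<in> E" if "x \<in> E" for x
  proof (cases "x = 0")
    case False
    then show ?thesis
      using CC.subfield_m_inv(1)[OF assms, of x] that by (simp add: CC_m_inv)
  qed (use cl in simp)
  show "complex_embedding E \<tau>" if "\<tau> \<in> embeddings E"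
  proof unfold_locales
    fix x y assume "x \<in> E" "y \<in> E"
    then show "x + y \<in> E" "x * y \<in> E" "\<tau> (x + y) = \<tau> x + \<tau> y" "\<tau> (x * y) = \<tau> x * \<tau> y"
      using cl that by (simp_all add: embeddings_def Ring.ring_hom_def)
  next
    fix x assume "x \<in> E"
    then show "- x \<in> E" "inverse x \<in> E" using cl inv by simp_all
  qed (use cl that in \<open>simp_all add: embeddings_def Ring.ring_hom_def\<close>)
  show "\<tau> \<in> embeddings E" if "complex_embedding E \<tau>"
    using complex_embedding.homs[OF that] by (auto simp: embeddings_def Ring.ring_hom_def)
qed

lemma complex_embedding_imp_subfield:
  assumes "complex_embedding E \<tau>" shows "subfield E CC"
proof -
  interpret complex_embedding E \<tau> by fact
  show ?thesis
    by (rule field.subfieldI'[OF field_CC CC.subringI])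
      (auto simp: closed CC_m_inv)
qed

lemma uncountable_UNIV_complex: "uncountable (UNIV :: complex set)"
proof
  assume "countable (UNIV :: complex set)"
  then have "countable (range complex_of_real)" by (rule countable_subset[rotated]) auto
  then have "countable (UNIV :: real set)" by (rule countable_image_inj_on) (auto intro: injI)
  then show False using uncountable_UNIV_real by blast
qed

section \<open>Extension of embeddings to countably many further numbers\<close>

definition polys_over :: "complex set \<Rightarrow> complex poly set" where
  "polys_over E = {p. \<forall>i. coeff p i \<in> E}"

context complex_embedding
begin

lemma coeff_map_poly_hom [simp]: "coeff (map_poly \<tau> p) i = \<tau> (coeff p i)"
  by (simp add: coeff_map_poly hom_zero)

lemma map_poly_const: "map_poly \<tau> [:c:] = [:\<tau> c:]"
  by (rule poly_eqI) (simp add: coeff_pCons hom_zero split: nat.split)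

lemma polys_over_closed:
  assumes "p \<in> polys_over E" "q \<in> polys_over E"
  shows "p + q \<in> polys_over E" "p - q \<in> polys_over E" "p * q \<in> polys_over E"
  using assms by (auto simp: polys_over_def coeff_mult closed)

lemma monom_mem: "c \<in> E \<Longrightarrow> Polynomial.monom c n \<in> polys_over E"
  by (auto simp: polys_over_def closed)

lemma map_poly_hom:
  assumes "p \<in> polys_over E" "q \<in> polys_over E"
  shows "map_poly \<tau> (p + q) = map_poly \<tau> p + map_poly \<tau> q"
    "map_poly \<tau> (p - q) = map_poly \<tau> p - map_poly \<tau> q"
    "map_poly \<tau> (p * q) = map_poly \<tau> p * map_poly \<tau> q"
  using assms by (auto intro!: poly_eqI simp: polys_over_def coeff_mult homs closed)

lemma map_poly_eq_0_iff: "p \<in> polys_over E \<Longrightarrow> map_poly \<tau> p = 0 \<longleftrightarrow> p = 0"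
  by (auto simp: poly_eq_iff polys_over_def hom_eq_0_iff)

lemma degree_map_poly_hom: "p \<in> polys_over E \<Longrightarrow> degree (map_poly \<tau> p) = degree p"
  by (rule degree_map_poly) (auto simp: polys_over_def hom_eq_0_iff)

lemma poly_map_poly_hom:
  assumes "p \<in> polys_over E" "x \<in> E" shows "poly (map_poly \<tau> p) (\<tau> x) = \<tau> (poly p x)"
  using assms by (simp add: poly_altdef degree_map_poly_hom homs closed polys_over_def)

text \<open>Ordinary long division; quotient and remainder keep their coefficients in
  \<open>E\<close> because the leading coefficient of \<open>m\<close> is inverted inside
  \<open>E\<close>.\<close>

lemma polys_over_division:
  assumes "m \<in> polys_over E" "m \<noteq> 0" "p \<in> polys_over E"
  shows "\<exists>k\<in>polys_over E. \<exists>r\<in>polys_over E. p = m * k + r \<and> (r = 0 \<or> degree r < degree m)"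
  using assms(3)
\<comment> \<open>The zero polynomial and the nonzero constants both have \<open>degree\<close> 0;
  the shift by \<open>Suc\<close> makes cancelling a constant to zero a genuine decrease.\<close>
proof (induction "if p = 0 then 0 else Suc (degree p)" arbitrary: p rule: less_induct)
  case less
  show ?case
  proof (cases "p = 0 \<or> degree p < degree m")
    case True
    then show ?thesis using less.prems monom_mem[OF zero_mem, of 0] by force
  next
    case False
    define t where "t = Polynomial.monom (lead_coeff p / lead_coeff m) (degree p - degree m)"
    have t: "t \<in> polys_over E"
      unfolding t_def using assms less.prems by (intro monom_mem divide_mem) (auto simp: polys_over_def)
    have lc: "lead_coeff m \<noteq> 0" using assms by simp
    have "t \<noteq> 0" using False lc by (auto simp: t_def)
    then have deg: "degree (m * t) = degree p"
      using assms False lc by (simp add: degree_mult_eq t_def degree_monom_eq)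
    have "coeff (m * t) (degree p) = coeff p (degree p)"
      using coeff_mult_degree_sum[of m t] lc False by (simp add: t_def degree_monom_eq)
    then have "p - m * t = 0 \<or> degree (p - m * t) < degree p"
      using deg by (metis coeff_diff degree_diff_le dual_order.refl eq_iff_diff_eq_0 le_neq_implies_less leading_coeff_0_iff)
    then have "(if p - m * t = 0 then 0 else Suc (degree (p - m * t))) < (if p = 0 then 0 else Suc (degree p))"
      using False by auto
    moreover have "p - m * t \<in> polys_over E"
      using polys_over_closed assms(1) t less.prems by blast
    ultimately obtain k r where kr: "k \<in> polys_over E" "r \<in> polys_over E" "p - m * t = m * k + r"
      "r = 0 \<or> degree r < degree m"
      using less.hyps[of "p - m * t"] by blast
    then have "p = m * (k + t) + r" by (simp add: algebra_simps)
    then show ?thesis using kr polys_over_closed t by blast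
  qed
qed

lemma countable_polys_over: "countable E \<Longrightarrow> countable (polys_over E)"
proof (rule countable_subset)
  show "polys_over E \<subseteq> Poly ` lists E"
  proof
    fix p assume "p \<in> polys_over E"
    then have "coeffs p \<in> lists E" by (auto simp: polys_over_def coeffs_def)
    then show "p \<in> Poly ` lists E" by (metis Poly_coeffs imageI)
  qed
qed auto

text \<open>The number y is a possible value of \<tau> at x: the polynomials over \<open>E\<close>
  vanishing at x must be those whose conjugates vanish at y. For algebraic x a root of the
  conjugated minimal polynomial works; for transcendental x any y that avoids the roots of all
  conjugated nonzero polynomials, of which there are countably many.\<close>

lemma conjugate_root_exists:
  assumes "countable E"
  shows "\<exists>y. \<forall>p\<in>polys_over E. poly p x = 0 \<longleftrightarrow> poly (map_poly \<tau> p) y = 0"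
proof (cases "\<exists>p\<in>polys_over E. p \<noteq> 0 \<and> poly p x = 0")
  case True
  define m where "m = (ARG_MIN degree p. p \<in> polys_over E \<and> p \<noteq> 0 \<and> poly p x = 0)"
  have m: "m \<in> polys_over E" "m \<noteq> 0" "poly m x = 0"
    and min: "\<And>p. p \<in> polys_over E \<Longrightarrow> p \<noteq> 0 \<Longrightarrow> poly p x = 0 \<Longrightarrow> degree m \<le> degree p"
    using True arg_min_nat_lemma[of "\<lambda>p. p \<in> polys_over E \<and> p \<noteq> 0 \<and> poly p x = 0" _ degree]
    unfolding m_def by blast+
  have "degree m \<noteq> 0" using m by (metis degree_eq_zeroE poly_const_conv pCons_0_0)
  then have "\<not> constant (poly (map_poly \<tau> m))"
    by (simp add: constant_degree degree_map_poly_hom m)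
  then obtain y where y: "poly (map_poly \<tau> m) y = 0"
    using fundamental_theorem_of_algebra by blast
  \<comment> \<open>\<open>n\<close> is the minimal polynomial of y, pulled back to
    \<open>E\<close>. It divides \<open>m\<close>, and it vanishes at x, as otherwise the cofactor
    would contradict the minimality of \<open>m\<close>. This makes both vanishing conditions
    equivalent without discussing irreducibility of the conjugated polynomial.\<close>
  define n where "n = (ARG_MIN degree p. p \<in> polys_over E \<and> p \<noteq> 0 \<and> poly (map_poly \<tau> p) y = 0)"
  have n: "n \<in> polys_over E" "n \<noteq> 0" "poly (map_poly \<tau> n) y = 0"
    and minn: "\<And>p. p \<in> polys_over E \<Longrightarrow> p \<noteq> 0 \<Longrightarrow> poly (map_poly \<tau> p) y = 0 \<Longrightarrow> degree n \<le> degree p"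
    using m y arg_min_nat_lemma[of "\<lambda>p. p \<in> polys_over E \<and> p \<noteq> 0 \<and> poly (map_poly \<tau> p) y = 0" _ degree]
    unfolding n_def by blast+
  have multiple_m: "\<exists>k\<in>polys_over E. p = m * k" if p: "p \<in> polys_over E" "poly p x = 0" for p
  proof -
    obtain k r where kr: "k \<in> polys_over E" "r \<in> polys_over E" "p = m * k + r" "r = 0 \<or> degree r < degree m"
      using polys_over_division[OF m(1,2) p(1)] by blast
    then have "poly r x = 0" using p m by simp
    then have "r = 0" using min kr by force
    then show ?thesis using kr by auto
  qed
  have multiple_n: "\<exists>k\<in>polys_over E. p = n * k" if p: "p \<in> polys_over E" "poly (map_poly \<tau> p) y = 0" for p
  proof -
    obtain k r where kr: "k \<in> polys_over E" "r \<in> polys_over E" "p = n * k + r" "r = 0 \<or> degree r < degree n"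
      using polys_over_division[OF n(1,2) p(1)] by blast
    then have "poly (map_poly \<tau> r) y = 0" using p n by (simp add: map_poly_hom polys_over_closed)
    then have "r = 0" using minn kr by force
    then show ?thesis using kr by auto
  qed
  obtain k where k: "k \<in> polys_over E" "m = n * k" using multiple_n m y by blast
  have "poly n x = 0"
  proof (rule ccontr)
    assume "poly n x \<noteq> 0"
    then have "poly k x = 0" "k \<noteq> 0" using m k by auto
    then have "degree n = 0" using min[of k] k n by (auto simp: degree_mult_eq)
    then obtain c where "n = [:c:]" by (rule degree_eq_zeroE)
    moreover from this have "map_poly \<tau> n = [:\<tau> c:]"
      by (simp add: map_poly_const)
    moreover have "c \<in> E" using n \<open>n = [:c:]\<close> by (auto simp: polys_over_def dest: spec[of _ 0])
    ultimately show False using n by (simp add: hom_eq_0_iff)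
  qed
  then have "poly p x = 0 \<longleftrightarrow> poly (map_poly \<tau> p) y = 0" if "p \<in> polys_over E" for p
    using that multiple_m[of p] multiple_n[of p] m y by (auto simp: map_poly_hom)
  then show ?thesis by blast
next
  case False
  have "countable (\<Union>p\<in>polys_over E - {0}. {y. poly (map_poly \<tau> p) y = 0})"
    using assms countable_polys_over
    by (intro countable_UN) (auto intro!: uncountable_infinite poly_roots_finite countable_finite simp: map_poly_eq_0_iff)
  then obtain y where "y \<notin> (\<Union>p\<in>polys_over E - {0}. {y. poly (map_poly \<tau> p) y = 0})"
    using uncountable_UNIV_complex by (metis UNIV_eq_I)
  then have "\<forall>p\<in>polys_over E. poly p x = 0 \<longleftrightarrow> poly (map_poly \<tau> p) y = 0"
    using False by (auto simp: map_poly_eq_0_iff)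
  then show ?thesis by blast
qed

text \<open>\<open>E(x)\<close> is the set of fractions p(x)/q(x). Since p at x and the conjugate of
  p at y vanish together, substituting y for x is well defined on fractions and never divides by
  zero.\<close>

lemma extend_to_element:
  assumes "countable E"
  shows "\<exists>E' \<tau>'. complex_embedding E' \<tau>' \<and> countable E' \<and> E \<subseteq> E' \<and> x \<in> E' \<and> (\<forall>z\<in>E. \<tau>' z = \<tau> z)"
proof -
  obtain y where y: "\<And>p. p \<in> polys_over E \<Longrightarrow> poly p x = 0 \<longleftrightarrow> poly (map_poly \<tau> p) y = 0"
    using conjugate_root_exists[OF assms] by blast
  define D where "D = {(p, q). p \<in> polys_over E \<and> q \<in> polys_over E \<and> poly q x \<noteq> 0}"
  define v where "v = (\<lambda>(p, q). poly p x / poly q x)"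
  define w where "w = (\<lambda>(p, q). poly (map_poly \<tau> p) y / poly (map_poly \<tau> q) y)"
  define E' where "E' = v ` D"
  \<comment> \<open>\<open>inv_into D v\<close> picks some fraction representing the number; by
    \<open>wd\<close> the choice does not affect the value.\<close>
  define \<tau>' where "\<tau>' = w \<circ> inv_into D v"
  have wd: "w d = w d'" if "d \<in> D" "d' \<in> D" "v d = v d'" for d d'
  proof -
    obtain p q p' q' where d: "d = (p, q)" "d' = (p', q')" by fastforce
    have in_E: "p \<in> polys_over E" "q \<in> polys_over E" "p' \<in> polys_over E" "q' \<in> polys_over E"
      and nz: "poly q x \<noteq> 0" "poly q' x \<noteq> 0"
      using that by (auto simp: D_def d)
    have "poly (p * q' - p' * q) x = 0"
      using that nz by (simp add: v_def d frac_eq_eq)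
    then have "poly (map_poly \<tau> (p * q' - p' * q)) y = 0"
      using y[of "p * q' - p' * q"] polys_over_closed in_E by simp
    then show ?thesis
      using nz y in_E by (auto simp: w_def d map_poly_hom polys_over_closed frac_eq_eq)
  qed
  have \<tau>'_v: "\<tau>' (v d) = w d" if "d \<in> D" for d
    unfolding \<tau>'_def comp_def using that by (intro wd inv_into_into f_inv_into_f) auto
  have const: "[:c:] \<in> polys_over E" if "c \<in> E" for c
    using monom_mem[OF that, of 0] by (simp add: monom_0)
  have const_D: "([:c:], [:1:]) \<in> D" if "c \<in> E" for c
    using that const one_mem by (auto simp: D_def)
  have v_const: "v ([:c:], [:1:]) = c" for c by (simp add: v_def)
  have w_const: "w ([:c:], [:1:]) = \<tau> c" for c by (simp only: w_def split map_poly_const) (simp add: hom_one)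
  have E: "E \<subseteq> E'"
    unfolding E'_def using const_D v_const by (metis imageI subsetI)
  have ext: "\<tau>' z = \<tau> z" if "z \<in> E" for z
    using \<tau>'_v[OF const_D[OF that]] v_const w_const by simp
  have x: "x \<in> E'"
  proof -
    have "(Polynomial.monom 1 1, [:1:]) \<in> D" using const one_mem monom_mem by (auto simp: D_def)
    moreover have "v (Polynomial.monom 1 1, [:1:]) = x" by (simp add: v_def poly_monom)
    ultimately show ?thesis unfolding E'_def by (metis imageI)
  qed
  have emb: "complex_embedding E' \<tau>'"
  proof unfold_locales
    show "1 \<in> E'" "\<tau>' 1 = 1" using E one_mem ext hom_one by auto
  next
    fix a b assume "a \<in> E'" "b \<in> E'"
    then obtain p q r s where pq: "(p, q) \<in> D" "(r, s) \<in> D" "a = v (p, q)" "b = v (r, s)"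
      unfolding E'_def by fastforce
    then have in_E: "p \<in> polys_over E" "q \<in> polys_over E" "r \<in> polys_over E" "s \<in> polys_over E"
      and nz: "poly q x \<noteq> 0" "poly s x \<noteq> 0"
      by (auto simp: D_def)
    have nz': "poly (map_poly \<tau> q) y \<noteq> 0" "poly (map_poly \<tau> s) y \<noteq> 0"
      using nz in_E y by auto
    have D: "(p * s + r * q, q * s) \<in> D" "(p * r, q * s) \<in> D"
      using in_E nz by (auto simp: D_def polys_over_closed)
    have v: "a + b = v (p * s + r * q, q * s)" "a * b = v (p * r, q * s)"
      unfolding pq(3,4) v_def split poly_add poly_mult using nz by (simp_all add: add_frac_eq)
    show "a + b \<in> E'" "a * b \<in> E'" unfolding v E'_def using D by auto
    show "\<tau>' (a + b) = \<tau>' a + \<tau>' b" "\<tau>' (a * b) = \<tau>' a * \<tau>' b"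
      unfolding v \<tau>'_v[OF D(1)] \<tau>'_v[OF D(2)] unfolding pq \<tau>'_v[OF pq(1)] \<tau>'_v[OF pq(2)]
      unfolding w_def split using nz' in_E by (simp_all add: map_poly_hom polys_over_closed add_frac_eq)
  next
    fix a assume "a \<in> E'"
    then obtain p q where pq: "(p, q) \<in> D" "a = v (p, q)"
      unfolding E'_def by fastforce
    have "0 - p \<in> polys_over E" using pq const[OF zero_mem] by (intro polys_over_closed) (auto simp: D_def)
    then have "(- p, q) \<in> D" "v (- p, q) = - a" using pq by (auto simp: D_def v_def)
    then show "- a \<in> E'" unfolding E'_def by (metis imageI)
    show "inverse a \<in> E'"
    proof (cases "a = 0")
      case True then show ?thesis using E zero_mem by auto
    next
      case False
      then have "(q, p) \<in> D" "v (q, p) = inverse a" using pq by (auto simp: D_def v_def)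
      then show ?thesis unfolding E'_def by (metis imageI)
    qed
  qed
  have "countable D"
    by (rule countable_subset[of _ "polys_over E \<times> polys_over E"])
      (auto simp: D_def intro: countable_polys_over assms)
  then have "countable E'" unfolding E'_def by blast
  then show ?thesis using emb E x ext by blast
qed

text \<open>Elements of \<open>B\<close> are adjoined one at a time and the tower of embeddings is
  glued on its union. Each stage stays countable, which is what permits the next transcendental
  step.\<close>

lemma extend_to_countable:
  assumes "countable E" "countable B"
  shows "\<exists>E' \<tau>'. complex_embedding E' \<tau>' \<and> countable E' \<and> E \<union> B \<subseteq> E' \<and> (\<forall>z\<in>E. \<tau>' z = \<tau> z)"
proof -
  \<comment> \<open>The extra 0 keeps the enumerated set nonempty, so that
    \<open>from_nat_into\<close> reaches all of \<open>B\<close>.\<close>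
  define x where "x = from_nat_into (insert 0 B)"
  define P where "P = (\<lambda>(n::nat) S. complex_embedding (fst S) (snd S) \<and> countable (fst S) \<and> E \<subseteq> fst S
    \<and> (\<forall>z\<in>E. snd S z = \<tau> z))"
  define Q where "Q = (\<lambda>n S S'. fst S \<subseteq> fst S' \<and> x n \<in> fst S' \<and> (\<forall>z\<in>fst S. snd S' z = (snd S z :: complex)))"
  have "\<exists>f. \<forall>n. P n (f n) \<and> Q n (f n) (f (Suc n))"
  proof (rule dependent_nat_choice)
    show "\<exists>S. P 0 S"
      by (rule exI[of _ "(E, \<tau>)"]) (auto simp: P_def assms complex_embedding_axioms)
    show "\<exists>S'. P (Suc n) S' \<and> Q n S S'" if S: "P n S" for S n
    proof -
      interpret S: complex_embedding "fst S" "snd S" using S by (simp add: P_def)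
      obtain E' \<tau>' where "complex_embedding E' \<tau>'" "countable E'" "fst S \<subseteq> E'" "x n \<in> E'"
        "\<forall>z\<in>fst S. \<tau>' z = snd S z"
        using S.extend_to_element[of "x n"] S by (auto simp: P_def)
      then show ?thesis
        using S by (intro exI[of _ "(E', \<tau>')"]) (auto simp: P_def Q_def)
    qed
  qed
  then obtain S where S: "\<And>n. P n (S n)" "\<And>n. Q n (S n) (S (Suc n))" by blast
  define F where "F = (\<lambda>n. fst (S n))"
  define \<rho> where "\<rho> = (\<lambda>n. snd (S n))"
  have emb: "complex_embedding (F n) (\<rho> n)" "countable (F n)" "E \<subseteq> F n" "\<And>z. z \<in> E \<Longrightarrow> \<rho> n z = \<tau> z" for n
    using S(1)[of n] by (auto simp: P_def F_def \<rho>_def)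
  have step: "F n \<subseteq> F (Suc n)" "x n \<in> F (Suc n)" "\<And>z. z \<in> F n \<Longrightarrow> \<rho> (Suc n) z = \<rho> n z" for n
    using S(2)[of n] by (auto simp: Q_def F_def \<rho>_def)
  have mono: "F m \<subseteq> F n \<and> (\<forall>z\<in>F m. \<rho> n z = \<rho> m z)" if "m \<le> n" for m n
    using that
  proof (induction n rule: dec_induct)
    case (step k)
    then show ?case using \<open>\<And>n. F n \<subseteq> F (Suc n)\<close> \<open>\<And>z n. z \<in> F n \<Longrightarrow> \<rho> (Suc n) z = \<rho> n z\<close> by (metis subset_iff)
  qed auto
  define \<tau>' where "\<tau>' = (\<lambda>z. \<rho> (LEAST n. z \<in> F n) z)"
  have \<tau>'_eq: "\<tau>' z = \<rho> n z" if "z \<in> F n" for z n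
    unfolding \<tau>'_def using mono[of "LEAST n. z \<in> F n" n] that LeastI[of "\<lambda>n. z \<in> F n" n] Least_le[of "\<lambda>n. z \<in> F n" n]
    by auto
  have emb': "complex_embedding (F n) \<tau>'" for n
    by (rule complex_embedding.cong[OF emb(1)]) (rule \<tau>'_eq)
  have two: "\<exists>n. a \<in> F n \<and> b \<in> F n" if "a \<in> \<Union> (range F)" "b \<in> \<Union> (range F)" for a b
    using that mono by (metis UN_E max.cobounded1 max.cobounded2 subset_iff)
  have "complex_embedding (\<Union> (range F)) \<tau>'"
  proof unfold_locales
    show "1 \<in> \<Union> (range F)" using complex_embedding.one_mem[OF emb(1)[of 0]] by blast
    show "\<tau>' 1 = 1" using complex_embedding.hom_one[OF emb'[of 0]] .
    fix a assume "a \<in> \<Union> (range F)"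
    then obtain n where "a \<in> F n" by blast
    then show "- a \<in> \<Union> (range F)" "inverse a \<in> \<Union> (range F)"
      using complex_embedding.uminus_mem[OF emb(1)] complex_embedding.inverse_mem[OF emb(1)] by blast+
  next
    fix a b assume "a \<in> \<Union> (range F)" "b \<in> \<Union> (range F)"
    then obtain n where n: "a \<in> F n" "b \<in> F n" using two by blast
    interpret n: complex_embedding "F n" \<tau>' by (rule emb')
    show "a + b \<in> \<Union> (range F)" "a * b \<in> \<Union> (range F)" "\<tau>' (a + b) = \<tau>' a + \<tau>' b" "\<tau>' (a * b) = \<tau>' a * \<tau>' b"
      using n n.add_mem[OF n] n.mult_mem[OF n] n.hom_add[OF n] n.hom_mult[OF n] by blast+
  qed
  moreover have "B \<subseteq> \<Union> (range F)"
  proof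
    fix z assume "z \<in> B"
    then obtain n where "x n = z"
      unfolding x_def using from_nat_into_surj[of "insert 0 B" z] assms by auto
    then show "z \<in> \<Union> (range F)" using step(2)[of n] by blast
  qed
  moreover have "E \<subseteq> \<Union> (range F)" using emb(3)[of 0] by blast
  moreover have "\<forall>z\<in>E. \<tau>' z = \<tau> z" using emb(3)[of 0] emb(4) \<tau>'_eq[of _ 0] by (metis subsetD)
  moreover have "countable (\<Union> (range F))" using emb(2) by auto
  ultimately show ?thesis by blast
qed

end


section \<open>Algebraic numbers and their embeddings\<close>

lemma complex_embedding_id: "subfield E CC \<Longrightarrow> complex_embedding E id"
  by (subst complex_embedding_iff) (auto simp: embeddings_def Ring.ring_hom_def)

text \<open>Polynomials over \<open>CC\<close> are coefficient lists starting with the leading term,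
  hence the \<open>rev\<close>. The translation gives access to the theorem that the algebraic
  elements form a subfield.\<close>

lemma algebraic_iff_CC: "algebraic x \<longleftrightarrow> \<not> ring.transcendental CC \<rat> x"
proof
  have sub: "subfield \<rat> CC"
    by (rule complex_embedding_imp_subfield[of _ id]) (unfold_locales, auto)
  have eval: "CC.eval p x = poly (Poly (rev p)) x" for p
  proof (induction p)
    case (Cons a p)
    have "x [^]\<^bsub>CC\<^esub> n = x ^ n" for n :: nat by (induction n) auto
    then show ?case using Cons by (simp add: Poly_append poly_monom)
  qed simp
  show "algebraic x" if tr: "\<not> ring.transcendental CC \<rat> x"
  proof -
    obtain p where p: "p \<in> carrier (univ_poly CC \<rat>)" "p \<noteq> []" "CC.eval p x = 0"
      using CC.algebraicE[OF subfieldE(1)[OF sub], of x, unfolded over_def] tr by auto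
    then have lc: "hd p \<noteq> 0" "set p \<subseteq> \<rat>" by (auto simp: univ_poly_carrier[symmetric] polynomial_def)
    have "coeff (Poly (rev p)) (length p - 1) = hd p"
      using p by (simp add: coeff_Poly_eq nth_default_def rev_nth hd_conv_nth)
    then have "Poly (rev p) \<noteq> 0" using lc by (metis coeff_0)
    moreover have "coeff (Poly (rev p)) i \<in> \<rat>" for i
      using lc by (auto simp: coeff_Poly_eq nth_default_def rev_nth subset_iff)
    ultimately show ?thesis using p eval by (auto intro!: algebraicI'[of "Poly (rev p)"])
  qed
  show "\<not> ring.transcendental CC \<rat> x" if alg: "algebraic x"
  proof -
    obtain p where p: "\<And>i. coeff p i \<in> \<rat>" "p \<noteq> 0" "poly p x = 0"
      using alg by (auto simp: algebraic_altdef)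
    have "rev (coeffs p) \<in> carrier (univ_poly CC \<rat>)"
      using p by (auto simp: univ_poly_carrier[symmetric] polynomial_def hd_rev last_coeffs_eq_coeff_degree coeffs_def)
    then have "CC.algebraic \<rat> x"
      using CC.algebraicI[of "rev (coeffs p)" \<rat> x] p eval by (auto simp: over_def)
    then show ?thesis by simp
  qed
qed

abbreviation algebraic_numbers :: "complex set" where
  "algebraic_numbers \<equiv> {x. algebraic x}"

lemma subfield_Rats: "subfield \<rat> CC"
  by (rule complex_embedding_imp_subfield[of _ id]) (unfold_locales, auto)

lemma subfield_algebraic_numbers: "subfield algebraic_numbers CC"
  using field.subfield_of_algebraics[OF field_CC subfield_Rats] by (simp add: over_def algebraic_iff_CC)

interpretation algebraic: complex_embedding algebraic_numbers id
  by (rule complex_embedding_id[OF subfield_algebraic_numbers])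

lemma number_field_imp_algebraic:
  assumes "number_field L" shows "L \<subseteq> algebraic_numbers"
proof
  fix x assume "x \<in> L"
  then show "x \<in> algebraic_numbers"
    using assms CC.finite_dimension_imp_algebraic[OF subfield_Rats, of L x] subfieldE(1)[of L CC]
    by (auto simp: number_field_def algebraic_iff_CC over_def)
qed

lemma countable_algebraic_numbers: "countable algebraic_numbers"
proof -
  interpret Q: complex_embedding \<rat> id by (rule complex_embedding_id[OF subfield_Rats])
  have "countable (\<rat> :: complex set)" by (simp add: Rats_eq_range_of_rat_o_nat_to_rat_surj)
  then have "countable (\<Union>p\<in>polys_over \<rat> - {0}. {y. poly p y = 0})"
    using Q.countable_polys_over
    by (intro countable_UN) (auto intro!: poly_roots_finite countable_finite)
  moreover have "algebraic_numbers \<subseteq> (\<Union>p\<in>polys_over \<rat> - {0}. {y. poly p y = 0})"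
    by (auto simp: algebraic_altdef polys_over_def)
  ultimately show ?thesis by (rule countable_subset[rotated])
qed

lemma complex_embedding_roots:
  assumes "complex_embedding E \<tau>" "\<And>i. coeff p i \<in> \<rat>" "x \<in> E" "poly p x = 0"
  shows "poly p (\<tau> x) = 0"
proof -
  interpret complex_embedding E \<tau> by fact
  have "p \<in> polys_over E" using assms(2) Rats_subset by (auto simp: polys_over_def)
  moreover have "map_poly \<tau> p = p" using assms(2) by (auto intro!: poly_eqI hom_Rats)
  ultimately show ?thesis using poly_map_poly_hom[of p x] assms hom_zero by simp
qed

lemma complex_embedding_algebraic:
  assumes "complex_embedding E \<tau>" "x \<in> E" "algebraic x" shows "algebraic (\<tau> x)"
proof -
  obtain p where p: "\<And>i. coeff p i \<in> \<rat>" "p \<noteq> 0" "poly p x = 0" using assms(3) by (auto simp: algebraic_altdef)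
  then show ?thesis using complex_embedding_roots[OF assms(1) p(1) assms(2) p(3)] algebraicI' by blast
qed

text \<open>For each nonzero rational polynomial the embedding maps the finite set of roots
  injectively into itself, hence onto itself.\<close>

lemma complex_embedding_algebraic_surj:
  assumes "complex_embedding algebraic_numbers \<sigma>"
  shows "\<sigma> ` algebraic_numbers = algebraic_numbers"
proof (rule equalityI; rule subsetI)
  fix y assume "y \<in> \<sigma> ` algebraic_numbers"
  then show "y \<in> algebraic_numbers" using complex_embedding_algebraic[OF assms] by auto
next
  interpret complex_embedding algebraic_numbers \<sigma> by fact
  fix y assume "y \<in> algebraic_numbers"
  then obtain p where p: "\<And>i. coeff p i \<in> \<rat>" "p \<noteq> 0" "poly p y = 0" by (auto simp: algebraic_altdef)
  let ?R = "{z. poly p z = 0}"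
  have alg: "?R \<subseteq> algebraic_numbers" using p algebraicI' by auto
  have "\<sigma> ` ?R \<subseteq> ?R" using complex_embedding_roots[OF assms p(1)] alg by auto
  then have "\<sigma> ` ?R = ?R"
    using inj_on_subset[OF inj alg] poly_roots_finite[OF p(2)] by (metis endo_inj_surj)
  moreover have "y \<in> ?R" using p by simp
  ultimately have "y \<in> \<sigma> ` ?R" by simp
  then show "y \<in> \<sigma> ` algebraic_numbers" using alg by blast
qed

section \<open>CM numbers\<close>

text \<open>The union of all CM fields: the algebraic numbers on which complex conjugation is
  independent of the embedding.\<close>

definition CM_numbers :: "complex set" where
  "CM_numbers = {x \<in> algebraic_numbers. \<forall>\<sigma>. complex_embedding algebraic_numbers \<sigma> \<longrightarrow> \<sigma> (cnj x) = cnj (\<sigma> x)}"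

lemma CM_numbers_algebraic: "x \<in> CM_numbers \<Longrightarrow> x \<in> algebraic_numbers"
  by (simp add: CM_numbers_def)

lemma embedding_cnj_CM:
  "complex_embedding algebraic_numbers \<sigma> \<Longrightarrow> x \<in> CM_numbers \<Longrightarrow> \<sigma> (cnj x) = cnj (\<sigma> x)"
  by (simp add: CM_numbers_def)

lemma cnj_CM_numbers: "x \<in> CM_numbers \<Longrightarrow> cnj x \<in> CM_numbers"
  by (simp add: CM_numbers_def) (metis complex_cnj_cnj)

text \<open>The defining condition says that two field homomorphisms, \<sigma> after conjugation and
  conjugation after \<sigma>, agree at x; the places of agreement form a subfield.\<close>

interpretation CM: complex_embedding CM_numbers id
proof unfold_locales
  note [simp] = complex_embedding.homs
  show "1 \<in> CM_numbers" by (auto simp: CM_numbers_def)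
  fix x assume x: "x \<in> CM_numbers"
  then show "- x \<in> CM_numbers" "inverse x \<in> CM_numbers" by (auto simp: CM_numbers_def)
  fix y assume "y \<in> CM_numbers"
  then show "x + y \<in> CM_numbers" "x * y \<in> CM_numbers"
    using x algebraic.add_mem algebraic.mult_mem by (auto simp: CM_numbers_def)
qed auto

text \<open>For a second embedding \<rho>, the composite of \<sigma> and \<rho> is an embedding too.
  As both the composite and \<sigma> commute with conjugation at x, so does \<rho> at
  \<open>\<sigma> x\<close>.\<close>

lemma embedding_CM_numbers:
  assumes "complex_embedding algebraic_numbers \<sigma>" "x \<in> CM_numbers"
  shows "\<sigma> x \<in> CM_numbers"
proof -
  interpret complex_embedding algebraic_numbers \<sigma> by fact
  have "\<rho> (cnj (\<sigma> x)) = cnj (\<rho> (\<sigma> x))" if \<rho>: "complex_embedding algebraic_numbers \<rho>" for \<rho>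
    using embedding_cnj_CM[OF compose[OF \<rho>] assms(2)] complex_embedding_algebraic_surj[OF assms(1)]
      embedding_cnj_CM[OF assms] by simp
  then show ?thesis
    using complex_embedding_algebraic[OF assms(1)] CM_numbers_algebraic[OF assms(2)]
    by (auto simp: CM_numbers_def)
qed

text \<open>On the unit circle conjugation is inversion, which every embedding respects. So the
  condition on w amounts to \<open>\<sigma> w\<close> having modulus one again, and a nonnegative
  real is 1 as soon as a positive power of it is.\<close>

lemma CM_numbers_root:
  assumes "cmod w = 1" "n > 0" "w ^ n \<in> CM_numbers"
  shows "w \<in> CM_numbers"
proof -
  have alg: "algebraic w"
  proof (rule algebraic_root)
    show "algebraic (w ^ n)" using CM_numbers_algebraic[OF assms(3)] by simp
    show "poly (Polynomial.monom 1 n) w = w ^ n" by (simp add: poly_monom)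
    show "\<forall>i. coeff (Polynomial.monom (1 :: complex) n) i \<in> \<int>" by simp
  qed (use assms(2) in \<open>simp_all add: degree_monom_eq\<close>)
  have "\<sigma> (cnj w) = cnj (\<sigma> w)" if \<sigma>: "complex_embedding algebraic_numbers \<sigma>" for \<sigma>
  proof -
    interpret complex_embedding algebraic_numbers \<sigma> by fact
    have inv: "cnj z = inverse z \<longleftrightarrow> cmod z = 1" if "z \<noteq> 0" for z
    proof -
      have "cnj z = inverse z \<longleftrightarrow> z * cnj z = 1" using that by (auto simp: inverse_eq_divide field_simps)
      also have "\<dots> \<longleftrightarrow> (cmod z)\<^sup>2 = 1"
        unfolding complex_norm_square[symmetric] by (metis of_real_1 of_real_eq_iff)
      finally show ?thesis by (simp add: power2_eq_1_iff) (use norm_ge_zero[of z] in linarith)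
    qed
    have "w \<noteq> 0" using assms by auto
    have "cmod (w ^ n) = 1" using assms by (simp add: norm_power)
    moreover have mem: "w ^ n \<in> algebraic_numbers" "w ^ n \<noteq> 0"
      using CM_numbers_algebraic[OF assms(3)] \<open>w \<noteq> 0\<close> by simp_all
    ultimately have "cnj (\<sigma> (w ^ n)) = inverse (\<sigma> (w ^ n))"
      using inv[of "w ^ n"] embedding_cnj_CM[OF \<sigma> assms(3)] hom_inverse[OF mem(1)] by simp
    then have "cmod (\<sigma> (w ^ n)) = 1" using inv[of "\<sigma> (w ^ n)"] hom_eq_0_iff[OF mem(1)] mem(2) by blast
    then have "cmod (\<sigma> w) ^ n = 1" using alg by (simp add: hom_power norm_power)
    then have "cmod (\<sigma> w) = 1" using assms(2) norm_ge_zero[of "\<sigma> w"]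
      by (metis power_eq_imp_eq_base power_one zero_le_one)
    then show ?thesis
      using inv[of w] inv[of "\<sigma> w"] \<open>w \<noteq> 0\<close> alg assms(1) by (simp add: hom_inverse hom_eq_0_iff)
  qed
  then show ?thesis using alg by (auto simp: CM_numbers_def)
qed


text \<open>After completing the square, \<open>L\<close> is generated over the totally real
  \<open>L0\<close> by some z with square in \<open>L0\<close>. Every embedding sends z to a number
  with real square; as \<open>L\<close> is totally imaginary that number is not real, so it is
  purely imaginary, and conjugation acts on it by a sign, independently of the embedding.\<close>

lemma CM_field_subset_CM_numbers:
  assumes "CM_field L" shows "L \<subseteq> CM_numbers"
proof
  fix x assume x: "x \<in> L"
  obtain L0 where L0: "L0 \<subseteq> L" "number_field L0" "totally_real L0" "CC.dimension 2 L0 L"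
    and L: "number_field L" "totally_imaginary L"
    using assms by (auto simp: CM_field_def)
  have sub: "subfield L CC" "subfield L0 CC" using L L0 by (auto simp: number_field_def)
  interpret L: complex_embedding L id by (rule complex_embedding_id[OF sub(1)])
  interpret L0: complex_embedding L0 id by (rule complex_embedding_id[OF sub(2)])
  have real: "\<sigma> z \<in> \<real>" if "complex_embedding L \<sigma>" "z \<in> L0" for \<sigma> z
  proof -
    have "\<sigma> \<in> embeddings L0"
      using complex_embedding.restrict_domain[OF that(1) L0.complex_embedding_axioms L0(1)]
        complex_embedding_iff[OF sub(2)] by blast
    then show ?thesis using L0(3) that by (auto simp: totally_real_def)
  qed
  have "L \<subseteq> algebraic_numbers" by (rule number_field_imp_algebraic[OF L(1)])
  then have restr: "complex_embedding L \<sigma>" if "complex_embedding algebraic_numbers \<sigma>" for \<sigma>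
    using complex_embedding.restrict_domain[OF that L.complex_embedding_axioms] by blast
  have "\<sigma> (cnj x) = cnj (\<sigma> x)" if \<sigma>: "complex_embedding algebraic_numbers \<sigma>" for \<sigma>
  proof (cases "x \<in> L0")
    case True
    then have "x \<in> \<real>" "\<sigma> x \<in> \<real>" using real[OF L.complex_embedding_axioms] real[OF restr[OF \<sigma>]] by auto
    then show ?thesis by (simp add: Reals_cnj_iff)
  next
    case False
    interpret \<sigma>: complex_embedding L \<sigma> by (rule restr[OF \<sigma>])
    have Span1: "CC.Span L0 [1] = L0"
      by (auto simp: CC.line_extension_mem_iff)
    have "CC.independent L0 [x, 1]"
      using False Span1 L0.zero_mem by (intro CC.li_Cons CC.li_Nil) auto
    then have "CC.Span L0 [x, 1] = L"
      using CC.independent_length_eq_dimension[OF sub(2) L0(4), of "[x, 1]"] x L.one_mem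
      by (auto simp del: CC.Span.simps)
    then have span: "\<exists>a\<in>L0. \<exists>b\<in>L0. z = a * x + b" if "z \<in> L" for z
      using that Span1 by (auto simp: CC.line_extension_mem_iff)
    obtain a b where ab: "a \<in> L0" "b \<in> L0" "x * x = a * x + b"
      using span[OF L.mult_mem[OF x x]] by blast
    \<comment> \<open>\<open>d\<close> is the discriminant of X^2 - a X - b, and \<open>z\<close> a
      square root of it.\<close>
    define z where "z = 2 * x - a"
    define d where "d = a * a + 4 * b"
    have nums: "2 \<in> L0" "4 \<in> L0" using L0.of_nat_mem[of 2] L0.of_nat_mem[of 4] by simp_all
    have d: "d \<in> L0" unfolding d_def by (intro L0.closed ab nums)
    have z: "z \<in> L" unfolding z_def using nums L0(1) ab x by (intro L.closed) auto
    have zz: "z * z = d"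
    proof -
      have "z * z = 4 * (x * x) - 4 * (a * x) + a * a" by (simp add: z_def algebra_simps)
      then show ?thesis by (simp add: ab(3) d_def algebra_simps)
    qed
    have x_eq: "x = z / 2 + a / 2" by (simp add: z_def field_simps)
    have imag: "cnj (\<rho> z) = - \<rho> z" if \<rho>: "complex_embedding L \<rho>" for \<rho>
    proof -
      interpret \<rho>: complex_embedding L \<rho> by fact
      have sq: "\<rho> z * \<rho> z \<in> \<real>" using real[OF \<rho> d] z by (simp add: zz[symmetric] \<rho>.hom_mult)
      \<comment> \<open>Every element of \<open>L\<close> is a combination of z and 1 over
        \<open>L0\<close>, so a real image of z would make the whole image of \<open>L\<close>
        real.\<close>
      have "\<rho> z \<notin> \<real>"
      proof
        assume rz: "\<rho> z \<in> \<real>"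
        have "\<rho> y \<in> \<real>" if y: "y \<in> L" for y
        proof -
          obtain u v where uv: "u \<in> L0" "v \<in> L0" "y = u * x + v" using span[OF y] by blast
          have "y = u * (z / 2) + (u * (a / 2) + v)" unfolding uv(3) by (subst x_eq) (simp add: algebra_simps)
          moreover have "u * (a / 2) + v \<in> L0" "u / 2 \<in> L0" using uv ab nums by (auto intro!: L0.closed)
          ultimately have "\<rho> y = \<rho> (u / 2) * \<rho> z + \<rho> (u * (a / 2) + v)"
            using z L0(1) by (metis (no_types, lifting) \<rho>.hom_add \<rho>.hom_mult \<rho>.mult_mem subset_iff times_divide_eq_left times_divide_eq_right)
          then show ?thesis
            using rz real[OF \<rho> \<open>u / 2 \<in> L0\<close>] real[OF \<rho> \<open>u * (a / 2) + v \<in> L0\<close>] by simp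
        qed
        then show False
          using L(2) \<rho> complex_embedding_iff[OF sub(1)] by (auto simp: totally_imaginary_def)
      qed
      moreover have "Im (\<rho> z) * Re (\<rho> z) = 0" using sq by (simp add: complex_is_Real_iff)
      ultimately show ?thesis by (simp add: complex_is_Real_iff complex_eq_iff)
    qed
    have "cnj z = - z" using imag[OF L.complex_embedding_axioms] by simp
    have "cnj a = a" "cnj (\<sigma> a) = \<sigma> a"
      using real[OF L.complex_embedding_axioms ab(1)] real[OF restr[OF \<sigma>] ab(1)] by (simp_all add: Reals_cnj_iff)
    have aL: "a \<in> L" "2 \<in> L" using ab L0(1) nums by auto
    have \<sigma>2: "\<sigma> 2 = 2" using \<sigma>.hom_of_nat[of 2] by simp
    have "cnj x = - z / 2 + a / 2" by (subst x_eq) (simp add: \<open>cnj z = - z\<close> \<open>cnj a = a\<close>)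
    then have "\<sigma> (cnj x) = - \<sigma> z / 2 + \<sigma> a / 2"
      using z aL \<sigma>2 by (simp add: \<sigma>.homs \<sigma>.closed)
    moreover have "\<sigma> x = \<sigma> z / 2 + \<sigma> a / 2"
      using arg_cong[OF x_eq, of \<sigma>] z aL \<sigma>2 by (simp add: \<sigma>.homs \<sigma>.closed)
    ultimately show ?thesis using imag[OF restr[OF \<sigma>]] \<open>cnj (\<sigma> a) = \<sigma> a\<close> by simp
  qed
  then show "x \<in> CM_numbers" using x \<open>L \<subseteq> algebraic_numbers\<close> by (auto simp: CM_numbers_def)
qed

section \<open>Normal closures and extension of Galois automorphisms\<close>

lemma normal_over_rat_algebraic_numbers: "normal_over_rat algebraic_numbers"
proof -
  have "algebraic z" if "Factorial_Ring.irreducible p" "poly (map_poly of_rat p) z = 0" for p :: "rat poly" and z :: complex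
    using that by (intro algebraicI'[of "map_poly of_rat p"]) (auto simp: coeff_map_poly map_poly_eq_0_iff)
  then show ?thesis using subfield_algebraic_numbers by (auto simp: normal_over_rat_def)
qed

lemma normal_closure_algebraic:
  assumes "L \<subseteq> algebraic_numbers"
  shows "subfield (normal_closure L) CC" "L \<subseteq> normal_closure L" "normal_closure L \<subseteq> algebraic_numbers"
proof -
  have emb: "complex_embedding K id" if "normal_over_rat K" for K
    using that by (intro complex_embedding_id) (simp add: normal_over_rat_def)
  have "complex_embedding (normal_closure L) id"
    unfolding normal_closure_def using emb
    by unfold_locales (auto simp: complex_embedding_def)
  then show "subfield (normal_closure L) CC" by (rule complex_embedding_imp_subfield)
  show "L \<subseteq> normal_closure L" by (auto simp: normal_closure_def)
  show "normal_closure L \<subseteq> algebraic_numbers"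
    using normal_over_rat_algebraic_numbers assms by (auto simp: normal_closure_def)
qed

text \<open>The entries of symmetry matrices may lie outside \<open>K\<close>, so q must act on
  further algebraic numbers. These are countable, hence the extension of embeddings applies; which
  extension is obtained does not matter later.\<close>

lemma extend_Gal:
  assumes "q \<in> Gal K" "subfield K CC" "K \<subseteq> algebraic_numbers"
  obtains \<sigma> where "complex_embedding algebraic_numbers \<sigma>" "\<And>x. x \<in> K \<Longrightarrow> \<sigma> x = q x"
proof -
  have "q \<in> embeddings K"
    using assms(1) by (auto simp: Gal_def ring_iso_def embeddings_def Ring.ring_hom_def)
  then interpret complex_embedding K q using complex_embedding_iff[OF assms(2)] by blast
  have "countable K" using countable_subset[OF assms(3) countable_algebraic_numbers] .
  then obtain E \<tau> where E: "complex_embedding E \<tau>" "K \<union> algebraic_numbers \<subseteq> E" "\<forall>z\<in>K. \<tau> z = q z"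
    using extend_to_countable[OF _ countable_algebraic_numbers] by blast
  then have "complex_embedding algebraic_numbers \<tau>"
    using complex_embedding.restrict_domain[OF E(1) algebraic.complex_embedding_axioms] by blast
  then show ?thesis using that E(3) by blast
qed

section \<open>Hermitian and unitary matrices\<close>

lemma mat_adjoint_dim [simp]: "dim_row (mat_adjoint (A :: complex mat)) = dim_col A" "dim_col (mat_adjoint A) = dim_row A"
  by (auto simp: mat_adjoint_def)

lemma mat_adjoint_carrier [simp]: "(A :: complex mat) \<in> carrier_mat n m \<Longrightarrow> mat_adjoint A \<in> carrier_mat m n"
  unfolding carrier_mat_def by (simp only: mem_Collect_eq mat_adjoint_dim)

lemma mat_adjoint_index [simp]:
  "i < dim_col A \<Longrightarrow> j < dim_row A \<Longrightarrow> mat_adjoint (A :: complex mat) $$ (i, j) = cnj (A $$ (j, i))"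
  by (simp add: mat_adjoint_def mat_of_rows_index cols_nth)

lemma mat_adjoint_adjoint [simp]: "mat_adjoint (mat_adjoint A) = (A :: complex mat)"
  by (rule eq_matI) auto

lemma mat_mult_index:
  "A \<in> carrier_mat n k \<Longrightarrow> B \<in> carrier_mat k m \<Longrightarrow> i < n \<Longrightarrow> j < m \<Longrightarrow>
    (A * B) $$ (i, j) = (\<Sum>l<k. A $$ (i, l) * B $$ (l, j))"
  by (auto simp: scalar_prod_def intro!: sum.cong)

lemma mat_adjoint_mult:
  assumes "A \<in> carrier_mat n k" "B \<in> carrier_mat k m"
  shows "mat_adjoint (A * B) = mat_adjoint B * mat_adjoint (A :: complex mat)"
proof (rule eq_matI)
  fix i j assume "i < dim_row (mat_adjoint B * mat_adjoint A)" "j < dim_col (mat_adjoint B * mat_adjoint A)"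
  then have ij: "i < m" "j < n" using assms by auto
  then have "(mat_adjoint B * mat_adjoint A) $$ (i, j) = (\<Sum>l<k. mat_adjoint B $$ (i, l) * mat_adjoint A $$ (l, j))"
    using assms by (intro mat_mult_index) auto
  also have "\<dots> = cnj (\<Sum>l<k. A $$ (j, l) * B $$ (l, i))"
    using assms ij by (simp add: mult.commute)
  also have "\<dots> = mat_adjoint (A * B) $$ (i, j)"
    using assms ij by (subst mat_adjoint_index) (auto simp: mat_mult_index[OF assms ij(2,1)] simp del: index_mult_mat(1))
  finally show "mat_adjoint (A * B) $$ (i, j) = (mat_adjoint B * mat_adjoint A) $$ (i, j)" ..
qed (use assms in auto)

lemma mat_adjoint_one [simp]: "mat_adjoint (1\<^sub>m n :: complex mat) = 1\<^sub>m n"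
  by (rule eq_matI) auto

lemma mat_inv_eqI:
  assumes "A \<in> carrier_mat n n" "B \<in> carrier_mat n n" "A * B = 1\<^sub>m n"
  shows "mat_inv A = B"
proof -
  have BA: "B * A = 1\<^sub>m n" using mat_mult_left_right_inverse[OF assms] .
  have "A \<in> Units (ring_mat TYPE(complex) n ())"
    using assms BA by (auto simp: Units_def ring_mat_def)
  then obtain D where "mat_inverse A = Some D" using mat_inverse(1)[OF assms(1)] by fastforce
  then have D: "mat_inv A = D" "D * A = 1\<^sub>m n" "D \<in> carrier_mat n n"
    using mat_inverse(2)[OF assms(1)] by (auto simp: mat_inv_def)
  have "D = D * (A * B)" using assms D by simp
  also have "\<dots> = D * A * B" using assms D by (intro assoc_mult_mat[symmetric])
  also have "\<dots> = B" using assms D by simp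
  finally show ?thesis using D by simp
qed

lemma unitary_matD:
  assumes "unitary_mat n A"
  shows "A \<in> carrier_mat n n" "mat_adjoint A * A = 1\<^sub>m n" "A * mat_adjoint A = 1\<^sub>m n"
    "mat_inv A = mat_adjoint A"
  using assms by (auto simp: unitary_mat_def intro!: mat_inv_eqI)

lemma unitary_matI:
  assumes "A \<in> carrier_mat n n" "mat_adjoint A * A = 1\<^sub>m n" shows "unitary_mat n A"
  using assms mat_mult_left_right_inverse[of "mat_adjoint A" n A] by (auto simp: unitary_mat_def)

lemma unitary_mat_mult:
  assumes "unitary_mat n A" "unitary_mat n B" shows "unitary_mat n (A * B)"
proof (rule unitary_matI)
  note A = unitary_matD[OF assms(1)] and B = unitary_matD[OF assms(2)]
  have "mat_adjoint (A * B) * (A * B) = mat_adjoint B * ((mat_adjoint A * A) * B)"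
    using A(1) B(1) by (simp add: mat_adjoint_mult[OF A(1) B(1)] assoc_mult_mat[of _ n n _ n _ n] mult_carrier_mat[of _ n n _ n])
  then show "mat_adjoint (A * B) * (A * B) = 1\<^sub>m n" using A(2) B(1,2) by simp
  show "A * B \<in> carrier_mat n n" using A(1) B(1) by simp
qed

lemma unitary_mat_one: "unitary_mat n (1\<^sub>m n)"
  by (simp add: unitary_mat_def)

lemma elements_mat_eq: "elements_mat A = {A $$ (i, j) | i j. i < dim_row A \<and> j < dim_col A}"
  unfolding elements_mat_def by force

lemma elements_matI: "i < dim_row A \<Longrightarrow> j < dim_col A \<Longrightarrow> A $$ (i, j) \<in> elements_mat A"
  by (auto simp: elements_mat_eq)

lemma map_mat_adjoint:
  assumes "\<And>x. x \<in> elements_mat A \<Longrightarrow> \<tau> (cnj x) = cnj (\<tau> x)"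
  shows "map_mat \<tau> (mat_adjoint A) = mat_adjoint (map_mat \<tau> A)"
  using assms elements_matI[of _ A] by (intro eq_matI) auto

context complex_embedding
begin

lemma map_mat_mult:
  assumes "A \<in> carrier_mat n k" "B \<in> carrier_mat k m" "elements_mat A \<subseteq> E" "elements_mat B \<subseteq> E"
  shows "map_mat \<tau> (A * B) = map_mat \<tau> A * map_mat \<tau> B"
proof (rule eq_matI)
  fix i j assume "i < dim_row (map_mat \<tau> A * map_mat \<tau> B)" "j < dim_col (map_mat \<tau> A * map_mat \<tau> B)"
  then have ij: "i < n" "j < m" using assms by auto
  have el: "\<And>l. l < k \<Longrightarrow> A $$ (i, l) \<in> E" "\<And>l. l < k \<Longrightarrow> B $$ (l, j) \<in> E"
    using assms(3,4) elements_matI[of i A] elements_matI[of _ B j] ij carrier_matD[OF assms(1)] carrier_matD[OF assms(2)] by auto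
  have m: "map_mat \<tau> A \<in> carrier_mat n k" "map_mat \<tau> B \<in> carrier_mat k m" using assms by auto
  have "map_mat \<tau> (A * B) $$ (i, j) = \<tau> ((A * B) $$ (i, j))" using ij assms by simp
  then show "map_mat \<tau> (A * B) $$ (i, j) = (map_mat \<tau> A * map_mat \<tau> B) $$ (i, j)"
    unfolding mat_mult_index[OF assms(1,2) ij] mat_mult_index[OF m ij]
    using el ij assms(1,2) hom_sum[of "{..<k}" "\<lambda>l. A $$ (i, l) * B $$ (l, j)"] by (simp add: hom_mult mult_mem)
qed (use assms in auto)

lemma elements_mat_mult:
  assumes "A \<in> carrier_mat n k" "B \<in> carrier_mat k m" "elements_mat A \<subseteq> E" "elements_mat B \<subseteq> E"
  shows "elements_mat (A * B) \<subseteq> E"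
proof
  fix x assume "x \<in> elements_mat (A * B)"
  then obtain i j where ij: "i < n" "j < m" "x = (A * B) $$ (i, j)"
    using assms(1,2) by (auto simp: elements_mat_eq)
  have el: "\<And>l. l < k \<Longrightarrow> A $$ (i, l) \<in> E" "\<And>l. l < k \<Longrightarrow> B $$ (l, j) \<in> E"
    using assms(3,4) elements_matI[of i A] elements_matI[of _ B j] ij carrier_matD[OF assms(1)] carrier_matD[OF assms(2)] by auto
  then show "x \<in> E"
    unfolding ij(3) mat_mult_index[OF assms(1,2) ij(1,2)] by (auto intro!: closed)
qed

lemma map_mat_one: "map_mat \<tau> (1\<^sub>m n) = 1\<^sub>m n"
  by (rule eq_matI) (auto simp: homs)

lemma elements_mat_one: "elements_mat (1\<^sub>m n) \<subseteq> E"
  by (auto simp: elements_mat_def zero_mem one_mem)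

lemma map_mat_inv_into: "elements_mat A \<subseteq> E \<Longrightarrow> map_mat (inv_into E \<tau>) (map_mat \<tau> A) = A"
  using elements_matI[of _ A] by (intro eq_matI) (auto intro!: inv_into_f_f inj)

end

lemma complex_embedding_cnj: "complex_embedding UNIV cnj"
  by unfold_locales auto

lemma complex_embedding_Kc: "complex_embedding UNIV (Kc g)"
  using complex_embedding_cnj complex_embedding_id[OF complex_embedding_imp_subfield[OF complex_embedding_cnj]]
  by (cases "anti g") (auto simp: Kc_def[abs_def] id_def)

lemmas map_mat_Kc_mult = complex_embedding.map_mat_mult[OF complex_embedding_Kc _ _ subset_UNIV subset_UNIV]

lemma of_real_cmod_square: "(complex_of_real (cmod z))\<^sup>2 = z * cnj z"
  by (metis complex_norm_square of_real_power)

text \<open>Deflation: an eigenvector is completed to an orthonormal basis. In that basis the first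
  column vanishes off the diagonal, by Hermitian symmetry so does the first row, and the remaining
  block is smaller and again Hermitian.\<close>

lemma hermitian_diagonalization:
  assumes "A \<in> carrier_mat n n" "mat_adjoint A = (A :: complex mat)"
  shows "\<exists>T d. unitary_mat n T \<and> A = T * mat_diag n d * mat_adjoint T"
  using assms
proof (induction n arbitrary: A)
  case 0
  then show ?case by (intro exI[of _ "1\<^sub>m 0"] exI[of _ "\<lambda>_. 0"]) (auto simp: unitary_mat_one)
next
  case (Suc m)
  let ?n = "Suc m"
  note A = Suc.prems(1)
  obtain es where "char_poly A = (\<Prod>a\<leftarrow>es. [:- a, 1:])" "length es = ?n"
    using char_poly_factorized[OF A] by auto
  then obtain e where "poly (char_poly A) e = 0" by (cases es) auto
  then have "eigenvalue A e" by (simp add: eigenvalue_root_char_poly[OF A])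
  then obtain v where v: "v \<in> carrier_vec ?n" "v \<noteq> 0\<^sub>v ?n" "A *\<^sub>v v = e \<cdot>\<^sub>v v"
    using A by (auto simp: eigenvalue_def eigenvector_def)
  interpret cof_vec_space ?n "TYPE(complex)" .
  note b = basis_completion[OF v(1,2)]
  define ws where "ws = gram_schmidt ?n (basis_completion v)"
  have ws: "set ws \<subseteq> carrier_vec ?n" "corthogonal ws" "length ws = ?n"
    using gram_schmidt_result[OF b(2,4,5) refl] b(6) by (auto simp: ws_def)
  \<comment> \<open>Gram-Schmidt leaves the first vector unchanged, so the eigenvector is the first
    basis vector up to normalization.\<close>
  have hd: "ws ! 0 = v"
  proof -
    obtain vs where "basis_completion v = v # vs" using b(6,7) by (cases "basis_completion v") auto
    then have "hd ws = v" using v by (simp add: ws_def)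
    then show ?thesis using ws by (cases ws) auto
  qed
  define s where "s = (\<lambda>j. sqrt (\<Sum>k<?n. (cmod (ws ! j $ k))\<^sup>2))"
  have cprod: "ws ! i \<bullet>c ws ! j = (\<Sum>k<?n. ws ! i $ k * cnj (ws ! j $ k))"
    if "i < ?n" "j < ?n" for i j
  proof -
    have "ws ! j \<in> carrier_vec ?n" using ws that nth_mem[of j ws] by (metis subsetD)
    then show ?thesis by (auto simp: scalar_prod_def lessThan_atLeast0)
  qed
  have prod: "(\<Sum>k<?n. ws ! i $ k * cnj (ws ! j $ k)) = of_bool (i = j) * of_real ((s i)\<^sup>2)"
    if "i < ?n" "j < ?n" for i j
  proof -
    have "ws ! i \<bullet>c ws ! j = (\<Sum>k<?n. ws ! i $ k * cnj (ws ! j $ k))" by (rule cprod[OF that])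
    moreover have "ws ! i \<bullet>c ws ! j = 0" if "i \<noteq> j"
      using corthogonalD[OF ws(2), of i j] ws \<open>i < ?n\<close> \<open>j < ?n\<close> that by simp
    ultimately show ?thesis
      by (auto simp: s_def sum_nonneg of_real_cmod_square)
  qed
  have s: "s j \<noteq> 0" if "j < ?n" for j
  proof
    assume "s j = 0"
    then have "ws ! j \<bullet>c ws ! j = 0"
      using cprod[OF that that] prod[OF that that] by simp
    then show False using corthogonalD[OF ws(2), of j j] ws that by simp
  qed
  define W where "W = Matrix.mat ?n ?n (\<lambda>(i, j). ws ! j $ i / of_real (s j))"
  have W: "W \<in> carrier_mat ?n ?n" by (simp add: W_def)
  have uW: "unitary_mat ?n W"
  proof (rule unitary_matI[OF W], rule eq_matI)
    fix i j assume "i < dim_row (1\<^sub>m ?n :: complex mat)" "j < dim_col (1\<^sub>m ?n :: complex mat)"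
    then have ij: "i < ?n" "j < ?n" by auto
    have "(mat_adjoint W * W) $$ (i, j) = (\<Sum>k<?n. mat_adjoint W $$ (i, k) * W $$ (k, j))"
      using W ij by (intro mat_mult_index) auto
    also have "\<dots> = (\<Sum>k<?n. ws ! j $ k * cnj (ws ! i $ k) / (of_real (s i) * of_real (s j)))"
      using W ij by (intro sum.cong) (auto simp: W_def)
    also have "\<dots> = of_bool (j = i) * of_real ((s j)\<^sup>2) / (of_real (s i) * of_real (s j))"
      using prod[OF ij(2,1)] by (simp flip: sum_divide_distrib)
    also have "\<dots> = 1\<^sub>m ?n $$ (i, j)"
      using ij s[OF ij(1)] by (auto simp: power2_eq_square)
    finally show "(mat_adjoint W * W) $$ (i, j) = 1\<^sub>m ?n $$ (i, j)" .
  qed (use W in auto)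
  note uWD = unitary_matD[OF uW]
  define H where "H = mat_adjoint W * A * W"
  have H: "H \<in> carrier_mat ?n ?n" using W A by (auto simp: H_def)
  have H_adj: "mat_adjoint H = H"
    unfolding H_def using A W Suc.prems(2)
    by (simp add: mat_adjoint_mult[of _ ?n ?n _ ?n] assoc_mult_mat[of _ ?n ?n _ ?n _ ?n] mult_carrier_mat[of _ ?n ?n _ ?n])
  have AWH: "A = W * H * mat_adjoint W"
  proof -
    have "W * H * mat_adjoint W = (W * mat_adjoint W) * A * (W * mat_adjoint W)"
      unfolding H_def using A W by (simp add: assoc_mult_mat[of _ ?n ?n _ ?n _ ?n] mult_carrier_mat[of _ ?n ?n _ ?n])
    then show ?thesis using uWD A by simp
  qed
  have AW0: "(A * W) $$ (i, 0) = e * W $$ (i, 0)" if "i < ?n" for i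
  proof -
    have "(A * W) $$ (i, 0) = (\<Sum>k<?n. A $$ (i, k) * v $ k) / of_real (s 0)"
      using A W that hd by (subst mat_mult_index[of _ ?n ?n _ ?n]) (auto simp: W_def sum_divide_distrib add_divide_distrib)
    also have "(\<Sum>k<?n. A $$ (i, k) * v $ k) = (A *\<^sub>v v) $ i"
      using A v(1) that by (auto simp: scalar_prod_def intro!: sum.cong)
    also have "\<dots> = e * v $ i" using v that by simp
    finally show ?thesis using that hd by (simp add: W_def)
  qed
  have col0: "H $$ (i, 0) = e * of_bool (i = 0)" if "i < ?n" for i
  proof -
    have "H = mat_adjoint W * (A * W)" unfolding H_def using A W by (simp add: assoc_mult_mat[of _ ?n ?n _ ?n _ ?n] mult_carrier_mat[of _ ?n ?n _ ?n])
    then have "H $$ (i, 0) = (\<Sum>k<?n. mat_adjoint W $$ (i, k) * (A * W) $$ (k, 0))"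
      using A W that by (simp only:) (intro mat_mult_index, auto)
    also have "\<dots> = e * (\<Sum>k<?n. mat_adjoint W $$ (i, k) * W $$ (k, 0))"
      unfolding sum_distrib_left using AW0 by (intro sum.cong) auto
    also have "(\<Sum>k<?n. mat_adjoint W $$ (i, k) * W $$ (k, 0)) = (mat_adjoint W * W) $$ (i, 0)"
      using W that by (intro mat_mult_index[symmetric]) auto
    finally show ?thesis using uWD that by simp
  qed
  have row0: "H $$ (0, i) = e * of_bool (i = 0)" if "i < ?n" for i
  proof -
    have "H $$ (0, i) = cnj (H $$ (i, 0))"
      using arg_cong[OF H_adj, of "\<lambda>M. M $$ (0, i)"] H that by simp
    moreover have "H $$ (0, 0) = cnj (H $$ (0, 0))"
      using arg_cong[OF H_adj, of "\<lambda>M. M $$ (0, 0)"] H by simp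
    ultimately show ?thesis using col0[OF that] col0[of 0] by (cases "i = 0") auto
  qed
  define A' where "A' = Matrix.mat m m (\<lambda>(i, j). H $$ (Suc i, Suc j))"
  have "mat_adjoint A' = A'"
  proof (rule eq_matI)
    fix i j assume "i < dim_row A'" "j < dim_col A'"
    then have "i < m" "j < m" by (auto simp: A'_def)
    then show "mat_adjoint A' $$ (i, j) = A' $$ (i, j)"
      using arg_cong[OF H_adj, of "\<lambda>M. M $$ (Suc i, Suc j)"] H by (simp add: A'_def)
  qed (auto simp: A'_def)
  then obtain T d where T: "unitary_mat m T" "A' = T * mat_diag m d * mat_adjoint T"
    using Suc.IH[of A'] by (auto simp: A'_def)
  note uT = unitary_matD[OF T(1)]
  \<comment> \<open>The block sum of 1 and \<open>T\<close>; accordingly \<open>f\<close> puts the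
    eigenvalue \<open>e\<close> in front of \<open>d\<close>.\<close>
  define S where "S = Matrix.mat ?n ?n (\<lambda>(i, j). case (i, j) of (0, 0) \<Rightarrow> 1 | (Suc i, Suc j) \<Rightarrow> T $$ (i, j) | _ \<Rightarrow> 0)"
  define f where "f = case_nat e d"
  have S: "S \<in> carrier_mat ?n ?n" by (simp add: S_def)
  have uS: "unitary_mat ?n S"
  proof (rule unitary_matI[OF S], rule eq_matI)
    fix i j assume "i < dim_row (1\<^sub>m ?n :: complex mat)" "j < dim_col (1\<^sub>m ?n :: complex mat)"
    then have ij: "i < ?n" "j < ?n" by auto
    have TT: "(\<Sum>k<m. cnj (T $$ (k, i)) * T $$ (k, j)) = of_bool (i = j)" if "i < m" "j < m" for i j
      using mat_mult_index[of "mat_adjoint T" m m T m i j] uT that by (auto split: if_splits)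
    have "(mat_adjoint S * S) $$ (i, j) = (\<Sum>k<?n. mat_adjoint S $$ (i, k) * S $$ (k, j))"
      using S ij by (intro mat_mult_index) auto
    also have "\<dots> = (\<Sum>k<?n. cnj (S $$ (k, i)) * S $$ (k, j))"
      using S ij by (intro sum.cong) auto
    also have "\<dots> = 1\<^sub>m ?n $$ (i, j)"
      unfolding sum.lessThan_Suc_shift using ij TT by (cases i; cases j) (auto simp: S_def)
    finally show "(mat_adjoint S * S) $$ (i, j) = 1\<^sub>m ?n $$ (i, j)" .
  qed (use S in auto)
  have "H = S * mat_diag ?n f * mat_adjoint S"
  proof (rule eq_matI)
    fix i j assume "i < dim_row (S * mat_diag ?n f * mat_adjoint S)" "j < dim_col (S * mat_diag ?n f * mat_adjoint S)"
    then have ij: "i < ?n" "j < ?n" using S by auto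
    have diag: "(Y * mat_diag k g * mat_adjoint Y) $$ (i, j) = (\<Sum>l<k. Y $$ (i, l) * g l * cnj (Y $$ (j, l)))"
      if Y: "Y \<in> carrier_mat k k" "i < k" "j < k" for Y k g i j
      using Y by (subst mat_mult_index[of _ k k _ k]) (auto simp: mat_diag_mult_right[OF Y(1)] intro!: sum.cong)
    have AT: "H $$ (Suc i, Suc j) = (\<Sum>l<m. T $$ (i, l) * d l * cnj (T $$ (j, l)))" if "i < m" "j < m" for i j
      using diag[OF uT(1) that, of d] that by (simp flip: T(2)) (simp add: A'_def)
    show "H $$ (i, j) = (S * mat_diag ?n f * mat_adjoint S) $$ (i, j)"
      unfolding diag[OF S ij] sum.lessThan_Suc_shift
      using ij AT row0 col0 by (cases i; cases j) (auto simp: S_def f_def)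
  qed (use H S in auto)
  then have "A = (W * S) * mat_diag ?n f * mat_adjoint (W * S)"
    using AWH W S by (simp add: mat_adjoint_mult[OF W S] assoc_mult_mat[of _ ?n ?n _ ?n _ ?n] mult_carrier_mat[of _ ?n ?n _ ?n])
  then show ?case using unitary_mat_mult[OF uW uS] by blast
qed

text \<open>The eigenvalues are the squared lengths of the columns of \<open>U * T\<close>, positive
  because \<open>U\<close> is invertible. Writing them as exponentials of real numbers prepares for
  arbitrary complex powers.\<close>

lemma gram_matrix_spectral:
  assumes U: "U \<in> carrier_mat n n" and V: "V \<in> carrier_mat n n" "V * U = 1\<^sub>m n"
  shows "\<exists>T (l :: nat \<Rightarrow> real). unitary_mat n T \<and>
    mat_adjoint U * U = T * mat_diag n (\<lambda>i. exp (of_real (l i))) * mat_adjoint T"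
proof -
  let ?Q = "mat_adjoint U * U"
  have Q: "?Q \<in> carrier_mat n n" using U by auto
  have "mat_adjoint ?Q = ?Q" using U by (simp add: mat_adjoint_mult[of _ n n])
  then obtain T d where T: "unitary_mat n T" "?Q = T * mat_diag n d * mat_adjoint T"
    using hermitian_diagonalization[OF Q] by blast
  note uT = unitary_matD[OF T(1)]
  have UT: "U * T \<in> carrier_mat n n" using U uT by auto
  have "mat_adjoint (U * T) * (U * T) = (mat_adjoint T * T) * mat_diag n d * (mat_adjoint T * T)"
  proof -
    have "mat_adjoint (U * T) * (U * T) = mat_adjoint T * ?Q * T"
      using U uT(1) Q by (simp add: mat_adjoint_mult[OF U uT(1)] assoc_mult_mat[of _ n n _ n _ n] mult_carrier_mat[of _ n n _ n])
    then show ?thesis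
      unfolding T(2) using uT(1) by (simp add: assoc_mult_mat[of _ n n _ n _ n] mult_carrier_mat[of _ n n _ n])
  qed
  then have D: "mat_adjoint (U * T) * (U * T) = mat_diag n d"
    using uT by (simp add: left_mult_one_mat[of _ n n] right_mult_one_mat[of _ n n])
  have d: "\<exists>r>0. d i = of_real r" if i: "i < n" for i
  proof -
    have "d i = (\<Sum>k<n. mat_adjoint (U * T) $$ (i, k) * (U * T) $$ (k, i))"
      using arg_cong[OF D, of "\<lambda>M. M $$ (i, i)"] mat_mult_index[of "mat_adjoint (U * T)" n n "U * T" n i i] UT i
      by (simp add: mat_diag_def)
    also have "\<dots> = of_real (\<Sum>k<n. (cmod ((U * T) $$ (k, i)))\<^sup>2)"
      unfolding of_real_sum using U uT i by (intro sum.cong) (auto simp: of_real_cmod_square mult.commute)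
    finally have di: "d i = of_real (\<Sum>k<n. (cmod ((U * T) $$ (k, i)))\<^sup>2)" .
    have "\<exists>k<n. (U * T) $$ (k, i) \<noteq> 0"
    proof (rule ccontr)
      assume "\<not> ?thesis"
      moreover have "(mat_adjoint T * V) * (U * T) = 1\<^sub>m n"
      proof -
        have "(mat_adjoint T * V) * (U * T) = mat_adjoint T * ((V * U) * T)"
          using U V(1) uT(1) by (simp add: assoc_mult_mat[of _ n n _ n _ n] mult_carrier_mat[of _ n n _ n])
        then show ?thesis using V uT by simp
      qed
      then have "1 = (\<Sum>k<n. (mat_adjoint T * V) $$ (i, k) * (U * T) $$ (k, i))"
        using mat_mult_index[of "mat_adjoint T * V" n n "U * T" n i i] UT V uT i
          mult_carrier_mat[of "mat_adjoint T" n n V n] by simp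
      ultimately show False by simp
    qed
    then have "(\<Sum>k<n. (cmod ((U * T) $$ (k, i)))\<^sup>2) > 0"
      by (intro sum_pos2[where i = "SOME k. k < n \<and> (U * T) $$ (k, i) \<noteq> 0"])
        (auto simp del: index_mult_mat dest!: someI_ex)
    then show ?thesis using di by blast
  qed
  then have "mat_diag n d = mat_diag n (\<lambda>i. exp (of_real (ln (Re (d i)))))"
    by (intro eq_matI) (auto simp: mat_diag_def exp_of_real dest!: d)
  then show ?thesis using T by (intro exI[of _ T] exI[of _ "\<lambda>i. ln (Re (d i))"]) auto
qed

text \<open>The z-th power of the positive matrix with eigenbasis \<open>T\<close> and logarithmic
  eigenvalues \<open>l\<close>: the matrix itself for z = 1, its inverse for z = -1, a unitary for
  imaginary z. Eigenbasis and logarithms are part of the data, so no branch of a power has to be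
  chosen.\<close>

definition spec_power :: "nat \<Rightarrow> complex mat \<Rightarrow> (nat \<Rightarrow> real) \<Rightarrow> complex \<Rightarrow> complex mat" where
  "spec_power n T l z = T * mat_diag n (\<lambda>i. exp (z * of_real (l i))) * mat_adjoint T"

lemma cnj_exp: "cnj (exp z) = exp (cnj z)"
  by (simp add: exp_eq_polar cis_cnj)

context
  fixes n T assumes T: "unitary_mat n T"
begin

private lemma carriers: "T \<in> carrier_mat n n" "mat_adjoint T \<in> carrier_mat n n" "mat_diag n f \<in> carrier_mat n n"
  using unitary_matD(1)[OF T] by simp_all

private lemmas assoc = assoc_mult_mat[of _ n n _ n _ n] mult_carrier_mat[of _ n n _ n] carriers

private lemma cancel:
  assumes "A \<in> carrier_mat n n"
  shows "mat_adjoint T * (T * A) = A" "T * (mat_adjoint T * A) = A"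
  using assms unitary_matD[OF T] carriers
  by (simp_all add: left_mult_one_mat[of _ n n] flip: assoc_mult_mat[of _ n n _ n _ n])

lemma spec_power_carrier: "spec_power n T l z \<in> carrier_mat n n"
  by (simp add: spec_power_def assoc)

lemma spec_power_mult: "spec_power n T l z * spec_power n T l w = spec_power n T l (z + w)"
proof -
  have "spec_power n T l z * spec_power n T l w =
    T * ((mat_diag n (\<lambda>i. exp (z * of_real (l i))) * mat_diag n (\<lambda>i. exp (w * of_real (l i)))) * mat_adjoint T)"
    unfolding spec_power_def by (simp add: assoc cancel del: mat_diag_diag)
  then show ?thesis
    by (simp add: spec_power_def assoc mult_exp_exp distrib_right del: assoc_mult_mat)
qed

lemma spec_power_zero: "spec_power n T l 0 = 1\<^sub>m n"
  using unitary_matD[OF T] by (simp add: spec_power_def right_mult_one_mat[of _ n n])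

lemma spec_power_adjoint: "mat_adjoint (spec_power n T l z) = spec_power n T l (cnj z)"
proof -
  have "mat_adjoint (mat_diag n (\<lambda>i. exp (z * of_real (l i)))) = mat_diag n (\<lambda>i. exp (cnj z * of_real (l i)))"
    by (rule eq_matI) (auto simp: mat_diag_def cnj_exp)
  then show ?thesis
    by (simp add: spec_power_def mat_adjoint_mult[of _ n n _ n] assoc)
qed

lemma adjoint_mult_spec_power:
  "mat_adjoint T * spec_power n T l z = mat_diag n (\<lambda>i. exp (z * of_real (l i))) * mat_adjoint T"
  by (simp add: spec_power_def assoc cancel)

lemma spec_power_mult_basis:
  "spec_power n T l z * T = T * mat_diag n (\<lambda>i. exp (z * of_real (l i)))"
  using unitary_matD[OF T] by (simp add: spec_power_def assoc right_mult_one_mat[of _ n n])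

lemma spec_power_unique_inverse:
  assumes "V \<in> carrier_mat n n" "spec_power n T l z * V = 1\<^sub>m n"
  shows "V = spec_power n T l (- z)"
proof -
  have "V = (spec_power n T l (- z) * spec_power n T l z) * V"
    using assms by (simp add: spec_power_mult spec_power_zero)
  also have "\<dots> = spec_power n T l (- z) * (spec_power n T l z * V)"
    using assms spec_power_carrier by (intro assoc_mult_mat[of _ n n _ n _ n]) auto
  finally show ?thesis using assms spec_power_carrier by (simp add: right_mult_one_mat[of _ n n])
qed

end

type_synonym tensor = "nat \<Rightarrow> nat \<Rightarrow> nat \<Rightarrow> nat \<Rightarrow> complex"

section \<open>Change of bases in fusion spaces\<close>

text \<open>The action of base changes on one block of F symbols. \<open>A\<close> and
  \<open>B\<close> act on the indices of the two left vertices, \<open>M\<close> and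
  \<open>N\<close> from the other side on those of the right ones; this is why products in the last
  two places come in reverse order in \<open>tact_mult\<close>.\<close>

definition tact :: "complex mat \<Rightarrow> complex mat \<Rightarrow> complex mat \<Rightarrow> complex mat \<Rightarrow> tensor \<Rightarrow> tensor" where
  "tact A B M N Y = (\<lambda>\<alpha> \<beta> \<mu> \<nu>.
     \<Sum>\<alpha>'<dim_col A. \<Sum>\<beta>'<dim_col B. \<Sum>\<mu>'<dim_row M. \<Sum>\<nu>'<dim_row N.
       A $$ (\<alpha>, \<alpha>') * B $$ (\<beta>, \<beta>') * Y \<alpha>' \<beta>' \<mu>' \<nu>' * M $$ (\<mu>', \<mu>) * N $$ (\<nu>', \<nu>))"

text \<open>Tensors are total functions whose components beyond the dimensions carry no meaning, so
  equality is required within range only.\<close>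

definition tensor_eq :: "nat \<Rightarrow> nat \<Rightarrow> nat \<Rightarrow> nat \<Rightarrow> tensor \<Rightarrow> tensor \<Rightarrow> bool" where
  "tensor_eq a b m n Y Z \<longleftrightarrow> (\<forall>\<alpha><a. \<forall>\<beta><b. \<forall>\<mu><m. \<forall>\<nu><n. Y \<alpha> \<beta> \<mu> \<nu> = Z \<alpha> \<beta> \<mu> \<nu>)"

lemma tensor_eq_sym: "tensor_eq a b m n Y Z \<Longrightarrow> tensor_eq a b m n Z Y"
  by (simp add: tensor_eq_def)

lemma tensor_eq_trans [trans]: "tensor_eq a b m n Y Z \<Longrightarrow> tensor_eq a b m n Z W \<Longrightarrow> tensor_eq a b m n Y W"
  by (simp add: tensor_eq_def)

lemma sum4_cartesian:
  "(\<Sum>x<a. \<Sum>y<b. \<Sum>z<m. \<Sum>w<n. f x y z w) =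
    (\<Sum>(x, y, z, w)\<in>{..<a} \<times> {..<b} \<times> {..<m} \<times> {..<(n::nat)}. f x y z w :: complex)"
  by (simp add: sum.cartesian_product)

lemma sum4_product:
  "(\<Sum>x<a. \<Sum>y<b. \<Sum>z<m. \<Sum>w<n. f x * g y * h z * k w) =
    (\<Sum>x<a. f x) * (\<Sum>y<b. g y) * (\<Sum>z<m. h z) * (\<Sum>w<(n::nat). k w :: complex)"
  by (simp add: mult.assoc flip: sum_distrib_left sum_distrib_right)

lemma tact_mult:
  assumes A: "A \<in> carrier_mat a a" "A' \<in> carrier_mat a a" and B: "B \<in> carrier_mat b b" "B' \<in> carrier_mat b b"
    and M: "M \<in> carrier_mat m m" "M' \<in> carrier_mat m m" and N: "N \<in> carrier_mat n n" "N' \<in> carrier_mat n n"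
  shows "tensor_eq a b m n (tact A B M N (tact A' B' M' N' Y)) (tact (A * A') (B * B') (M' * M) (N' * N) Y)"
  unfolding tensor_eq_def
proof (intro allI impI)
  fix \<alpha> \<beta> \<mu> \<nu> assume i: "\<alpha> < a" "\<beta> < b" "\<mu> < m" "\<nu> < n"
  \<comment> \<open>Merging the four summations into one over a product set reduces the claim to a
    single exchange of sums and a factorization of the kernel.\<close>
  let ?I = "{..<a} \<times> {..<b} \<times> {..<m} \<times> {..<n}"
  define K where "K = (\<lambda>(x, y, z, w). A $$ (\<alpha>, x) * B $$ (\<beta>, y) * M $$ (z, \<mu>) * N $$ (w, \<nu>))"
  define K' where "K' = (\<lambda>(x, y, z, w) (x', y', z', w'). A' $$ (x, x') * B' $$ (y, y') * M' $$ (z', z) * N' $$ (w', w))"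
  define Y' where "Y' = (\<lambda>(x, y, z, w). Y x y z w)"
  have "tact A B M N (tact A' B' M' N' Y) \<alpha> \<beta> \<mu> \<nu> = (\<Sum>p\<in>?I. K p * (\<Sum>p'\<in>?I. K' p p' * Y' p'))"
    unfolding tact_def using carrier_matD[OF A(1)] carrier_matD[OF A(2)] carrier_matD[OF B(1)] carrier_matD[OF B(2)]
      carrier_matD[OF M(1)] carrier_matD[OF M(2)] carrier_matD[OF N(1)] carrier_matD[OF N(2)]
    by (simp only: sum4_cartesian) (auto intro!: sum.cong simp: K_def K'_def Y'_def mult_ac)
  also have "\<dots> = (\<Sum>p'\<in>?I. (\<Sum>p\<in>?I. K p * K' p p') * Y' p')"
    unfolding sum_distrib_left sum_distrib_right by (subst sum.swap) (simp add: mult.assoc)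
  also have "\<dots> = (\<Sum>(x', y', z', w')\<in>?I. (A * A') $$ (\<alpha>, x') * (B * B') $$ (\<beta>, y') * Y x' y' z' w' *
      (M' * M) $$ (z', \<mu>) * (N' * N) $$ (w', \<nu>))"
  proof (rule sum.cong[OF refl])
    fix p' assume p': "p' \<in> ?I"
    obtain x' y' z' w' where p'_eq: "p' = (x', y', z', w')" by (cases p')
    have j: "x' < a" "y' < b" "z' < m" "w' < n" using p' by (auto simp: p'_eq)
    have "(\<Sum>p\<in>?I. K p * K' p p') = (\<Sum>x<a. \<Sum>y<b. \<Sum>z<m. \<Sum>w<n.
        (A $$ (\<alpha>, x) * A' $$ (x, x')) * (B $$ (\<beta>, y) * B' $$ (y, y')) * (M' $$ (z', z) * M $$ (z, \<mu>)) * (N' $$ (w', w) * N $$ (w, \<nu>)))"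
      unfolding sum4_cartesian by (intro sum.cong) (auto simp: K_def K'_def p'_eq mult_ac)
    also have "\<dots> = (A * A') $$ (\<alpha>, x') * (B * B') $$ (\<beta>, y') * (M' * M) $$ (z', \<mu>) * (N' * N) $$ (w', \<nu>)"
      unfolding sum4_product mat_mult_index[OF A i(1) j(1)] mat_mult_index[OF B i(2) j(2)]
        mat_mult_index[OF M(2,1) j(3) i(3)] mat_mult_index[OF N(2,1) j(4) i(4)] ..
    finally show "(\<Sum>p\<in>?I. K p * K' p p') * Y' p' = (case p' of (x', y', z', w') \<Rightarrow>
        (A * A') $$ (\<alpha>, x') * (B * B') $$ (\<beta>, y') * Y x' y' z' w' * (M' * M) $$ (z', \<mu>) * (N' * N) $$ (w', \<nu>))"
      by (simp add: p'_eq Y'_def mult_ac del: index_mult_mat)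
  qed
  also have "\<dots> = tact (A * A') (B * B') (M' * M) (N' * N) Y \<alpha> \<beta> \<mu> \<nu>"
    unfolding tact_def using assms by (simp add: sum4_cartesian del: index_mult_mat(1))
  finally show "tact A B M N (tact A' B' M' N' Y) \<alpha> \<beta> \<mu> \<nu> = tact (A * A') (B * B') (M' * M) (N' * N) Y \<alpha> \<beta> \<mu> \<nu>" .
qed

lemma tact_cong:
  assumes "A \<in> carrier_mat a a" "B \<in> carrier_mat b b" "M \<in> carrier_mat m m" "N \<in> carrier_mat n n"
    and "tensor_eq a b m n Y Z"
  shows "tact A B M N Y = tact A B M N Z"
  using assms by (intro ext) (auto simp: tact_def tensor_eq_def intro!: sum.cong)

lemma tact_mat_diag:
  "tensor_eq a b m n (tact (mat_diag a f) (mat_diag b g) (mat_diag m h) (mat_diag n k) Y)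
    (\<lambda>\<alpha> \<beta> \<mu> \<nu>. f \<alpha> * g \<beta> * Y \<alpha> \<beta> \<mu> \<nu> * h \<mu> * k \<nu>)"
  unfolding tensor_eq_def
proof (intro allI impI)
  fix \<alpha> \<beta> \<mu> \<nu> assume i: "\<alpha> < a" "\<beta> < b" "\<mu> < m" "\<nu> < n"
  have "tact (mat_diag a f) (mat_diag b g) (mat_diag m h) (mat_diag n k) Y \<alpha> \<beta> \<mu> \<nu> =
    (\<Sum>p\<in>{..<a} \<times> {..<b} \<times> {..<m} \<times> {..<n}. if p = (\<alpha>, \<beta>, \<mu>, \<nu>) then f \<alpha> * g \<beta> * Y \<alpha> \<beta> \<mu> \<nu> * h \<mu> * k \<nu> else 0)"
    unfolding tact_def carrier_matD(1)[OF mat_diag_dim] carrier_matD(2)[OF mat_diag_dim] sum4_cartesian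
    using i by (intro sum.cong[OF refl]) (auto simp: mat_diag_def split: if_splits)
  also have "\<dots> = f \<alpha> * g \<beta> * Y \<alpha> \<beta> \<mu> \<nu> * h \<mu> * k \<nu>"
    using i by (simp add: sum.delta)
  finally show "tact (mat_diag a f) (mat_diag b g) (mat_diag m h) (mat_diag n k) Y \<alpha> \<beta> \<mu> \<nu> =
    f \<alpha> * g \<beta> * Y \<alpha> \<beta> \<mu> \<nu> * h \<mu> * k \<nu>" .
qed

lemma tact_one: "tensor_eq a b m n (tact (1\<^sub>m a) (1\<^sub>m b) (1\<^sub>m m) (1\<^sub>m n) Y) Y"
  using tact_mat_diag[of a b m n "\<lambda>_. 1" "\<lambda>_. 1" "\<lambda>_. 1" "\<lambda>_. 1" Y] by simp

lemma tact_matrix: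
  assumes "A \<in> carrier_mat a a" "M \<in> carrier_mat m m" "Y \<in> carrier_mat a m" "\<alpha> < a" "\<mu> < m"
  shows "tact A (1\<^sub>m 1) M (1\<^sub>m 1) (\<lambda>\<alpha> _ \<mu> _. Y $$ (\<alpha>, \<mu>)) \<alpha> 0 \<mu> 0 = (A * Y * M) $$ (\<alpha>, \<mu>)"
proof -
  have AY: "A * Y \<in> carrier_mat a m" using assms by simp
  have "(A * Y * M) $$ (\<alpha>, \<mu>) = (\<Sum>z<m. (\<Sum>x<a. A $$ (\<alpha>, x) * Y $$ (x, z)) * M $$ (z, \<mu>))"
    using assms by (simp add: mat_mult_index[OF AY assms(2)] mat_mult_index[OF assms(1,3)] del: index_mult_mat(1) assoc_mult_mat)
  also have "\<dots> = (\<Sum>x<a. \<Sum>z<m. A $$ (\<alpha>, x) * Y $$ (x, z) * M $$ (z, \<mu>))"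
    unfolding sum_distrib_right by (rule sum.swap)
  also have "\<dots> = tact A (1\<^sub>m 1) M (1\<^sub>m 1) (\<lambda>\<alpha> _ \<mu> _. Y $$ (\<alpha>, \<mu>)) \<alpha> 0 \<mu> 0"
    using assms by (auto simp: tact_def)
  finally show ?thesis ..
qed

text \<open>An R symbol is a tensor with two further legs of dimension one. In this guise the
  braiding equation is covered by the same eigenvalue argument as the F equation.\<close>

lemma matrix_eq_iff_tensor:
  assumes "A \<in> carrier_mat a a" "M \<in> carrier_mat m m" "Y \<in> carrier_mat a m" "Z \<in> carrier_mat a m"
  shows "A * Y * M = Z \<longleftrightarrow>
    tensor_eq a 1 m 1 (tact A (1\<^sub>m 1) M (1\<^sub>m 1) (\<lambda>\<alpha> _ \<mu> _. Y $$ (\<alpha>, \<mu>))) (\<lambda>\<alpha> _ \<mu> _. Z $$ (\<alpha>, \<mu>))"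
    (is "?l = ?r")
proof
  show ?r if ?l using that assms by (auto simp: tensor_eq_def tact_matrix simp del: index_mult_mat One_nat_def)
  show ?l if ?r
    using that assms tact_matrix[OF assms(1-3)]
    by (intro eq_matI) (auto simp: tensor_eq_def simp del: index_mult_mat(1) One_nat_def)
qed

text \<open>In eigenbases the invariance says that the weights of the indices of every nonzero component cancel.\<close>

lemma tact_spec_power:
  assumes u: "unitary_mat a T1" "unitary_mat b T2" "unitary_mat m T3" "unitary_mat n T4"
    and inv: "tensor_eq a b m n
      (tact (spec_power a T1 l1 1) (spec_power b T2 l2 1) (spec_power m T3 l3 (- 1)) (spec_power n T4 l4 (- 1)) Y) Y"
  shows "tensor_eq a b m n
      (tact (spec_power a T1 l1 z) (spec_power b T2 l2 z) (spec_power m T3 l3 (- z)) (spec_power n T4 l4 (- z)) Y) Y"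
proof -
  note c = unitary_matD(1)[OF u(1)] unitary_matD(1)[OF u(2)] unitary_matD(1)[OF u(3)] unitary_matD(1)[OF u(4)]
  note c' = c[THEN mat_adjoint_carrier]
  note s = spec_power_carrier[OF u(1)] spec_power_carrier[OF u(2)] spec_power_carrier[OF u(3)] spec_power_carrier[OF u(4)]
  define E :: "nat \<Rightarrow> (nat \<Rightarrow> real) \<Rightarrow> complex \<Rightarrow> complex mat"
    where "E = (\<lambda>n l z. mat_diag n (\<lambda>i. exp (z * of_real (l i))))"
  have E: "E n l z \<in> carrier_mat n n" for n l z by (simp add: E_def)
  \<comment> \<open>\<open>Z\<close> is the tensor in the eigenbases, where spectral powers act
    diagonally.\<close>
  define Z where "Z = tact (mat_adjoint T1) (mat_adjoint T2) T3 T4 Y"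
  have P: "tensor_eq a b m n (tact (mat_adjoint T1) (mat_adjoint T2) T3 T4
      (tact (spec_power a T1 l1 z) (spec_power b T2 l2 z) (spec_power m T3 l3 (- z)) (spec_power n T4 l4 (- z)) Y))
      (tact (E a l1 z) (E b l2 z) (E m l3 (- z)) (E n l4 (- z)) Z)" for z
  proof -
    have "tensor_eq a b m n (tact (mat_adjoint T1) (mat_adjoint T2) T3 T4
      (tact (spec_power a T1 l1 z) (spec_power b T2 l2 z) (spec_power m T3 l3 (- z)) (spec_power n T4 l4 (- z)) Y))
      (tact (E a l1 z * mat_adjoint T1) (E b l2 z * mat_adjoint T2) (T3 * E m l3 (- z)) (T4 * E n l4 (- z)) Y)"
      using tact_mult[OF c'(1) s(1) c'(2) s(2) c(3) s(3) c(4) s(4)]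
      unfolding E_def by (simp only: u adjoint_mult_spec_power spec_power_mult_basis)
    also have "tensor_eq a b m n \<dots> (tact (E a l1 z) (E b l2 z) (E m l3 (- z)) (E n l4 (- z)) Z)"
      unfolding Z_def by (rule tensor_eq_sym, rule tact_mult) (rule E c c')+
    finally show ?thesis .
  qed
  have "tensor_eq a b m n (tact (E a l1 1) (E b l2 1) (E m l3 (- 1)) (E n l4 (- 1)) Z) Z"
    using P[of 1] tact_cong[OF c'(1,2) c(3,4) inv] by (simp add: Z_def tensor_eq_def)
  then have Z1: "Z \<alpha> \<beta> \<mu> \<nu> = exp (of_real (l1 \<alpha>)) * exp (of_real (l2 \<beta>)) * Z \<alpha> \<beta> \<mu> \<nu> * exp (- of_real (l3 \<mu>)) * exp (- of_real (l4 \<nu>))"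
    if "\<alpha> < a" "\<beta> < b" "\<mu> < m" "\<nu> < n" for \<alpha> \<beta> \<mu> \<nu>
    using that tact_mat_diag[of a b m n _ _ _ _ Z] by (simp add: E_def tensor_eq_def)
  have "tensor_eq a b m n (tact (E a l1 z) (E b l2 z) (E m l3 (- z)) (E n l4 (- z)) Z) Z"
    unfolding tensor_eq_def
  proof (intro allI impI)
    fix \<alpha> \<beta> \<mu> \<nu> assume i: "\<alpha> < a" "\<beta> < b" "\<mu> < m" "\<nu> < n"
    let ?x = "l1 \<alpha> + l2 \<beta> - l3 \<mu> - l4 \<nu>"
    have "Z \<alpha> \<beta> \<mu> \<nu> = of_real (exp ?x) * Z \<alpha> \<beta> \<mu> \<nu>"
      by (subst Z1[OF i]) (simp add: exp_of_real exp_add exp_diff exp_minus field_simps)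
    \<comment> \<open>The weight \<open>?x\<close> is real, so \<open>exp ?x = 1\<close> forces
      \<open>?x = 0\<close>. This is where positivity of the eigenvalues enters: complex logarithms
      would leave a multiple of 2 pi i.\<close>
    then have "Z \<alpha> \<beta> \<mu> \<nu> = 0 \<or> ?x = 0" by (auto simp: mult_cancel_right1)
    moreover have "exp (z * of_real (l1 \<alpha>)) * exp (z * of_real (l2 \<beta>)) * Z \<alpha> \<beta> \<mu> \<nu> * exp (- z * of_real (l3 \<mu>)) * exp (- z * of_real (l4 \<nu>))
      = exp (z * of_real ?x) * Z \<alpha> \<beta> \<mu> \<nu>"
      by (simp add: mult_exp_exp algebra_simps flip: exp_add)
    moreover have "tact (E a l1 z) (E b l2 z) (E m l3 (- z)) (E n l4 (- z)) Z \<alpha> \<beta> \<mu> \<nu> =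
      exp (z * of_real (l1 \<alpha>)) * exp (z * of_real (l2 \<beta>)) * Z \<alpha> \<beta> \<mu> \<nu> * exp (- z * of_real (l3 \<mu>)) * exp (- z * of_real (l4 \<nu>))"
      using i tact_mat_diag[of a b m n _ _ _ _ Z] unfolding E_def tensor_eq_def by blast
    ultimately show "tact (E a l1 z) (E b l2 z) (E m l3 (- z)) (E n l4 (- z)) Z \<alpha> \<beta> \<mu> \<nu> = Z \<alpha> \<beta> \<mu> \<nu>"
      by (elim disjE) (simp_all only: of_real_0 mult_zero_right mult_zero_left exp_zero mult_1_left)
  qed
  then have "tensor_eq a b m n (tact (mat_adjoint T1) (mat_adjoint T2) T3 T4
      (tact (spec_power a T1 l1 z) (spec_power b T2 l2 z) (spec_power m T3 l3 (- z)) (spec_power n T4 l4 (- z)) Y)) Z"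
    using P tensor_eq_trans by blast
  then have "tact T1 T2 (mat_adjoint T3) (mat_adjoint T4) (tact (mat_adjoint T1) (mat_adjoint T2) T3 T4
      (tact (spec_power a T1 l1 z) (spec_power b T2 l2 z) (spec_power m T3 l3 (- z)) (spec_power n T4 l4 (- z)) Y))
    = tact T1 T2 (mat_adjoint T3) (mat_adjoint T4) Z"
    by (rule tact_cong[OF c(1,2) c'(3,4)])
  moreover have "tensor_eq a b m n (tact T1 T2 (mat_adjoint T3) (mat_adjoint T4) (tact (mat_adjoint T1) (mat_adjoint T2) T3 T4 W)) W" for W
    using tensor_eq_trans[OF tact_mult[OF c(1) c'(1) c(2) c'(2) c'(3) c(3) c'(4) c(4)] ] tact_one
      unitary_matD(3)[OF u(1)] unitary_matD(3)[OF u(2)] unitary_matD(3)[OF u(3)] unitary_matD(3)[OF u(4)]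
    by simp
  ultimately show ?thesis
    unfolding Z_def by (metis tensor_eq_sym tensor_eq_trans)
qed

context complex_embedding
begin

lemma tact_hom:
  assumes A: "A \<in> carrier_mat a a" "B \<in> carrier_mat b b" "M \<in> carrier_mat m m" "N \<in> carrier_mat n n"
    and el: "elements_mat A \<subseteq> E" "elements_mat B \<subseteq> E" "elements_mat M \<subseteq> E" "elements_mat N \<subseteq> E"
    and Y: "\<And>\<alpha> \<beta> \<mu> \<nu>. \<alpha> < a \<Longrightarrow> \<beta> < b \<Longrightarrow> \<mu> < m \<Longrightarrow> \<nu> < n \<Longrightarrow> Y \<alpha> \<beta> \<mu> \<nu> \<in> E"
  shows "tensor_eq a b m n (tact (map_mat \<tau> A) (map_mat \<tau> B) (map_mat \<tau> M) (map_mat \<tau> N) (\<lambda>\<alpha> \<beta> \<mu> \<nu>. \<tau> (Y \<alpha> \<beta> \<mu> \<nu>)))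
    (\<lambda>\<alpha> \<beta> \<mu> \<nu>. \<tau> (tact A B M N Y \<alpha> \<beta> \<mu> \<nu>))"
  unfolding tensor_eq_def
proof (intro allI impI)
  fix \<alpha> \<beta> \<mu> \<nu> assume i: "\<alpha> < a" "\<beta> < b" "\<mu> < m" "\<nu> < n"
  let ?I = "{..<a} \<times> {..<b} \<times> {..<m} \<times> {..<n}"
  have mem: "A $$ (\<alpha>, x) \<in> E" "B $$ (\<beta>, y) \<in> E" "M $$ (z, \<mu>) \<in> E" "N $$ (w, \<nu>) \<in> E"
    if "x < a" "y < b" "z < m" "w < n" for x y z w
    using that i el elements_matI[of _ A] elements_matI[of _ B] elements_matI[of _ M] elements_matI[of _ N] A
    by auto
  show "tact (map_mat \<tau> A) (map_mat \<tau> B) (map_mat \<tau> M) (map_mat \<tau> N) (\<lambda>\<alpha> \<beta> \<mu> \<nu>. \<tau> (Y \<alpha> \<beta> \<mu> \<nu>)) \<alpha> \<beta> \<mu> \<nu> =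
    \<tau> (tact A B M N Y \<alpha> \<beta> \<mu> \<nu>)"
    unfolding tact_def index_map_mat(2,3) carrier_matD(1)[OF A(3)] carrier_matD(2)[OF A(1)] carrier_matD(1)[OF A(4)] carrier_matD(2)[OF A(2)]
      sum4_cartesian
    using mem Y i A by (subst hom_sum) (auto simp: split_beta hom_mult mult_mem intro!: sum.cong)
qed

end


section \<open>The symmetry equations\<close>

definition Ften :: "'a mtc_data \<Rightarrow> 'a \<Rightarrow> 'a \<Rightarrow> 'a \<Rightarrow> 'a \<Rightarrow> 'a \<Rightarrow> 'a \<Rightarrow> tensor" where
  "Ften C a b c d e f = (\<lambda>\<alpha> \<beta> \<mu> \<nu>. Fsym C a b c d (e, \<alpha>, \<beta>) (f, \<mu>, \<nu>))"

definition R_dims :: "'a mtc_data \<Rightarrow> bool" where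
  "R_dims C \<longleftrightarrow> (\<forall>a b c. Rsym C a b c \<in> carrier_mat (fus C b a c) (fus C a b c))"

definition inverse_pair :: "'a mtc_data \<Rightarrow> ('a \<Rightarrow> 'a \<Rightarrow> 'a \<Rightarrow> complex mat) \<Rightarrow> ('a \<Rightarrow> 'a \<Rightarrow> 'a \<Rightarrow> complex mat) \<Rightarrow> bool" where
  "inverse_pair C U V \<longleftrightarrow> (\<forall>a b c.
     U a b c \<in> carrier_mat (fus C a b c) (fus C a b c) \<and> V a b c \<in> carrier_mat (fus C a b c) (fus C a b c) \<and>
     U a b c * V a b c = 1\<^sub>m (fus C a b c))"

text \<open>The symmetry equations for invertible, not necessarily unitary, matrices \<open>U\<close> with inverses \<open>V\<close>,
  and with an arbitrary map \<open>k\<close> of the coefficients in the role of \<open>K\<^sup>g\<close>.\<close>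

definition lin_sym :: "'a mtc_data \<Rightarrow> ('a \<Rightarrow> 'a) \<Rightarrow> (complex \<Rightarrow> complex) \<Rightarrow>
    ('a \<Rightarrow> 'a \<Rightarrow> 'a \<Rightarrow> complex mat) \<Rightarrow> ('a \<Rightarrow> 'a \<Rightarrow> 'a \<Rightarrow> complex mat) \<Rightarrow> bool" where
  "lin_sym C p k U V \<longleftrightarrow> bij p \<and> (\<forall>a b c. fus C (p a) (p b) (p c) = fus C a b c) \<and> inverse_pair C U V \<and>
     (\<forall>a b c. U (p b) (p a) (p c) * Rsym C (p a) (p b) (p c) * V (p a) (p b) (p c) = map_mat k (Rsym C a b c)) \<and>
     (\<forall>a b c d e f. tensor_eq (fus C a b e) (fus C e c d) (fus C b c f) (fus C a f d)
        (tact (U (p a) (p b) (p e)) (U (p e) (p c) (p d)) (V (p b) (p c) (p f)) (V (p a) (p f) (p d))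
          (Ften C (p a) (p b) (p c) (p d) (p e) (p f)))
        (\<lambda>\<alpha> \<beta> \<mu> \<nu>. k (Ften C a b c d e f \<alpha> \<beta> \<mu> \<nu>)))"

lemma inverse_pairD:
  assumes "inverse_pair C U V"
  shows "U a b c \<in> carrier_mat (fus C a b c) (fus C a b c)" "V a b c \<in> carrier_mat (fus C a b c) (fus C a b c)"
    "U a b c * V a b c = 1\<^sub>m (fus C a b c)" "V a b c * U a b c = 1\<^sub>m (fus C a b c)"
  using assms mat_mult_left_right_inverse[of "U a b c" "fus C a b c" "V a b c"] by (auto simp: inverse_pair_def)

lemma inverse_pair_mat_inv: "inverse_pair C U V \<Longrightarrow> mat_inv (U a b c) = V a b c"
  by (rule mat_inv_eqI) (rule inverse_pairD; assumption)+

lemma lin_symD: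
  assumes "lin_sym C p k U V"
  shows "bij p" "fus C (p a) (p b) (p c) = fus C a b c" "inverse_pair C U V"
    "U (p b) (p a) (p c) * Rsym C (p a) (p b) (p c) * V (p a) (p b) (p c) = map_mat k (Rsym C a b c)"
    "tensor_eq (fus C a b e) (fus C e c d) (fus C b c f) (fus C a f d)
        (tact (U (p a) (p b) (p e)) (U (p e) (p c) (p d)) (V (p b) (p c) (p f)) (V (p a) (p f) (p d))
          (Ften C (p a) (p b) (p c) (p d) (p e) (p f)))
        (\<lambda>\<alpha> \<beta> \<mu> \<nu>. k (Ften C a b c d e f \<alpha> \<beta> \<mu> \<nu>))"
  using assms by (simp_all add: lin_sym_def)

lemma lin_sym_carriers:
  assumes "lin_sym C p k U V"
  shows "U (p a) (p b) (p c) \<in> carrier_mat (fus C a b c) (fus C a b c)"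
    "V (p a) (p b) (p c) \<in> carrier_mat (fus C a b c) (fus C a b c)"
    "U (p a) (p b) (p c) * V (p a) (p b) (p c) = 1\<^sub>m (fus C a b c)"
    "V (p a) (p b) (p c) * U (p a) (p b) (p c) = 1\<^sub>m (fus C a b c)"
  using inverse_pairD[OF lin_symD(3)[OF assms], of "p a" "p b" "p c"] lin_symD(2)[OF assms] by auto

lemma lin_sym_equationsD:
  assumes "inverse_pair C U V"
    "\<And>a b c. fus C (p a) (p b) (p c) = fus C a b c"
  shows "preserves_R C \<lparr>anti = s, sperm = p, smat = U\<rparr> \<longleftrightarrow>
     (\<forall>a b c. U (p b) (p a) (p c) * Rsym C (p a) (p b) (p c) * V (p a) (p b) (p c) =
       map_mat (Kc \<lparr>anti = s, sperm = p, smat = U\<rparr>) (Rsym C a b c))"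
    "preserves_F C \<lparr>anti = s, sperm = p, smat = U\<rparr> \<longleftrightarrow>
     (\<forall>a b c d e f. tensor_eq (fus C a b e) (fus C e c d) (fus C b c f) (fus C a f d)
        (tact (U (p a) (p b) (p e)) (U (p e) (p c) (p d)) (V (p b) (p c) (p f)) (V (p a) (p f) (p d))
          (Ften C (p a) (p b) (p c) (p d) (p e) (p f)))
        (\<lambda>\<alpha> \<beta> \<mu> \<nu>. Kc \<lparr>anti = s, sperm = p, smat = U\<rparr> (Ften C a b c d e f \<alpha> \<beta> \<mu> \<nu>)))"
proof -
  note inv = inverse_pair_mat_inv[OF assms(1)] and c = inverse_pairD(1,2)[OF assms(1)]
  show "preserves_R C \<lparr>anti = s, sperm = p, smat = U\<rparr> \<longleftrightarrow>
     (\<forall>a b c. U (p b) (p a) (p c) * Rsym C (p a) (p b) (p c) * V (p a) (p b) (p c) =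
       map_mat (Kc \<lparr>anti = s, sperm = p, smat = U\<rparr>) (Rsym C a b c))"
    by (simp add: preserves_R_def inv)
  have dims: "dim_col (U (p a) (p b) (p c)) = fus C (p a) (p b) (p c)" "dim_row (V (p a) (p b) (p c)) = fus C (p a) (p b) (p c)" for a b c
    using carrier_matD(2)[OF c(1)] carrier_matD(1)[OF c(2)] by auto
  show "preserves_F C \<lparr>anti = s, sperm = p, smat = U\<rparr> \<longleftrightarrow>
     (\<forall>a b c d e f. tensor_eq (fus C a b e) (fus C e c d) (fus C b c f) (fus C a f d)
        (tact (U (p a) (p b) (p e)) (U (p e) (p c) (p d)) (V (p b) (p c) (p f)) (V (p a) (p f) (p d))
          (Ften C (p a) (p b) (p c) (p d) (p e) (p f)))
        (\<lambda>\<alpha> \<beta> \<mu> \<nu>. Kc \<lparr>anti = s, sperm = p, smat = U\<rparr> (Ften C a b c d e f \<alpha> \<beta> \<mu> \<nu>)))"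
    unfolding preserves_F_def Let_def tensor_eq_def tact_def dims Ften_def inv left_idx_def right_idx_def sym.simps
    by (simp add: inv) blast
qed

text \<open>Makes symmetries the unitary case of \<open>lin_sym\<close>, so that composition,
  rescaling and transport along embeddings can be proved without unitarity and specialized
  afterwards.\<close>

lemma syms_iff_lin_sym:
  "g \<in> syms C \<longleftrightarrow> (\<forall>a b c. unitary_mat (fus C a b c) (smat g a b c)) \<and>
     lin_sym C (sperm g) (Kc g) (smat g) (\<lambda>a b c. mat_adjoint (smat g a b c))"
proof (cases "(\<forall>a b c. unitary_mat (fus C a b c) (smat g a b c)) \<and> (\<forall>a b c. fus C (sperm g a) (sperm g b) (sperm g c) = fus C a b c)")
  case True
  then have pair: "inverse_pair C (smat g) (\<lambda>a b c. mat_adjoint (smat g a b c))"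
    unfolding inverse_pair_def by (intro allI conjI mat_adjoint_carrier unitary_matD(1,3)) auto
  have g: "\<lparr>anti = anti g, sperm = sperm g, smat = smat g\<rparr> = g" by simp
  show ?thesis
    using lin_sym_equationsD[OF pair, of "sperm g" "anti g"] True pair unfolding g lin_sym_def syms_def by auto
next
  case False
  then show ?thesis by (auto simp: syms_def lin_sym_def)
qed

text \<open>The equations for \<open>p\<close> leave \<open>k\<close> of the symbols at the anyons
  permuted by \<open>p'\<close>. As a field homomorphism, \<open>k\<close> can be pulled out of the
  sums, after which the equations for \<open>p'\<close> apply. The inverse of \<open>p\<close> in
  the arguments of \<open>U'\<close> undoes the outer relabelling.\<close>

lemma lin_sym_comp:
  assumes 1: "lin_sym C p k U V" and 2: "lin_sym C p' k' U' V'" and k: "complex_embedding UNIV k" and R: "R_dims C"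
  shows "lin_sym C (p \<circ> p') (k \<circ> k')
    (\<lambda>a b c. map_mat k (U' (inv_into UNIV p a) (inv_into UNIV p b) (inv_into UNIV p c)) * U a b c)
    (\<lambda>a b c. V a b c * map_mat k (V' (inv_into UNIV p a) (inv_into UNIV p b) (inv_into UNIV p c)))"
proof -
  interpret k: complex_embedding UNIV k by fact
  note c = inverse_pairD[OF lin_symD(3)[OF 1]] and c' = inverse_pairD[OF lin_symD(3)[OF 2]]
  note pc = lin_sym_carriers[OF 1] and pc' = lin_sym_carriers[OF 2]
  note kmult = k.map_mat_mult[OF _ _ subset_UNIV subset_UNIV]
  have p: "inv_into UNIV p (p a) = a" for a using lin_symD(1)[OF 1] by (simp add: bij_is_inj)
  have p': "p (inv_into UNIV p a) = a" for a using lin_symD(1)[OF 1] by (simp add: bij_is_surj surj_f_inv_f)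
  have fus_inv: "fus C (inv_into UNIV p a) (inv_into UNIV p b) (inv_into UNIV p c) = fus C a b c" for a b c
    using lin_symD(2)[OF 1, of "inv_into UNIV p a" "inv_into UNIV p b" "inv_into UNIV p c"] by (simp add: p')
  have ck: "map_mat k (U' a b c) \<in> carrier_mat (fus C a b c) (fus C a b c)"
    "map_mat k (V' a b c) \<in> carrier_mat (fus C a b c) (fus C a b c)" for a b c
    using c' by auto
  have pair: "inverse_pair C (\<lambda>a b c. map_mat k (U' (inv_into UNIV p a) (inv_into UNIV p b) (inv_into UNIV p c)) * U a b c)
    (\<lambda>a b c. V a b c * map_mat k (V' (inv_into UNIV p a) (inv_into UNIV p b) (inv_into UNIV p c)))"
    unfolding inverse_pair_def
  proof (intro allI conjI)
    fix a b c'
    let ?n = "fus C a b c'"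
    let ?U = "map_mat k (U' (inv_into UNIV p a) (inv_into UNIV p b) (inv_into UNIV p c'))" and ?V = "map_mat k (V' (inv_into UNIV p a) (inv_into UNIV p b) (inv_into UNIV p c'))"
    have m: "?U \<in> carrier_mat ?n ?n" "?V \<in> carrier_mat ?n ?n" using ck[of "inv_into UNIV p a" "inv_into UNIV p b" "inv_into UNIV p c'"] by (auto simp: fus_inv)
    show "?U * U a b c' \<in> carrier_mat ?n ?n" "V a b c' * ?V \<in> carrier_mat ?n ?n"
      using m c[of a b c'] by auto
    have "(?U * U a b c') * (V a b c' * ?V) = ?U * ((U a b c' * V a b c') * ?V)"
      using m c(1,2)[of a b c'] by (simp add: assoc_mult_mat[of _ ?n ?n _ ?n _ ?n] mult_carrier_mat[of _ ?n ?n _ ?n])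
    also have "\<dots> = ?U * ?V" using m c(3)[of a b c'] by (simp add: left_mult_one_mat[of _ ?n ?n])
    also have "\<dots> = map_mat k (U' (inv_into UNIV p a) (inv_into UNIV p b) (inv_into UNIV p c') * V' (inv_into UNIV p a) (inv_into UNIV p b) (inv_into UNIV p c'))"
      by (rule kmult[symmetric]) (rule c')+
    also have "\<dots> = 1\<^sub>m ?n" using c'(3) by (simp add: fus_inv k.map_mat_one)
    finally show "(?U * U a b c') * (V a b c' * ?V) = 1\<^sub>m ?n" .
  qed
  show ?thesis
    unfolding lin_sym_def
  proof (intro conjI allI)
    show "bij (p \<circ> p')" using lin_symD(1)[OF 1] lin_symD(1)[OF 2] by (rule bij_comp[rotated])
    show "fus C ((p \<circ> p') a) ((p \<circ> p') b) ((p \<circ> p') c) = fus C a b c" for a b c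
      using lin_symD(2)[OF 1] lin_symD(2)[OF 2] by simp
    show "inverse_pair C (\<lambda>a b c. map_mat k (U' (inv_into UNIV p a) (inv_into UNIV p b) (inv_into UNIV p c)) * U a b c)
      (\<lambda>a b c. V a b c * map_mat k (V' (inv_into UNIV p a) (inv_into UNIV p b) (inv_into UNIV p c)))" by (rule pair)
  next
    fix a b c'
    let ?m = "fus C b a c'" and ?n = "fus C a b c'"
    let ?R = "Rsym C (p (p' a)) (p (p' b)) (p (p' c'))" and ?R' = "Rsym C (p' a) (p' b) (p' c')"
    have Rc: "?R \<in> carrier_mat ?m ?n" "?R' \<in> carrier_mat ?m ?n"
      using R lin_symD(2)[OF 1] lin_symD(2)[OF 2] by (metis R_dims_def)+
    have m: "map_mat k (U' (p' b) (p' a) (p' c')) \<in> carrier_mat ?m ?m" "map_mat k (V' (p' a) (p' b) (p' c')) \<in> carrier_mat ?n ?n"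
      using ck[of "p' b" "p' a" "p' c'"] ck[of "p' a" "p' b" "p' c'"] lin_symD(2)[OF 2] by auto
    have q: "U (p (p' b)) (p (p' a)) (p (p' c')) \<in> carrier_mat ?m ?m" "V (p (p' a)) (p (p' b)) (p (p' c')) \<in> carrier_mat ?n ?n"
      using pc(1)[of "p' b" "p' a" "p' c'"] pc(2)[of "p' a" "p' b" "p' c'"] lin_symD(2)[OF 2] by auto
    have "map_mat k (U' (p' b) (p' a) (p' c')) * U (p (p' b)) (p (p' a)) (p (p' c')) * ?R *
        (V (p (p' a)) (p (p' b)) (p (p' c')) * map_mat k (V' (p' a) (p' b) (p' c')))
      = map_mat k (U' (p' b) (p' a) (p' c')) * (U (p (p' b)) (p (p' a)) (p (p' c')) * ?R * V (p (p' a)) (p (p' b)) (p (p' c'))) *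
        map_mat k (V' (p' a) (p' b) (p' c'))"
      using Rc m q
      by (simp add: assoc_mult_mat[of _ ?m ?m _ ?m _ ?n] assoc_mult_mat[of _ ?m ?n _ ?n _ ?n] assoc_mult_mat[of _ ?m ?m _ ?n _ ?n]
          mult_carrier_mat[of _ ?m ?m _ ?n] mult_carrier_mat[of _ ?m ?m _ ?m] mult_carrier_mat[of _ ?m ?n _ ?n] mult_carrier_mat[of _ ?n ?n _ ?n])
    also have "\<dots> = map_mat k (U' (p' b) (p' a) (p' c')) * map_mat k ?R' * map_mat k (V' (p' a) (p' b) (p' c'))"
      by (simp only: lin_symD(4)[OF 1])
    also have "\<dots> = map_mat k (U' (p' b) (p' a) (p' c') * ?R' * V' (p' a) (p' b) (p' c'))"
      using pc'(1)[of b a c'] pc'(2)[of a b c'] Rc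
      by (simp add: kmult[of _ ?m ?m _ ?n] kmult[of _ ?m ?n _ ?n] mult_carrier_mat[of _ ?m ?m _ ?n] del: assoc_mult_mat)
    also have "\<dots> = map_mat (k \<circ> k') (Rsym C a b c')"
      by (simp only: lin_symD(4)[OF 2]) (auto intro!: eq_matI)
    finally show "map_mat k (U' (inv_into UNIV p ((p \<circ> p') b)) (inv_into UNIV p ((p \<circ> p') a)) (inv_into UNIV p ((p \<circ> p') c'))) * U ((p \<circ> p') b) ((p \<circ> p') a) ((p \<circ> p') c') *
       Rsym C ((p \<circ> p') a) ((p \<circ> p') b) ((p \<circ> p') c') *
       (V ((p \<circ> p') a) ((p \<circ> p') b) ((p \<circ> p') c') * map_mat k (V' (inv_into UNIV p ((p \<circ> p') a)) (inv_into UNIV p ((p \<circ> p') b)) (inv_into UNIV p ((p \<circ> p') c')))) =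
       map_mat (k \<circ> k') (Rsym C a b c')"
      by (simp add: p)
  next
    fix a b c' d e f
    let ?pa = "p' a" and ?pb = "p' b" and ?pc = "p' c'" and ?pd = "p' d" and ?pe = "p' e" and ?pf = "p' f"
    let ?n1 = "fus C a b e" and ?n2 = "fus C e c' d" and ?n3 = "fus C b c' f" and ?n4 = "fus C a f d"
    have fus2: "fus C (p' x) (p' y) (p' z) = fus C x y z" for x y z by (rule lin_symD(2)[OF 2])
    note pcc = pc(1,2)[of "p' x" "p' y" "p' z" for x y z, unfolded fus2]
    note ckk = ck[of "p' x" "p' y" "p' z" for x y z, unfolded fus2]
    let ?F = "Ften C (p ?pa) (p ?pb) (p ?pc) (p ?pd) (p ?pe) (p ?pf)"
    let ?k1 = "map_mat k (U' ?pa ?pb ?pe)" and ?k2 = "map_mat k (U' ?pe ?pc ?pd)"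
      and ?k3 = "map_mat k (V' ?pb ?pc ?pf)" and ?k4 = "map_mat k (V' ?pa ?pf ?pd)"
    let ?u1 = "U (p ?pa) (p ?pb) (p ?pe)" and ?u2 = "U (p ?pe) (p ?pc) (p ?pd)"
      and ?v3 = "V (p ?pb) (p ?pc) (p ?pf)" and ?v4 = "V (p ?pa) (p ?pf) (p ?pd)"
    have "tensor_eq ?n1 ?n2 ?n3 ?n4 (tact (?k1 * ?u1) (?k2 * ?u2) (?v3 * ?k3) (?v4 * ?k4) ?F) (tact ?k1 ?k2 ?k3 ?k4 (tact ?u1 ?u2 ?v3 ?v4 ?F))"
      by (rule tensor_eq_sym, rule tact_mult) (rule pcc ckk)+
    also have "tact ?k1 ?k2 ?k3 ?k4 (tact ?u1 ?u2 ?v3 ?v4 ?F) =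
        tact ?k1 ?k2 ?k3 ?k4 (\<lambda>\<alpha> \<beta> \<mu> \<nu>. k (Ften C ?pa ?pb ?pc ?pd ?pe ?pf \<alpha> \<beta> \<mu> \<nu>))"
      by (rule tact_cong[of _ ?n1 _ ?n2 _ ?n3 _ ?n4]) (use ckk lin_symD(5)[OF 1, of ?pa ?pb ?pe ?pc ?pd ?pf] in \<open>simp_all add: fus2\<close>)
    also have "tensor_eq ?n1 ?n2 ?n3 ?n4 \<dots>
      (\<lambda>\<alpha> \<beta> \<mu> \<nu>. k (tact (U' ?pa ?pb ?pe) (U' ?pe ?pc ?pd) (V' ?pb ?pc ?pf) (V' ?pa ?pf ?pd) (Ften C ?pa ?pb ?pc ?pd ?pe ?pf) \<alpha> \<beta> \<mu> \<nu>))"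
      by (rule k.tact_hom) (rule pc' subset_UNIV UNIV_I)+
    also have "tensor_eq ?n1 ?n2 ?n3 ?n4 \<dots> (\<lambda>\<alpha> \<beta> \<mu> \<nu>. k (k' (Ften C a b c' d e f \<alpha> \<beta> \<mu> \<nu>)))"
      using lin_symD(5)[OF 2, of a b e c' d f] by (simp add: tensor_eq_def)
    finally show "tensor_eq ?n1 ?n2 ?n3 ?n4
      (tact (map_mat k (U' (inv_into UNIV p ((p \<circ> p') a)) (inv_into UNIV p ((p \<circ> p') b)) (inv_into UNIV p ((p \<circ> p') e))) * U ((p \<circ> p') a) ((p \<circ> p') b) ((p \<circ> p') e))
        (map_mat k (U' (inv_into UNIV p ((p \<circ> p') e)) (inv_into UNIV p ((p \<circ> p') c')) (inv_into UNIV p ((p \<circ> p') d))) * U ((p \<circ> p') e) ((p \<circ> p') c') ((p \<circ> p') d))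
        (V ((p \<circ> p') b) ((p \<circ> p') c') ((p \<circ> p') f) * map_mat k (V' (inv_into UNIV p ((p \<circ> p') b)) (inv_into UNIV p ((p \<circ> p') c')) (inv_into UNIV p ((p \<circ> p') f))))
        (V ((p \<circ> p') a) ((p \<circ> p') f) ((p \<circ> p') d) * map_mat k (V' (inv_into UNIV p ((p \<circ> p') a)) (inv_into UNIV p ((p \<circ> p') f)) (inv_into UNIV p ((p \<circ> p') d))))
        (Ften C ((p \<circ> p') a) ((p \<circ> p') b) ((p \<circ> p') c') ((p \<circ> p') d) ((p \<circ> p') e) ((p \<circ> p') f)))
      (\<lambda>\<alpha> \<beta> \<mu> \<nu>. (k \<circ> k') (Ften C a b c' d e f \<alpha> \<beta> \<mu> \<nu>))"
      by (simp add: p)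
  qed
qed

lemma FR_entriesI:
  "i \<in> left_idx C a b c d \<Longrightarrow> j \<in> right_idx C a b c d \<Longrightarrow> Fsym C a b c d i j \<in> FR_entries C"
  "x \<in> elements_mat (Rsym C a b c) \<Longrightarrow> x \<in> FR_entries C"
proof -
  show "Fsym C a b c d i j \<in> FR_entries C" if "i \<in> left_idx C a b c d" "j \<in> right_idx C a b c d"
    unfolding FR_entries_def using that by (intro UnI1 CollectI exI conjI) (rule refl)
qed (auto simp: FR_entries_def)

text \<open>A relation rather than an equation, with F compared at admissible indices only: values
  elsewhere cannot be recovered from \<open>C'\<close>, and the relation has to persist when
  \<open>C\<close> and \<open>C'\<close> trade places.\<close>

definition conj_data :: "(complex \<Rightarrow> complex) \<Rightarrow> 'a mtc_data \<Rightarrow> 'a mtc_data \<Rightarrow> bool" where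
  "conj_data \<tau> C C' \<longleftrightarrow> fus C' = fus C \<and> unt C' = unt C \<and> piv C' = piv C \<and>
     (\<forall>a b c d. \<forall>i\<in>left_idx C a b c d. \<forall>j\<in>right_idx C a b c d. Fsym C' a b c d i j = \<tau> (Fsym C a b c d i j)) \<and>
     (\<forall>a b c. Rsym C' a b c = map_mat \<tau> (Rsym C a b c))"

lemma conj_data_Ften:
  assumes "conj_data \<tau> C C'"
  shows "tensor_eq (fus C a b e) (fus C e c d) (fus C b c f) (fus C a f d)
    (Ften C' a b c d e f) (\<lambda>\<alpha> \<beta> \<mu> \<nu>. \<tau> (Ften C a b c d e f \<alpha> \<beta> \<mu> \<nu>))"
  using assms by (auto simp: conj_data_def tensor_eq_def Ften_def left_idx_def right_idx_def)

lemma Ften_FR_entries: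
  "\<alpha> < fus C a b e \<Longrightarrow> \<beta> < fus C e c d \<Longrightarrow> \<mu> < fus C b c f \<Longrightarrow> \<nu> < fus C a f d \<Longrightarrow>
    Ften C a b c d e f \<alpha> \<beta> \<mu> \<nu> \<in> FR_entries C"
  by (auto simp: Ften_def left_idx_def right_idx_def intro!: FR_entriesI(1))

lemma conj_data_R_dims: "conj_data \<tau> C C' \<Longrightarrow> R_dims C \<Longrightarrow> R_dims C'"
  by (simp add: conj_data_def R_dims_def)

text \<open>The map \<tau> has to commute with \<open>k\<close> at the F and R symbols, but not at
  the entries of \<open>U\<close>. This admits transcendental solutions, where \<tau> and
  conjugation need not commute; the image is then a solution that may fail to be unitary.\<close>

lemma lin_sym_map:
  assumes sym: "lin_sym C p k U V" and emb: "complex_embedding E \<tau>"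
    and UV: "\<And>a b c. elements_mat (U a b c) \<subseteq> E" "\<And>a b c. elements_mat (V a b c) \<subseteq> E"
    and FR: "FR_entries C \<subseteq> E" "\<And>x. x \<in> FR_entries C \<Longrightarrow> \<tau> (k x) = k (\<tau> x)"
    and C': "conj_data \<tau> C C'" and R: "R_dims C"
  shows "lin_sym C' p k (\<lambda>a b c. map_mat \<tau> (U a b c)) (\<lambda>a b c. map_mat \<tau> (V a b c))"
  unfolding lin_sym_def
proof (intro conjI allI)
  interpret complex_embedding E \<tau> by fact
  note c = inverse_pairD[OF lin_symD(3)[OF sym]] and pc = lin_sym_carriers[OF sym] and fus = lin_symD(2)[OF sym]
  have [simp]: "fus C' = fus C" using C' by (simp add: conj_data_def)
  show "bij p" "fus C' (p a) (p b) (p c) = fus C' a b c" for a b c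
    using lin_symD(1,2)[OF sym] by auto
  show "inverse_pair C' (\<lambda>a b c. map_mat \<tau> (U a b c)) (\<lambda>a b c. map_mat \<tau> (V a b c))"
    using c map_mat_mult[OF c(1,2) UV] by (auto simp: inverse_pair_def map_mat_one)
  fix a b c' d e f
  let ?m = "fus C b a c'" and ?n = "fus C a b c'"
  have Rel: "elements_mat (Rsym C x y z) \<subseteq> E" for x y z
    by (rule subsetI) (rule subsetD[OF FR(1) FR_entriesI(2)])
  have Rc: "Rsym C (p a) (p b) (p c') \<in> carrier_mat ?m ?n" using R fus by (metis R_dims_def)
  have UR: "U (p b) (p a) (p c') * Rsym C (p a) (p b) (p c') \<in> carrier_mat ?m ?n"
    "elements_mat (U (p b) (p a) (p c') * Rsym C (p a) (p b) (p c')) \<subseteq> E"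
    using pc(1)[of b a c'] Rc elements_mat_mult[OF pc(1)[of b a c'] Rc UV(1) Rel] by auto
  have "map_mat \<tau> (U (p b) (p a) (p c')) * Rsym C' (p a) (p b) (p c') * map_mat \<tau> (V (p a) (p b) (p c')) =
    map_mat \<tau> (U (p b) (p a) (p c') * Rsym C (p a) (p b) (p c') * V (p a) (p b) (p c'))"
    using C' map_mat_mult[OF pc(1)[of b a c'] Rc UV(1) Rel] map_mat_mult[OF UR(1) pc(2)[of a b c'] UR(2) UV(2)]
    by (simp add: conj_data_def)
  also have "\<dots> = map_mat \<tau> (map_mat k (Rsym C a b c'))" by (simp only: lin_symD(4)[OF sym])
  also have "\<dots> = map_mat k (Rsym C' a b c')"
    using C' FR(2)[OF FR_entriesI(2)[OF elements_matI[of _ "Rsym C a b c'"]]] by (intro eq_matI) (auto simp: conj_data_def)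
  finally show "map_mat \<tau> (U (p b) (p a) (p c')) * Rsym C' (p a) (p b) (p c') * map_mat \<tau> (V (p a) (p b) (p c')) =
    map_mat k (Rsym C' a b c')" .
  let ?n1 = "fus C a b e" and ?n2 = "fus C e c' d" and ?n3 = "fus C b c' f" and ?n4 = "fus C a f d"
  let ?F = "Ften C (p a) (p b) (p c') (p d) (p e) (p f)"
  have m: "map_mat \<tau> (U (p a) (p b) (p e)) \<in> carrier_mat ?n1 ?n1" "map_mat \<tau> (U (p e) (p c') (p d)) \<in> carrier_mat ?n2 ?n2"
    "map_mat \<tau> (V (p b) (p c') (p f)) \<in> carrier_mat ?n3 ?n3" "map_mat \<tau> (V (p a) (p f) (p d)) \<in> carrier_mat ?n4 ?n4"
    using pc by auto
  have eq: "tact (map_mat \<tau> (U (p a) (p b) (p e))) (map_mat \<tau> (U (p e) (p c') (p d)))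
       (map_mat \<tau> (V (p b) (p c') (p f))) (map_mat \<tau> (V (p a) (p f) (p d))) (Ften C' (p a) (p b) (p c') (p d) (p e) (p f)) =
    tact (map_mat \<tau> (U (p a) (p b) (p e))) (map_mat \<tau> (U (p e) (p c') (p d)))
       (map_mat \<tau> (V (p b) (p c') (p f))) (map_mat \<tau> (V (p a) (p f) (p d))) (\<lambda>\<alpha> \<beta> \<mu> \<nu>. \<tau> (?F \<alpha> \<beta> \<mu> \<nu>))"
    using conj_data_Ften[OF C', of "p a" "p b" "p e" "p c'" "p d" "p f"] by (intro tact_cong[OF m]) (simp add: fus)
  have "tensor_eq ?n1 ?n2 ?n3 ?n4 (tact (map_mat \<tau> (U (p a) (p b) (p e))) (map_mat \<tau> (U (p e) (p c') (p d)))
       (map_mat \<tau> (V (p b) (p c') (p f))) (map_mat \<tau> (V (p a) (p f) (p d))) (\<lambda>\<alpha> \<beta> \<mu> \<nu>. \<tau> (?F \<alpha> \<beta> \<mu> \<nu>)))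
      (\<lambda>\<alpha> \<beta> \<mu> \<nu>. \<tau> (tact (U (p a) (p b) (p e)) (U (p e) (p c') (p d)) (V (p b) (p c') (p f)) (V (p a) (p f) (p d)) ?F \<alpha> \<beta> \<mu> \<nu>))"
    by (rule tact_hom) (use pc UV FR Ften_FR_entries[of _ C "p a" "p b" "p e" _ "p c'" "p d" _ "p f"] in \<open>auto simp: fus\<close>)
  also have "tensor_eq ?n1 ?n2 ?n3 ?n4 \<dots> (\<lambda>\<alpha> \<beta> \<mu> \<nu>. \<tau> (k (Ften C a b c' d e f \<alpha> \<beta> \<mu> \<nu>)))"
    using lin_symD(5)[OF sym, of a b e c' d f] by (simp add: tensor_eq_def)
  also have "tensor_eq ?n1 ?n2 ?n3 ?n4 \<dots> (\<lambda>\<alpha> \<beta> \<mu> \<nu>. k (Ften C' a b c' d e f \<alpha> \<beta> \<mu> \<nu>))"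
    using conj_data_Ften[OF C', of a b e c' d f] FR(2)[OF Ften_FR_entries] by (simp add: tensor_eq_def)
  finally show "tensor_eq (fus C' a b e) (fus C' e c' d) (fus C' b c' f) (fus C' a f d)
     (tact (map_mat \<tau> (U (p a) (p b) (p e))) (map_mat \<tau> (U (p e) (p c') (p d)))
       (map_mat \<tau> (V (p b) (p c') (p f))) (map_mat \<tau> (V (p a) (p f) (p d))) (Ften C' (p a) (p b) (p c') (p d) (p e) (p f)))
     (\<lambda>\<alpha> \<beta> \<mu> \<nu>. k (Ften C' a b c' d e f \<alpha> \<beta> \<mu> \<nu>))"
    by (simp add: eq)
qed

text \<open>Two solutions over the same permutation and the same \<open>k\<close> differ by a linear
  automorphism fixing all anyons, the maps \<open>k\<close> cancelling. Applied to \<open>U\<close>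
  and its inverse adjoint, the quotient is the Gram matrix of \<open>U\<close>.\<close>

lemma lin_sym_quotient:
  assumes 1: "lin_sym C p k U V" and 2: "lin_sym C p k W Z" and R: "R_dims C"
  shows "lin_sym C id id (\<lambda>a b c. Z a b c * U a b c) (\<lambda>a b c. V a b c * W a b c)"
  unfolding lin_sym_def
proof (intro conjI allI)
  note c = inverse_pairD[OF lin_symD(3)[OF 1]] and c' = inverse_pairD[OF lin_symD(3)[OF 2]]
  have surj: "\<exists>a'. a = p a'" for a using lin_symD(1)[OF 1] by (metis bij_pointE)
  show "bij id" by simp
  show "fus C (id a) (id b) (id c) = fus C a b c" for a b c by simp
  show "inverse_pair C (\<lambda>a b c. Z a b c * U a b c) (\<lambda>a b c. V a b c * W a b c)"
    unfolding inverse_pair_def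
  proof (intro allI conjI)
    fix a b d
    let ?n = "fus C a b d"
    show "Z a b d * U a b d \<in> carrier_mat ?n ?n" "V a b d * W a b d \<in> carrier_mat ?n ?n"
      using c[of a b d] c'[of a b d] by auto
    have "Z a b d * U a b d * (V a b d * W a b d) = Z a b d * ((U a b d * V a b d) * W a b d)"
      using c(1,2)[of a b d] c'(1,2)[of a b d] by (simp add: assoc_mult_mat[of _ ?n ?n _ ?n _ ?n] mult_carrier_mat[of _ ?n ?n _ ?n])
    then show "Z a b d * U a b d * (V a b d * W a b d) = 1\<^sub>m ?n"
      using c(3)[of a b d] c'[of a b d] by (simp add: left_mult_one_mat[of _ ?n ?n])
  qed
  fix a0 b0 c0 d0 e0 f0
  obtain a b c' d e f where abc: "a0 = p a" "b0 = p b" "c0 = p c'" "d0 = p d" "e0 = p e" "f0 = p f"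
    using surj by metis
  note fus = lin_symD(2)[OF 1]
  have "Z (p b) (p a) (p c') * U (p b) (p a) (p c') * Rsym C (p a) (p b) (p c') * (V (p a) (p b) (p c') * W (p a) (p b) (p c')) = Rsym C (p a) (p b) (p c')"
  proof -
    let ?m = "fus C b a c'" and ?n = "fus C a b c'"
    let ?R = "Rsym C (p a) (p b) (p c')"
    have Rc: "?R \<in> carrier_mat ?m ?n" using R fus by (metis R_dims_def)
    note pc = lin_sym_carriers[OF 1, of b a c'] lin_sym_carriers[OF 1, of a b c']
    note qc = lin_sym_carriers[OF 2, of b a c'] lin_sym_carriers[OF 2, of a b c']
    note assoc = assoc_mult_mat[of _ ?m ?m _ ?m _ ?n] assoc_mult_mat[of _ ?m ?n _ ?n _ ?n] assoc_mult_mat[of _ ?m ?m _ ?n _ ?n]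
          mult_carrier_mat[of _ ?m ?m _ ?n] mult_carrier_mat[of _ ?m ?m _ ?m] mult_carrier_mat[of _ ?m ?n _ ?n] mult_carrier_mat[of _ ?n ?n _ ?n]
    have "Z (p b) (p a) (p c') * U (p b) (p a) (p c') * ?R * (V (p a) (p b) (p c') * W (p a) (p b) (p c')) =
      Z (p b) (p a) (p c') * (U (p b) (p a) (p c') * ?R * V (p a) (p b) (p c')) * W (p a) (p b) (p c')"
      using Rc pc qc by (simp add: assoc)
    also have "\<dots> = Z (p b) (p a) (p c') * (W (p b) (p a) (p c') * ?R * Z (p a) (p b) (p c')) * W (p a) (p b) (p c')"
      by (simp only: lin_symD(4)[OF 1] lin_symD(4)[OF 2])
    also have "\<dots> = (Z (p b) (p a) (p c') * W (p b) (p a) (p c')) * ?R * (Z (p a) (p b) (p c') * W (p a) (p b) (p c'))"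
      using Rc qc(1,2,5,6) by (simp add: assoc)
    also have "\<dots> = ?R" using Rc qc(4,8) by (simp add: left_mult_one_mat[of _ ?m ?n] right_mult_one_mat[of _ ?m ?n])
    finally show ?thesis .
  qed
  then show "Z (id b0) (id a0) (id c0) * U (id b0) (id a0) (id c0) * Rsym C (id a0) (id b0) (id c0) *
      (V (id a0) (id b0) (id c0) * W (id a0) (id b0) (id c0)) = map_mat id (Rsym C a0 b0 c0)"
    by (simp add: abc) (rule eq_matI; simp)
  let ?n1 = "fus C a b e" and ?n2 = "fus C e c' d" and ?n3 = "fus C b c' f" and ?n4 = "fus C a f d"
  let ?F = "Ften C (p a) (p b) (p c') (p d) (p e) (p f)"
  note pc = lin_sym_carriers[OF 1] and qc = lin_sym_carriers[OF 2]
  have "tensor_eq ?n1 ?n2 ?n3 ?n4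
    (tact (Z (p a) (p b) (p e) * U (p a) (p b) (p e)) (Z (p e) (p c') (p d) * U (p e) (p c') (p d))
      (V (p b) (p c') (p f) * W (p b) (p c') (p f)) (V (p a) (p f) (p d) * W (p a) (p f) (p d)) ?F)
    (tact (Z (p a) (p b) (p e)) (Z (p e) (p c') (p d)) (W (p b) (p c') (p f)) (W (p a) (p f) (p d))
      (tact (U (p a) (p b) (p e)) (U (p e) (p c') (p d)) (V (p b) (p c') (p f)) (V (p a) (p f) (p d)) ?F))"
    by (rule tensor_eq_sym, rule tact_mult) (rule pc qc)+
  also have "tact (Z (p a) (p b) (p e)) (Z (p e) (p c') (p d)) (W (p b) (p c') (p f)) (W (p a) (p f) (p d))
      (tact (U (p a) (p b) (p e)) (U (p e) (p c') (p d)) (V (p b) (p c') (p f)) (V (p a) (p f) (p d)) ?F) =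
    tact (Z (p a) (p b) (p e)) (Z (p e) (p c') (p d)) (W (p b) (p c') (p f)) (W (p a) (p f) (p d))
      (tact (W (p a) (p b) (p e)) (W (p e) (p c') (p d)) (Z (p b) (p c') (p f)) (Z (p a) (p f) (p d)) ?F)"
    by (rule tact_cong[OF qc(2,2) qc(1,1)])
      (use lin_symD(5)[OF 1, of a b e c' d f] lin_symD(5)[OF 2, of a b e c' d f] in \<open>simp add: tensor_eq_def\<close>)
  also have "tensor_eq ?n1 ?n2 ?n3 ?n4 \<dots> ?F"
    using tensor_eq_trans[OF tact_mult[OF qc(2,1,2,1,1,2,1,2)] ] tact_one by (simp only: qc(4))
  finally show "tensor_eq (fus C a0 b0 e0) (fus C e0 c0 d0) (fus C b0 c0 f0) (fus C a0 f0 d0)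
     (tact (Z (id a0) (id b0) (id e0) * U (id a0) (id b0) (id e0)) (Z (id e0) (id c0) (id d0) * U (id e0) (id c0) (id d0))
      (V (id b0) (id c0) (id f0) * W (id b0) (id c0) (id f0)) (V (id a0) (id f0) (id d0) * W (id a0) (id f0) (id d0))
      (Ften C (id a0) (id b0) (id c0) (id d0) (id e0) (id f0)))
     (\<lambda>\<alpha> \<beta> \<mu> \<nu>. id (Ften C a0 b0 c0 d0 e0 f0 \<alpha> \<beta> \<mu> \<nu>))"
    by (simp add: abc fus)
qed

text \<open>Over the trivial permutation each symmetry equation is the invariance of a tensor under
  spectral powers, and such an invariance extends from exponent 1 to all complex exponents.\<close>

lemma lin_sym_spec_power:
  assumes sym: "lin_sym C id id Q Q'" and R: "R_dims C"
    and T: "\<And>a b c. unitary_mat (fus C a b c) (T a b c)"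
    and Q: "\<And>a b c. Q a b c = spec_power (fus C a b c) (T a b c) (l a b c) 1"
  shows "lin_sym C id id (\<lambda>a b c. spec_power (fus C a b c) (T a b c) (l a b c) z)
    (\<lambda>a b c. spec_power (fus C a b c) (T a b c) (l a b c) (- z))"
  unfolding lin_sym_def
proof (intro conjI allI)
  note c = inverse_pairD[OF lin_symD(3)[OF sym]]
  have Q': "Q' a b c = spec_power (fus C a b c) (T a b c) (l a b c) (- 1)" for a b c
    using spec_power_unique_inverse[OF T] c(2,3)[of a b c] by (simp add: Q)
  show "bij id" by simp
  show "fus C (id a) (id b) (id c) = fus C a b c" for a b c by simp
  show "inverse_pair C (\<lambda>a b c. spec_power (fus C a b c) (T a b c) (l a b c) z)
    (\<lambda>a b c. spec_power (fus C a b c) (T a b c) (l a b c) (- z))"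
    using T by (auto simp: inverse_pair_def spec_power_carrier spec_power_mult spec_power_zero)
  fix a b c' d e f
  let ?m = "fus C b a c'" and ?n = "fus C a b c'"
  let ?Y = "\<lambda>\<alpha> _ \<mu> _. Rsym C a b c' $$ (\<alpha>, \<mu>)"
  have Rc: "Rsym C a b c' \<in> carrier_mat ?m ?n" using R by (simp add: R_dims_def)
  note iff = matrix_eq_iff_tensor[OF spec_power_carrier[OF T] spec_power_carrier[OF T] Rc Rc]
  \<comment> \<open>The two auxiliary legs of the R tensor carry weight zero, hence are unaffected
    by the exponent.\<close>
  have one: "spec_power 1 (1\<^sub>m 1) (\<lambda>_. 0) w = 1\<^sub>m 1" for w
    by (simp add: spec_power_def)
  have "map_mat id (Rsym C a b c') = Rsym C a b c'" by (rule eq_matI) auto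
  then have "Q b a c' * Rsym C a b c' * Q' a b c' = Rsym C a b c'"
    using lin_symD(4)[OF sym, of b a c'] by simp
  then have "tensor_eq ?m 1 ?n 1 (tact (spec_power ?m (T b a c') (l b a c') 1) (spec_power 1 (1\<^sub>m 1) (\<lambda>_. 0) 1)
      (spec_power ?n (T a b c') (l a b c') (- 1)) (spec_power 1 (1\<^sub>m 1) (\<lambda>_. 0) (- 1)) ?Y) ?Y"
    unfolding Q Q' iff one .
  then have "tensor_eq ?m 1 ?n 1 (tact (spec_power ?m (T b a c') (l b a c') z) (spec_power 1 (1\<^sub>m 1) (\<lambda>_. 0) z)
      (spec_power ?n (T a b c') (l a b c') (- z)) (spec_power 1 (1\<^sub>m 1) (\<lambda>_. 0) (- z)) ?Y) ?Y"
    by (rule tact_spec_power[OF T unitary_mat_one T unitary_mat_one])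
  then show "spec_power (fus C (id b) (id a) (id c')) (T (id b) (id a) (id c')) (l (id b) (id a) (id c')) z * Rsym C (id a) (id b) (id c') *
      spec_power (fus C (id a) (id b) (id c')) (T (id a) (id b) (id c')) (l (id a) (id b) (id c')) (- z) =
      map_mat id (Rsym C a b c')"
    using \<open>map_mat id (Rsym C a b c') = Rsym C a b c'\<close> unfolding one id_apply by (simp only: iff)
  show "tensor_eq (fus C a b e) (fus C e c' d) (fus C b c' f) (fus C a f d)
     (tact (spec_power (fus C (id a) (id b) (id e)) (T (id a) (id b) (id e)) (l (id a) (id b) (id e)) z)
       (spec_power (fus C (id e) (id c') (id d)) (T (id e) (id c') (id d)) (l (id e) (id c') (id d)) z)
       (spec_power (fus C (id b) (id c') (id f)) (T (id b) (id c') (id f)) (l (id b) (id c') (id f)) (- z))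
       (spec_power (fus C (id a) (id f) (id d)) (T (id a) (id f) (id d)) (l (id a) (id f) (id d)) (- z))
       (Ften C (id a) (id b) (id c') (id d) (id e) (id f)))
     (\<lambda>\<alpha> \<beta> \<mu> \<nu>. id (Ften C a b c' d e f \<alpha> \<beta> \<mu> \<nu>))"
    unfolding id_apply
    by (rule tact_spec_power[OF T T T T]) (use lin_symD(5)[OF sym, of a b e c' d f] in \<open>simp add: Q Q'\<close>)
qed

section \<open>The 0-form symmetry group\<close>

lemma Kc_sym_id [simp]: "Kc (sym_id C) = id"
  by (auto simp: Kc_def sym_id_def)

lemma Kc_sym_comp [simp]: "Kc (sym_comp g h) = Kc g \<circ> Kc h"
  by (auto simp: Kc_def sym_comp_def)

lemma Kc_cong: "anti g = anti h \<Longrightarrow> Kc g = Kc h"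
  by (auto simp: Kc_def)

lemma Kc_cnj [simp]: "Kc g (cnj x) = cnj (Kc g x)"
  by (simp add: Kc_def)

lemma cmod_Kc [simp]: "cmod (Kc g x) = cmod x"
  by (simp add: Kc_def)

lemma map_mat_Kc_adjoint: "map_mat (Kc g) (mat_adjoint A) = mat_adjoint (map_mat (Kc g) A)"
  by (rule map_mat_adjoint) simp

lemma unitary_map_mat_Kc:
  assumes "unitary_mat n A" shows "unitary_mat n (map_mat (Kc g) A)"
proof (rule unitary_matI)
  note A = unitary_matD[OF assms]
  interpret complex_embedding UNIV "Kc g" by (rule complex_embedding_Kc)
  show "map_mat (Kc g) A \<in> carrier_mat n n" using A by simp
  show "mat_adjoint (map_mat (Kc g) A) * map_mat (Kc g) A = 1\<^sub>m n"
    using A map_mat_Kc_mult[of "mat_adjoint A" n n A n g] by (simp add: map_mat_Kc_adjoint map_mat_one)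
qed

lemma symsD:
  assumes "g \<in> syms C"
  shows "unitary_mat (fus C a b c) (smat g a b c)" "bij (sperm g)"
    "fus C (sperm g a) (sperm g b) (sperm g c) = fus C a b c"
    "lin_sym C (sperm g) (Kc g) (smat g) (\<lambda>a b c. mat_adjoint (smat g a b c))"
    "smat g a b c \<in> carrier_mat (fus C a b c) (fus C a b c)"
  using assms unitary_matD(1) unfolding syms_iff_lin_sym by (auto dest: lin_symD)

lemma sperm_inverse:
  assumes "g \<in> syms C"
  shows "inv_into UNIV (sperm g) (sperm g a) = a" "sperm g (inv_into UNIV (sperm g) a) = a"
  using symsD(2)[OF assms] by (simp_all add: bij_is_inj bij_is_surj surj_f_inv_f)

lemma fus_sperm_inverse:
  assumes "g \<in> syms C"
  shows "fus C (inv_into UNIV (sperm g) a) (inv_into UNIV (sperm g) b) (inv_into UNIV (sperm g) c) = fus C a b c"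
  using symsD(3)[OF assms, of "inv_into UNIV (sperm g) a" "inv_into UNIV (sperm g) b" "inv_into UNIV (sperm g) c"]
  by (simp add: sperm_inverse[OF assms])

lemma inv_into_comp:
  assumes "bij p" "bij q" shows "inv_into UNIV (p \<circ> q) a = inv_into UNIV q (inv_into UNIV p a)"
  using o_inv_distrib[OF assms] by simp

lemma sym_id_in_syms:
  assumes "R_dims C" shows "sym_id C \<in> syms C"
proof -
  have "lin_sym C id id (\<lambda>a b c. 1\<^sub>m (fus C a b c)) (\<lambda>a b c. 1\<^sub>m (fus C a b c))"
    unfolding lin_sym_def
  proof (intro conjI allI)
    fix a b c
    have "Rsym C a b c \<in> carrier_mat (fus C b a c) (fus C a b c)" using assms by (simp add: R_dims_def)
    then show "1\<^sub>m (fus C (id b) (id a) (id c)) * Rsym C (id a) (id b) (id c) * 1\<^sub>m (fus C (id a) (id b) (id c)) =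
      map_mat id (Rsym C a b c)"
      by (intro eq_matI) (auto simp: left_mult_one_mat[of _ "fus C b a c" "fus C a b c"] right_mult_one_mat[of _ "fus C b a c" "fus C a b c"])
  qed (use tact_one in \<open>auto simp: inverse_pair_def\<close>)
  then show ?thesis
    by (subst syms_iff_lin_sym, unfold Kc_sym_id) (simp add: sym_id_def unitary_mat_one)
qed

lemma sym_comp_in_syms:
  assumes "g \<in> syms C" "h \<in> syms C" "R_dims C" shows "sym_comp g h \<in> syms C"
proof -
  let ?p = "inv_into UNIV (sperm g)"
  have u: "unitary_mat (fus C a b c) (map_mat (Kc g) (smat h (?p a) (?p b) (?p c)))" for a b c
    using unitary_map_mat_Kc[OF symsD(1)[OF assms(2), of "?p a" "?p b" "?p c"], of g] fus_sperm_inverse[OF assms(1)] by simp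
  have adj: "mat_adjoint (smat (sym_comp g h) a b c) =
    mat_adjoint (smat g a b c) * map_mat (Kc g) (mat_adjoint (smat h (?p a) (?p b) (?p c)))" for a b c
    using mat_adjoint_mult[OF unitary_matD(1)[OF u] unitary_matD(1)[OF symsD(1)[OF assms(1)]], of a b c]
    by (simp add: sym_comp_def map_mat_Kc_adjoint)
  have "lin_sym C (sperm g \<circ> sperm h) (Kc g \<circ> Kc h) (smat (sym_comp g h)) (\<lambda>a b c. mat_adjoint (smat (sym_comp g h) a b c))"
    unfolding adj using lin_sym_comp[OF symsD(4)[OF assms(1)] symsD(4)[OF assms(2)] complex_embedding_Kc assms(3)]
    by (simp add: sym_comp_def)
  then show ?thesis
    unfolding syms_iff_lin_sym Kc_sym_comp using unitary_mat_mult[OF u symsD(1)[OF assms(1)]]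
    by (simp add: sym_comp_def)
qed

text \<open>The factor on the fusion space of a, b, c caused by rescaling the anyons. \<gamma> is
  not confined to phases, since positive rescalings occur when unitarity is restored.\<close>

definition gauge :: "('a \<Rightarrow> complex) \<Rightarrow> 'a \<Rightarrow> 'a \<Rightarrow> 'a \<Rightarrow> complex" where
  "gauge \<gamma> a b c = \<gamma> a * \<gamma> b / \<gamma> c"

lemma gauge_simps:
  "gauge (\<lambda>a. \<gamma> a * \<delta> a) a b c = gauge \<gamma> a b c * gauge \<delta> a b c"
  "gauge (\<lambda>a. \<gamma> a / \<delta> a) a b c = gauge \<gamma> a b c / gauge \<delta> a b c"
  "gauge (\<lambda>a. inverse (\<gamma> a)) a b c = inverse (gauge \<gamma> a b c)"
  "gauge (\<lambda>a. 1) a b c = 1"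
  by (simp_all add: gauge_def field_simps)

lemma gauge_phase: "(\<And>a. cmod (\<gamma> a) = 1) \<Longrightarrow> cmod (gauge \<gamma> a b c) = 1"
  by (simp add: gauge_def norm_mult norm_divide)

lemma gauge_Kc: "gauge (\<lambda>a. Kc g (\<gamma> a)) a b c = Kc g (gauge \<gamma> a b c)"
  by (simp add: gauge_def Kc_def)

lemma nat_iso_iff:
  "(g, h) \<in> nat_iso C \<longleftrightarrow> g \<in> syms C \<and> h \<in> syms C \<and> anti g = anti h \<and> sperm g = sperm h \<and>
     (\<exists>\<gamma>. (\<forall>a. cmod (\<gamma> a) = 1) \<and> (\<forall>a b c. smat h a b c = gauge \<gamma> a b c \<cdot>\<^sub>m smat g a b c))"
  by (simp add: nat_iso_def gauge_def)

lemma smult_one_mat: "(1 :: complex) \<cdot>\<^sub>m A = A"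
  by (rule eq_matI) auto

lemma smult_smult_mat: "(x :: complex) \<cdot>\<^sub>m (y \<cdot>\<^sub>m A) = (x * y) \<cdot>\<^sub>m A"
  by (rule eq_matI) auto

lemma equiv_nat_iso: "equiv (syms C) (nat_iso C)"
proof (rule equivI)
  show "nat_iso C \<subseteq> syms C \<times> syms C" by (auto simp: nat_iso_iff)
  show "refl_on (syms C) (nat_iso C)"
    by (rule refl_onI) (auto simp: nat_iso_iff gauge_simps smult_one_mat intro!: exI[of _ "\<lambda>_. 1"])
  show "Relation.sym (nat_iso C)"
  proof (rule symI)
    fix g h assume "(g, h) \<in> nat_iso C"
    then obtain \<gamma> where \<gamma>: "\<forall>a. cmod (\<gamma> a) = 1" "\<forall>a b c. smat h a b c = gauge \<gamma> a b c \<cdot>\<^sub>m smat g a b c"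
      and gh: "g \<in> syms C" "h \<in> syms C" "anti g = anti h" "sperm g = sperm h"
      by (auto simp: nat_iso_iff)
    have "gauge \<gamma> a b c \<noteq> 0" for a b c using gauge_phase[of \<gamma> a b c] \<gamma>(1) by auto
    then have "smat g a b c = gauge (\<lambda>a. inverse (\<gamma> a)) a b c \<cdot>\<^sub>m smat h a b c" for a b c
      using \<gamma>(2) by (simp add: gauge_simps smult_smult_mat smult_one_mat)
    moreover have "\<forall>a. cmod (inverse (\<gamma> a)) = 1" using \<gamma>(1) by (simp add: norm_inverse)
    ultimately show "(h, g) \<in> nat_iso C" using gh unfolding nat_iso_iff by auto
  qed
  show "trans (nat_iso C)"
  proof (rule transI)
    fix g h k assume "(g, h) \<in> nat_iso C" "(h, k) \<in> nat_iso C"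
    then obtain \<gamma> \<delta> where "\<forall>a. cmod (\<gamma> a) = 1" "\<forall>a b c. smat h a b c = gauge \<gamma> a b c \<cdot>\<^sub>m smat g a b c"
      "\<forall>a. cmod (\<delta> a) = 1" "\<forall>a b c. smat k a b c = gauge \<delta> a b c \<cdot>\<^sub>m smat h a b c"
      and "g \<in> syms C" "k \<in> syms C" "anti g = anti k" "sperm g = sperm k"
      by (auto simp: nat_iso_iff)
    then show "(g, k) \<in> nat_iso C"
      unfolding nat_iso_iff
      by (intro conjI exI[of _ "\<lambda>a. \<delta> a * \<gamma> a"]) (auto simp: gauge_simps smult_smult_mat norm_mult)
  qed
qed

lemma map_mat_smult: "map_mat (Kc g) (x \<cdot>\<^sub>m A) = Kc g x \<cdot>\<^sub>m map_mat (Kc g) A"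
  by (rule eq_matI) (auto simp: Kc_def)

lemma sym_comp_nat_iso:
  assumes "(g, g') \<in> nat_iso C" "(h, h') \<in> nat_iso C" "R_dims C"
  shows "(sym_comp g h, sym_comp g' h') \<in> nat_iso C"
proof -
  obtain \<gamma> \<delta> where \<gamma>: "\<forall>a. cmod (\<gamma> a) = 1" "\<forall>a b c. smat g' a b c = gauge \<gamma> a b c \<cdot>\<^sub>m smat g a b c"
    and \<delta>: "\<forall>a. cmod (\<delta> a) = 1" "\<forall>a b c. smat h' a b c = gauge \<delta> a b c \<cdot>\<^sub>m smat h a b c"
    and s: "g \<in> syms C" "h \<in> syms C" "g' \<in> syms C" "h' \<in> syms C" "anti g = anti g'" "anti h = anti h'"
    "sperm g = sperm g'" "sperm h = sperm h'"
    using assms by (auto simp: nat_iso_iff)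
  let ?p = "inv_into UNIV (sperm g')"
  \<comment> \<open>Moving the rescaling of the inner symmetry past the outer one permutes its
    labels and applies \<open>K^g\<close>.\<close>
  let ?\<epsilon> = "\<lambda>a. Kc g' (\<delta> (?p a)) * \<gamma> a"
  have "smat (sym_comp g' h') a b c = gauge ?\<epsilon> a b c \<cdot>\<^sub>m smat (sym_comp g h) a b c" for a b c
  proof -
    have c: "map_mat (Kc g') (smat h (?p a) (?p b) (?p c)) \<in> carrier_mat (fus C a b c) (fus C a b c)"
      "smat g a b c \<in> carrier_mat (fus C a b c) (fus C a b c)"
      using symsD(5)[OF s(2)] symsD(5)[OF s(1)] fus_sperm_inverse[OF s(3)] by (metis map_carrier_mat)+
    have "smat (sym_comp g' h') a b c = map_mat (Kc g') (gauge \<delta> (?p a) (?p b) (?p c) \<cdot>\<^sub>m smat h (?p a) (?p b) (?p c)) *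
        (gauge \<gamma> a b c \<cdot>\<^sub>m smat g a b c)"
      using \<gamma>(2) \<delta>(2) by (simp add: sym_comp_def)
    also have "\<dots> = (Kc g' (gauge \<delta> (?p a) (?p b) (?p c)) * gauge \<gamma> a b c) \<cdot>\<^sub>m
        (map_mat (Kc g') (smat h (?p a) (?p b) (?p c)) * smat g a b c)"
      using c by (simp add: map_mat_smult smult_smult_mat mult_smult_distrib[of _ "fus C a b c" "fus C a b c"]
          mult_smult_assoc_mat[of _ "fus C a b c" "fus C a b c" _ "fus C a b c"] mult.commute)
    also have "map_mat (Kc g') (smat h (?p a) (?p b) (?p c)) * smat g a b c = smat (sym_comp g h) a b c"
      using s by (simp add: sym_comp_def Kc_cong[OF s(5)])
    also have "Kc g' (gauge \<delta> (?p a) (?p b) (?p c)) * gauge \<gamma> a b c = gauge ?\<epsilon> a b c"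
      by (simp add: gauge_simps gauge_Kc) (simp add: gauge_def Kc_def)
    finally show ?thesis .
  qed
  moreover have "\<forall>a. cmod (?\<epsilon> a) = 1" using \<gamma>(1) \<delta>(1) by (simp add: norm_mult)
  moreover have "anti (sym_comp g h) = anti (sym_comp g' h')" "sperm (sym_comp g h) = sperm (sym_comp g' h')"
    using s by (simp_all add: sym_comp_def)
  ultimately show ?thesis
    using sym_comp_in_syms[OF s(1,2) assms(3)] sym_comp_in_syms[OF s(3,4) assms(3)]
    unfolding nat_iso_iff by (intro conjI exI[of _ ?\<epsilon>]) simp_all
qed

lemma sym_comp_id:
  assumes "g \<in> syms C"
  shows "sym_comp (sym_id C) g = g" "sym_comp g (sym_id C) = g"
proof -
  interpret complex_embedding UNIV "Kc g" by (rule complex_embedding_Kc)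
  have c: "smat g a b c \<in> carrier_mat (fus C a b c) (fus C a b c)" for a b c by (rule symsD(5)[OF assms])
  have "map_mat id A = A" for A :: "complex mat" by (rule eq_matI) auto
  then show "sym_comp (sym_id C) g = g"
    unfolding sym_comp_def Kc_sym_id
    by (intro sym.equality ext) (auto simp: sym_id_def right_mult_one_mat[OF c])
  show "sym_comp g (sym_id C) = g"
    unfolding sym_comp_def
    by (intro sym.equality ext) (auto simp: sym_id_def map_mat_one fus_sperm_inverse[OF assms] left_mult_one_mat[OF c])
qed

lemma sym_comp_assoc:
  assumes "g \<in> syms C" "h \<in> syms C" "k \<in> syms C"
  shows "sym_comp (sym_comp g h) k = sym_comp g (sym_comp h k)"
proof (intro sym.equality ext)
  fix a b c
  let ?p = "inv_into UNIV (sperm g)" and ?q = "inv_into UNIV (sperm h)" and ?n = "fus C a b c"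
  have p: "inv_into UNIV (sperm g \<circ> sperm h) x = ?q (?p x)" for x
    using symsD(2)[OF assms(1)] symsD(2)[OF assms(2)] by (rule inv_into_comp)
  have m: "smat g a b c \<in> carrier_mat ?n ?n" "smat h (?p a) (?p b) (?p c) \<in> carrier_mat ?n ?n"
    "smat k (?q (?p a)) (?q (?p b)) (?q (?p c)) \<in> carrier_mat ?n ?n"
    using symsD(5)[OF assms(1)] symsD(5)[OF assms(2)] symsD(5)[OF assms(3)] fus_sperm_inverse[OF assms(1)]
      fus_sperm_inverse[OF assms(2)] by metis+
  have "map_mat (Kc g) (map_mat (Kc h) (smat k (?q (?p a)) (?q (?p b)) (?q (?p c))) * smat h (?p a) (?p b) (?p c)) =
    map_mat (Kc g \<circ> Kc h) (smat k (?q (?p a)) (?q (?p b)) (?q (?p c))) * map_mat (Kc g) (smat h (?p a) (?p b) (?p c))"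
  proof -
    have "map_mat (Kc g \<circ> Kc h) A = map_mat (Kc g) (map_mat (Kc h) A)" for A by (rule eq_matI) auto
    then show ?thesis using map_mat_Kc_mult[of _ ?n ?n _ ?n g] m by simp
  qed
  then show "smat (sym_comp (sym_comp g h) k) a b c = smat (sym_comp g (sym_comp h k)) a b c"
    using m unfolding sym_comp_def[of "sym_comp g h"] sym_comp_def[of g "sym_comp h k"] Kc_sym_comp
    by (simp add: sym_comp_def p assoc_mult_mat[of _ ?n ?n _ ?n _ ?n])
qed (auto simp: sym_comp_def)

section \<open>Classes of symmetries and their multiplication\<close>

abbreviation sym_class :: "'a mtc_data \<Rightarrow> 'a sym \<Rightarrow> 'a sym set" where
  "sym_class C g \<equiv> nat_iso C `` {g}"

lemma sym_class_in_carrier: "g \<in> syms C \<Longrightarrow> sym_class C g \<in> carrier (zero_form_group C)"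
  by (simp add: zero_form_group_def quotientI)

lemma carrier_zero_form_groupE:
  assumes "x \<in> carrier (zero_form_group C)"
  obtains g where "g \<in> syms C" "x = sym_class C g"
  using assms by (auto simp: zero_form_group_def elim: quotientE)

lemma zero_form_group_memD:
  assumes "x \<in> carrier (zero_form_group C)" "g \<in> x"
  shows "g \<in> syms C" "x = sym_class C g"
proof -
  obtain h where h: "h \<in> syms C" "x = sym_class C h" using assms(1) by (rule carrier_zero_form_groupE)
  then have "(h, g) \<in> nat_iso C" using assms(2) by auto
  then show "g \<in> syms C" "x = sym_class C g"
    using equiv_class_eq[OF equiv_nat_iso] h by (auto simp: nat_iso_iff)
qed

lemma sym_class_self: "g \<in> syms C \<Longrightarrow> g \<in> sym_class C g"
  by (rule equiv_class_self[OF equiv_nat_iso])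

lemma one_zero_form_group: "\<one>\<^bsub>zero_form_group C\<^esub> = sym_class C (sym_id C)"
  by (simp add: zero_form_group_def)

lemma mult_sym_class:
  assumes "g \<in> syms C" "h \<in> syms C" "R_dims C"
  shows "sym_class C g \<otimes>\<^bsub>zero_form_group C\<^esub> sym_class C h = sym_class C (sym_comp g h)"
proof -
  have "sym_class C (sym_comp g' h') = sym_class C (sym_comp g h)"
    if "(g, g') \<in> nat_iso C" "(h, h') \<in> nat_iso C" for g' h'
    using equiv_class_eq[OF equiv_nat_iso sym_comp_nat_iso[OF that assms(3)]] by simp
  then have "(\<Union>g'\<in>sym_class C g. \<Union>h'\<in>sym_class C h. sym_class C (sym_comp g' h')) =
    (\<Union>g'\<in>sym_class C g. \<Union>h'\<in>sym_class C h. sym_class C (sym_comp g h))"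
    by (intro SUP_cong refl) (auto simp only: Image_singleton_iff)
  also have "\<dots> = sym_class C (sym_comp g h)"
    using sym_class_self[OF assms(1)] sym_class_self[OF assms(2)] by (metis UN_constant empty_iff)
  finally show ?thesis by (simp add: zero_form_group_def)
qed

lemma zero_form_group_monoid:
  assumes "R_dims C" shows "monoid (zero_form_group C)"
proof (rule monoidI)
  show "\<one>\<^bsub>zero_form_group C\<^esub> \<in> carrier (zero_form_group C)"
    unfolding one_zero_form_group by (rule sym_class_in_carrier[OF sym_id_in_syms[OF assms]])
  fix x y assume x: "x \<in> carrier (zero_form_group C)" and y: "y \<in> carrier (zero_form_group C)"
  obtain g h where g: "g \<in> syms C" "x = sym_class C g" and h: "h \<in> syms C" "y = sym_class C h"
    using x y by (metis carrier_zero_form_groupE)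
  show "x \<otimes>\<^bsub>zero_form_group C\<^esub> y \<in> carrier (zero_form_group C)"
    unfolding g(2) h(2) mult_sym_class[OF g(1) h(1) assms]
    by (rule sym_class_in_carrier[OF sym_comp_in_syms[OF g(1) h(1) assms]])
  show "\<one>\<^bsub>zero_form_group C\<^esub> \<otimes>\<^bsub>zero_form_group C\<^esub> x = x" "x \<otimes>\<^bsub>zero_form_group C\<^esub> \<one>\<^bsub>zero_form_group C\<^esub> = x"
    unfolding g(2) one_zero_form_group using g assms
    by (simp_all add: mult_sym_class sym_id_in_syms sym_comp_id)
  fix z assume z: "z \<in> carrier (zero_form_group C)"
  obtain k where k: "k \<in> syms C" "z = sym_class C k" using z by (metis carrier_zero_form_groupE)
  show "x \<otimes>\<^bsub>zero_form_group C\<^esub> y \<otimes>\<^bsub>zero_form_group C\<^esub> z = x \<otimes>\<^bsub>zero_form_group C\<^esub> (y \<otimes>\<^bsub>zero_form_group C\<^esub> z)"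
    unfolding g(2) h(2) k(2) using g(1) h(1) k(1) assms
    by (simp add: mult_sym_class sym_comp_in_syms sym_comp_assoc)
qed

lemma smult_unitary_cmod:
  assumes "unitary_mat n A" "unitary_mat n (x \<cdot>\<^sub>m A)" "n \<noteq> 0" shows "cmod x = 1"
proof -
  note A = unitary_matD[OF assms(1)]
  have adj: "mat_adjoint (x \<cdot>\<^sub>m A) = cnj x \<cdot>\<^sub>m mat_adjoint A" by (rule eq_matI) auto
  have "1\<^sub>m n = mat_adjoint (x \<cdot>\<^sub>m A) * (x \<cdot>\<^sub>m A)" using unitary_matD(2)[OF assms(2)] by simp
  also have "\<dots> = (cnj x * x) \<cdot>\<^sub>m 1\<^sub>m n"
    using A by (simp add: adj mult_smult_distrib[of _ n n _ n] mult_smult_assoc_mat[of _ n n _ n] smult_smult_mat mult.commute)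
  finally have "(1\<^sub>m n :: complex mat) $$ (0, 0) = ((cnj x * x) \<cdot>\<^sub>m 1\<^sub>m n) $$ (0, 0)" by simp
  then have "of_real ((cmod x)\<^sup>2) = (1 :: complex)"
    using assms(3) complex_norm_square[of x] by (simp add: mult.commute)
  then have "(cmod x)\<^sup>2 = 1" by (metis of_real_1 of_real_eq_iff)
  then show ?thesis using norm_ge_zero[of x] by (simp add: power2_eq_1_iff)
qed

text \<open>In the F equation the factors of the two left vertices cancel against those of the two
  right ones; in the R equation the factor is symmetric in a and b. Nonvanishing of \<kappa> is
  enough, so positive rescalings are included.\<close>

lemma lin_sym_gauge:
  assumes sym: "lin_sym C p k U V" and \<kappa>: "\<And>a. \<kappa> a \<noteq> 0" and R: "R_dims C"
  shows "lin_sym C p k (\<lambda>a b c. gauge \<kappa> a b c \<cdot>\<^sub>m U a b c) (\<lambda>a b c. inverse (gauge \<kappa> a b c) \<cdot>\<^sub>m V a b c)"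
  unfolding lin_sym_def
proof (intro conjI allI)
  note c = inverse_pairD[OF lin_symD(3)[OF sym]] and pc = lin_sym_carriers[OF sym] and fus = lin_symD(2)[OF sym]
  have nz: "gauge \<kappa> a b c \<noteq> 0" for a b c using \<kappa> by (simp add: gauge_def)
  show "bij p" "fus C (p a) (p b) (p c) = fus C a b c" for a b c using lin_symD(1,2)[OF sym] by auto
  show "inverse_pair C (\<lambda>a b c. gauge \<kappa> a b c \<cdot>\<^sub>m U a b c) (\<lambda>a b c. inverse (gauge \<kappa> a b c) \<cdot>\<^sub>m V a b c)"
    unfolding inverse_pair_def
  proof (intro allI conjI)
    fix a b d
    show "gauge \<kappa> a b d \<cdot>\<^sub>m U a b d * (inverse (gauge \<kappa> a b d) \<cdot>\<^sub>m V a b d) = 1\<^sub>m (fus C a b d)"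
      using c(1-3)[of a b d] nz
      by (simp add: mult_smult_distrib[of _ "fus C a b d" "fus C a b d" _ "fus C a b d"]
          mult_smult_assoc_mat[of _ "fus C a b d" "fus C a b d" _ "fus C a b d"] smult_smult_mat smult_one_mat)
  qed (use c in auto)
  fix a b c' d e f
  let ?m = "fus C b a c'" and ?n = "fus C a b c'"
  have Rc: "Rsym C (p a) (p b) (p c') \<in> carrier_mat ?m ?n" using R fus by (metis R_dims_def)
  have g: "gauge \<kappa> (p b) (p a) (p c') = gauge \<kappa> (p a) (p b) (p c')" by (simp add: gauge_def)
  have "gauge \<kappa> (p b) (p a) (p c') \<cdot>\<^sub>m U (p b) (p a) (p c') * Rsym C (p a) (p b) (p c') *
      (inverse (gauge \<kappa> (p a) (p b) (p c')) \<cdot>\<^sub>m V (p a) (p b) (p c')) =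
    U (p b) (p a) (p c') * Rsym C (p a) (p b) (p c') * V (p a) (p b) (p c')"
    unfolding g using pc(1)[of b a c'] pc(2)[of a b c'] Rc nz
    by (simp add: mult_smult_distrib[of _ ?m ?n _ ?n] mult_smult_assoc_mat[of _ ?m ?n _ ?n] mult_smult_assoc_mat[of _ ?m ?m _ ?n]
        mult_carrier_mat[of _ ?m ?m _ ?n] smult_smult_mat smult_one_mat)
  then show "gauge \<kappa> (p b) (p a) (p c') \<cdot>\<^sub>m U (p b) (p a) (p c') * Rsym C (p a) (p b) (p c') *
      (inverse (gauge \<kappa> (p a) (p b) (p c')) \<cdot>\<^sub>m V (p a) (p b) (p c')) = map_mat k (Rsym C a b c')"
    by (simp only: lin_symD(4)[OF sym])
  have "tensor_eq (fus C a b e) (fus C e c' d) (fus C b c' f) (fus C a f d)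
    (tact (gauge \<kappa> (p a) (p b) (p e) \<cdot>\<^sub>m U (p a) (p b) (p e)) (gauge \<kappa> (p e) (p c') (p d) \<cdot>\<^sub>m U (p e) (p c') (p d))
       (inverse (gauge \<kappa> (p b) (p c') (p f)) \<cdot>\<^sub>m V (p b) (p c') (p f)) (inverse (gauge \<kappa> (p a) (p f) (p d)) \<cdot>\<^sub>m V (p a) (p f) (p d))
       (Ften C (p a) (p b) (p c') (p d) (p e) (p f)))
    (tact (U (p a) (p b) (p e)) (U (p e) (p c') (p d)) (V (p b) (p c') (p f)) (V (p a) (p f) (p d))
       (Ften C (p a) (p b) (p c') (p d) (p e) (p f)))"
    unfolding tensor_eq_def
  proof (intro allI impI)
    fix \<alpha> \<beta> \<mu> \<nu> assume i: "\<alpha> < fus C a b e" "\<beta> < fus C e c' d" "\<mu> < fus C b c' f" "\<nu> < fus C a f d"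
    have g: "gauge \<kappa> (p a) (p b) (p e) * gauge \<kappa> (p e) (p c') (p d) * inverse (gauge \<kappa> (p b) (p c') (p f)) *
      inverse (gauge \<kappa> (p a) (p f) (p d)) = 1"
      using \<kappa> by (simp add: gauge_def field_simps)
    have entry: "(x1 * u) * (x2 * v) * y * (x3 * w) * (x4 * z) = u * v * y * w * z"
      if "x1 * x2 * x3 * x4 = 1" for x1 x2 x3 x4 u v w y z :: complex
    proof -
      have "(x1 * u) * (x2 * v) * y * (x3 * w) * (x4 * z) = (x1 * x2 * x3 * x4) * (u * v * y * w * z)" by (simp only: mult_ac)
      then show ?thesis using that by simp
    qed
    show "tact (gauge \<kappa> (p a) (p b) (p e) \<cdot>\<^sub>m U (p a) (p b) (p e)) (gauge \<kappa> (p e) (p c') (p d) \<cdot>\<^sub>m U (p e) (p c') (p d))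
       (inverse (gauge \<kappa> (p b) (p c') (p f)) \<cdot>\<^sub>m V (p b) (p c') (p f)) (inverse (gauge \<kappa> (p a) (p f) (p d)) \<cdot>\<^sub>m V (p a) (p f) (p d))
       (Ften C (p a) (p b) (p c') (p d) (p e) (p f)) \<alpha> \<beta> \<mu> \<nu> =
      tact (U (p a) (p b) (p e)) (U (p e) (p c') (p d)) (V (p b) (p c') (p f)) (V (p a) (p f) (p d))
       (Ften C (p a) (p b) (p c') (p d) (p e) (p f)) \<alpha> \<beta> \<mu> \<nu>"
      unfolding tact_def index_smult_mat(2,3)
      by (intro sum.cong refl) (use i pc[of a b e] pc[of e c' d] pc[of b c' f] pc[of a f d] entry[OF g] in simp)
  qed
  then show "tensor_eq (fus C a b e) (fus C e c' d) (fus C b c' f) (fus C a f d)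
    (tact (gauge \<kappa> (p a) (p b) (p e) \<cdot>\<^sub>m U (p a) (p b) (p e)) (gauge \<kappa> (p e) (p c') (p d) \<cdot>\<^sub>m U (p e) (p c') (p d))
       (inverse (gauge \<kappa> (p b) (p c') (p f)) \<cdot>\<^sub>m V (p b) (p c') (p f)) (inverse (gauge \<kappa> (p a) (p f) (p d)) \<cdot>\<^sub>m V (p a) (p f) (p d))
       (Ften C (p a) (p b) (p c') (p d) (p e) (p f)))
     (\<lambda>\<alpha> \<beta> \<mu> \<nu>. k (Ften C a b c' d e f \<alpha> \<beta> \<mu> \<nu>))"
    using lin_symD(5)[OF sym] by (rule tensor_eq_trans)
qed

lemma lin_sym_unitary_in_syms:
  assumes "lin_sym C p (Kc g) (smat g) V" "p = sperm g" "\<And>a b c. unitary_mat (fus C a b c) (smat g a b c)"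
  shows "g \<in> syms C"
proof -
  have "V = (\<lambda>a b c. mat_adjoint (smat g a b c))"
    using inverse_pair_mat_inv[OF lin_symD(3)[OF assms(1)]] unitary_matD(4)[OF assms(3)] by (intro ext) metis
  then show ?thesis using assms by (simp add: syms_iff_lin_sym)
qed

lemma gauge_in_syms:
  assumes "g \<in> syms C" "\<And>a. cmod (\<gamma> a) = 1" "R_dims C"
  shows "g\<lparr>smat := \<lambda>a b c. gauge \<gamma> a b c \<cdot>\<^sub>m smat g a b c\<rparr> \<in> syms C" (is "?h \<in> _")
proof (rule lin_sym_unitary_in_syms)
  have "\<gamma> a \<noteq> 0" for a using assms(2)[of a] by auto
  then show "lin_sym C (sperm ?h) (Kc ?h) (smat ?h) (\<lambda>a b c. inverse (gauge \<gamma> a b c) \<cdot>\<^sub>m mat_adjoint (smat g a b c))"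
    using lin_sym_gauge[OF symsD(4)[OF assms(1)] _ assms(3), of \<gamma>] by (simp add: Kc_cong[of ?h g])
  fix a b c
  let ?n = "fus C a b c" and ?x = "gauge \<gamma> a b c" and ?A = "smat g a b c"
  note A = unitary_matD[OF symsD(1)[OF assms(1), of a b c]]
  have adj: "mat_adjoint (?x \<cdot>\<^sub>m ?A) = cnj ?x \<cdot>\<^sub>m mat_adjoint ?A" by (rule eq_matI) auto
  have "cnj ?x * ?x = 1"
    using gauge_phase[of \<gamma> a b c] assms(2) complex_norm_square[of ?x] by (simp add: mult.commute)
  then show "unitary_mat ?n (smat ?h a b c)"
    using A by (intro unitary_matI)
      (simp_all add: adj mult_smult_distrib[of _ ?n ?n _ ?n] mult_smult_assoc_mat[of _ ?n ?n _ ?n] smult_smult_mat mult.commute smult_one_mat)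
qed simp

section \<open>Conjugation of symmetries\<close>

definition CM_sym :: "'a sym \<Rightarrow> bool" where
  "CM_sym g \<longleftrightarrow> (\<forall>a b c. elements_mat (smat g a b c) \<subseteq> CM_numbers)"

definition conj_sym :: "(complex \<Rightarrow> complex) \<Rightarrow> 'a sym \<Rightarrow> 'a sym" where
  "conj_sym \<sigma> g = g\<lparr>smat := \<lambda>a b c. map_mat \<sigma> (smat g a b c)\<rparr>"

lemma conj_sym_simps [simp]:
  "anti (conj_sym \<sigma> g) = anti g" "sperm (conj_sym \<sigma> g) = sperm g"
  "smat (conj_sym \<sigma> g) = (\<lambda>a b c. map_mat \<sigma> (smat g a b c))" "Kc (conj_sym \<sigma> g) = Kc g"
  by (auto simp: conj_sym_def Kc_def)

lemma Kc_CM_numbers: "x \<in> CM_numbers \<Longrightarrow> Kc g x \<in> CM_numbers"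
  by (simp add: Kc_def cnj_CM_numbers)

lemma Kc_embedding:
  "complex_embedding algebraic_numbers \<sigma> \<Longrightarrow> x \<in> CM_numbers \<Longrightarrow> \<sigma> (Kc g x) = Kc g (\<sigma> x)"
  by (simp add: Kc_def embedding_cnj_CM)

text \<open>The squared modulus is x times its conjugate, and \<sigma> commutes with conjugation at
  x.\<close>

lemma cmod_embedding_CM:
  assumes "complex_embedding algebraic_numbers \<sigma>" "x \<in> CM_numbers" "cmod x = 1"
  shows "cmod (\<sigma> x) = 1"
proof -
  interpret complex_embedding algebraic_numbers \<sigma> by fact
  have mem: "x \<in> algebraic_numbers" "cnj x \<in> algebraic_numbers"
    using assms(2) cnj_CM_numbers CM_numbers_algebraic by blast+
  have "\<sigma> x * cnj (\<sigma> x) = \<sigma> (x * cnj x)"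
    using hom_mult[OF mem] embedding_cnj_CM[OF assms(1,2)] by simp
  also have "x * cnj x = 1" using complex_norm_square[of x] assms(3) by simp
  finally have "of_real ((cmod (\<sigma> x))\<^sup>2) = (1 :: complex)" using complex_norm_square[of "\<sigma> x"] hom_one by simp
  then have "(cmod (\<sigma> x))\<^sup>2 = 1" by (metis of_real_1 of_real_eq_iff)
  then show ?thesis using norm_ge_zero[of "\<sigma> x"] by (simp add: power2_eq_1_iff)
qed

text \<open>If a' is dual to a, then b occurs in the fusion of a' a with b, hence by associativity
  in that of a' with a b, so the fusion of a and b cannot be empty.\<close>

lemma fusion_rules_product_nonzero:
  assumes "fusion_rules C" shows "\<exists>c. fus C a b c \<noteq> 0"
proof -
  obtain a' where a': "\<And>c. fus C a c (unt C) = of_bool (c = a')"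
    using assms unfolding fusion_rules_def by metis
  have unit: "fus C (unt C) b b = 1" and comm: "fus C a' a (unt C) = 1"
    using assms a'[of a'] unfolding fusion_rules_def by auto
  have "0 < fus C a' a (unt C) * fus C (unt C) b b" using unit comm by simp
  also have "\<dots> \<le> (\<Sum>e\<in>UNIV. fus C a' a e * fus C e b b)"
    by (rule member_le_sum) auto
  also have "\<dots> = (\<Sum>f\<in>UNIV. fus C a b f * fus C a' f b)"
    using assms unfolding fusion_rules_def by blast
  finally obtain f where "fus C a b f * fus C a' f b \<noteq> 0"
    by (metis (no_types, lifting) less_numeral_extra(3) sum.neutral)
  then show ?thesis by auto
qed

text \<open>The phases are torsion modulo the field because repeated fusion with \<open>a\<close> must revisit some anyon.\<close>

lemma gauge_phases_CM:
  fixes C :: "'a::finite mtc_data"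
  assumes fusion: "fusion_rules C" and \<gamma>: "\<And>a. cmod (\<gamma> a) = 1"
    and CM: "\<And>a b c. fus C a b c \<noteq> 0 \<Longrightarrow> gauge \<gamma> a b c \<in> CM_numbers"
  shows "\<gamma> a \<in> CM_numbers"
proof -
  have nz: "\<gamma> b \<noteq> 0" for b using \<gamma>[of b] by auto
  define c where "c = rec_nat a (\<lambda>_ x. SOME y. fus C x a y \<noteq> 0)"
  have step: "fus C (c n) a (c (Suc n)) \<noteq> 0" for n
    using someI_ex[OF fusion_rules_product_nonzero[OF fusion, of "c n" a]] by (simp add: c_def)
  \<comment> \<open>The expression telescopes into n gauge factors along the path \<open>c\<close>.
    When the path returns to an earlier anyon the outer phases cancel and a pure power of
    \<open>\<gamma> a\<close> remains.\<close>
  have pow: "\<gamma> (c i) * \<gamma> a ^ n / \<gamma> (c (i + n)) \<in> CM_numbers" for i n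
  proof (induction n)
    case 0
    then show ?case using nz CM.one_mem by simp
  next
    case (Suc n)
    have "\<gamma> (c i) * \<gamma> a ^ Suc n / \<gamma> (c (i + Suc n)) =
      (\<gamma> (c i) * \<gamma> a ^ n / \<gamma> (c (i + n))) * gauge \<gamma> (c (i + n)) a (c (Suc (i + n)))"
      using nz by (simp add: gauge_def)
    then show ?case using CM.mult_mem[OF Suc CM[OF step[of "i + n"]]] by simp
  qed
  have "\<not> inj c" using finite_imageD[of c UNIV] by (metis finite infinite_UNIV_nat)
  then obtain i j where "i < j" "c i = c j" unfolding inj_def by (metis nat_neq_iff)
  then have "\<gamma> a ^ (j - i) \<in> CM_numbers" using pow[of i "j - i"] nz by simp
  then show ?thesis using CM_numbers_root[OF \<gamma>, of "j - i"] \<open>i < j\<close> by simp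
qed

lemma unitary_mat_nonzero_entry:
  assumes "unitary_mat n A" "n \<noteq> 0" shows "\<exists>i<n. A $$ (i, 0) \<noteq> 0"
proof (rule ccontr)
  note A = unitary_matD[OF assms(1)]
  assume "\<not> ?thesis"
  then have "(mat_adjoint A * A) $$ (0, 0) = 0"
    using A(1) assms(2) by (subst mat_mult_index[of _ n n _ n]) auto
  then show False using A assms(2) by simp
qed

lemma countable_PiE_const:
  assumes "finite I" "countable K" shows "countable (I \<rightarrow>\<^sub>E K)"
proof -
  obtain xs where xs: "set xs = I" using finite_list[OF assms(1)] by blast
  have "inj_on (\<lambda>f. map f xs) (I \<rightarrow>\<^sub>E K)"
  proof (rule inj_onI)
    fix f g assume "f \<in> I \<rightarrow>\<^sub>E K" "g \<in> I \<rightarrow>\<^sub>E K" "map f xs = map g xs"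
    then show "f = g" using xs by (intro PiE_ext[of f I "\<lambda>_. K" g]) (auto simp: map_eq_conv)
  qed
  moreover have "(\<lambda>f. map f xs) ` (I \<rightarrow>\<^sub>E K) \<subseteq> lists K" using xs by auto
  then have "countable ((\<lambda>f. map f xs) ` (I \<rightarrow>\<^sub>E K))"
    using countable_lists[OF assms(2)] by (rule countable_subset)
  ultimately show ?thesis using countable_image_inj_on by blast
qed

text \<open>If all the unitaries \<open>exp (\<i> t L)\<close> can be rescaled by phases into the same countable set, then \<open>L\<close> is a
  coboundary: compare two parameters with the same rescaled entries and the same windings of the phases.\<close>

lemma countable_orbit_imp_coboundary:
  fixes C :: "'a::finite mtc_data"
  assumes T: "\<And>a b c. unitary_mat (fus C a b c) (T a b c)" and K: "countable K"
    and orbit: "\<And>t :: real. \<exists>\<gamma>. (\<forall>a. cmod (\<gamma> a) = 1) \<and>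
      (\<forall>a b c. elements_mat (gauge \<gamma> a b c \<cdot>\<^sub>m spec_power (fus C a b c) (T a b c) (l a b c) (\<i> * of_real t)) \<subseteq> K)"
  shows "\<exists>c. \<forall>a b d. \<forall>i<fus C a b d. l a b d i = c a + c b - c d"
proof -
  let ?P = "\<lambda>a b c t. spec_power (fus C a b c) (T a b c) (l a b c) (\<i> * of_real t)"
  obtain \<gamma> :: "real \<Rightarrow> 'a \<Rightarrow> complex" where \<gamma>: "\<And>t a. cmod (\<gamma> t a) = 1"
    "\<And>t a b c. elements_mat (gauge (\<gamma> t) a b c \<cdot>\<^sub>m ?P a b c t) \<subseteq> K"
    using orbit by metis
  define \<theta> where "\<theta> = (\<lambda>t a. Arg (\<gamma> t a))"
  have cis_\<theta>: "\<gamma> t a = cis (\<theta> t a)" for t a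
    unfolding \<theta>_def using \<gamma>(1)[of t a] cis_Arg[of "\<gamma> t a"] by (cases "\<gamma> t a = 0") (auto simp: sgn_eq)
  \<comment> \<open>The total angle of the i-th eigenvalue of the rescaled matrix: the angles of the
    phases plus t times the logarithm.\<close>
  define x where "x = (\<lambda>t a b d i. \<theta> t a + \<theta> t b - \<theta> t d + t * l a b d i)"
  define I where "I = (UNIV :: ('a \<times> 'a \<times> 'a) set) \<times> {..<Suc (\<Sum>(a, b, c)\<in>UNIV. fus C a b c)} \<times> {..<Suc (\<Sum>(a, b, c)\<in>UNIV. fus C a b c)}"
  have "finite I" by (simp add: I_def)
  have bound: "fus C a b c \<le> (\<Sum>(a, b, c)\<in>UNIV. fus C a b c)" for a b c
    using member_le_sum[of "(a, b, c)" UNIV "\<lambda>(a, b, c). fus C a b c"] by simp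
  \<comment> \<open>One finite index set serves all fusion spaces, so indices are cut off at the
    last row and column; for empty spaces, where even that is out of range, \<open>f'\<close> puts
    the default 0.\<close>
  define f where "f = (\<lambda>t. \<lambda>((a, b, c), i, j)\<in>I. (gauge (\<gamma> t) a b c \<cdot>\<^sub>m ?P a b c t) $$ (min i (fus C a b c - 1), min j (fus C a b c - 1)))"
  define f' where "f' = (\<lambda>t. \<lambda>((a, b, c), i, j)\<in>I. if fus C a b c = 0 then 0 else f t ((a, b, c), i, j))"
  \<comment> \<open>Equal matrices fix the angles modulo 2 pi only. Recording the integer part of
    each angle in units of 2 pi, still countably many possibilities, removes the ambiguity.\<close>
  define g where "g = (\<lambda>t. \<lambda>((a, b, c), i, j)\<in>I. \<lfloor>x t a b c i / (2 * pi)\<rfloor>)"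
  have P: "?P a b c t \<in> carrier_mat (fus C a b c) (fus C a b c)" for a b c t by (rule spec_power_carrier[OF T])
  have entries: "(gauge (\<gamma> t) a b c \<cdot>\<^sub>m ?P a b c t) $$ (i, j) \<in> K" if "i < fus C a b c" "j < fus C a b c" for a b c t i j
    using \<gamma>(2)[of t a b c] elements_matI[of i "gauge (\<gamma> t) a b c \<cdot>\<^sub>m ?P a b c t" j] P[of a b c t] that by auto
  have "f' t \<in> (\<Pi>\<^sub>E p\<in>I. insert 0 K)" for t
    using entries by (auto simp: f'_def f_def)
  moreover have "g t \<in> (\<Pi>\<^sub>E p\<in>I. UNIV)" for t by (auto simp: g_def)
  ultimately have "range (\<lambda>t. (f' t, g t)) \<subseteq> (\<Pi>\<^sub>E p\<in>I. insert 0 K) \<times> (\<Pi>\<^sub>E p\<in>I. UNIV)" by auto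
  moreover have "countable ((\<Pi>\<^sub>E p\<in>I. insert 0 K) \<times> (\<Pi>\<^sub>E p\<in>I. (UNIV :: int set)))"
    using \<open>finite I\<close> K by (intro countable_SIGMA countable_PiE_const) auto
  ultimately have "countable (range (\<lambda>t. (f' t, g t)))" by (rule countable_subset)
  then have "\<not> inj (\<lambda>t. (f' t, g t))" using countable_image_inj_on uncountable_UNIV_real by blast
  then obtain s t where st: "s \<noteq> t" "f' s = f' t" "g s = g t" unfolding inj_def by blast
  have "l a b d i = (\<theta> t a - \<theta> s a) / (s - t) + (\<theta> t b - \<theta> s b) / (s - t) - (\<theta> t d - \<theta> s d) / (s - t)"
    if i: "i < fus C a b d" for a b d i
  proof -
    let ?n = "fus C a b d" and ?T = "T a b d" and ?l = "l a b d"
    have eq: "gauge (\<gamma> s) a b d \<cdot>\<^sub>m ?P a b d s = gauge (\<gamma> t) a b d \<cdot>\<^sub>m ?P a b d t"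
    proof (rule eq_matI)
      fix j k assume "j < dim_row (gauge (\<gamma> t) a b d \<cdot>\<^sub>m ?P a b d t)" "k < dim_col (gauge (\<gamma> t) a b d \<cdot>\<^sub>m ?P a b d t)"
      then have jk: "j < ?n" "k < ?n" using P[of a b d t] by auto
      then have "((a, b, d), j, k) \<in> I" using bound[of a b d] by (auto simp: I_def)
      then show "(gauge (\<gamma> s) a b d \<cdot>\<^sub>m ?P a b d s) $$ (j, k) = (gauge (\<gamma> t) a b d \<cdot>\<^sub>m ?P a b d t) $$ (j, k)"
        using fun_cong[OF st(2), of "((a, b, d), j, k)"] jk by (simp add: f'_def f_def min_def split: if_splits)
    qed (use P[of a b d s] P[of a b d t] in auto)
    \<comment> \<open>Passing to the basis \<open>T\<close> turns the equality of matrices into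
      equalities of eigenvalues, which sit on the diagonal.\<close>
    have diag: "(mat_adjoint ?T * ((y \<cdot>\<^sub>m spec_power ?n ?T ?l z) * ?T)) $$ (i, i) = y * exp (z * of_real (?l i))" for y z
    proof -
      note u = unitary_matD[OF T[of a b d]]
      have "mat_adjoint ?T * ((y \<cdot>\<^sub>m spec_power ?n ?T ?l z) * ?T) = mat_adjoint ?T * (y \<cdot>\<^sub>m (?T * mat_diag ?n (\<lambda>i. exp (z * of_real (?l i)))))"
        using u spec_power_carrier[OF T[of a b d]] by (simp add: mult_smult_assoc_mat[of _ ?n ?n _ ?n] spec_power_mult_basis[OF T])
      also have "\<dots> = y \<cdot>\<^sub>m (mat_adjoint ?T * ?T * mat_diag ?n (\<lambda>i. exp (z * of_real (?l i))))"
        using u assoc_mult_mat[of "mat_adjoint ?T" ?n ?n ?T ?n "mat_diag ?n (\<lambda>i. exp (z * of_real (?l i)))" ?n]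
        by (simp add: mult_smult_distrib[of _ ?n ?n _ ?n] mult_carrier_mat[of _ ?n ?n _ ?n])
      finally show ?thesis using u i by (simp add: left_mult_one_mat[of _ ?n ?n] mat_diag_def)
    qed
    have gx: "gauge (\<gamma> r) a b d * exp (\<i> * of_real r * of_real (?l i)) = cis (x r a b d i)" for r
      by (simp add: gauge_def cis_\<theta> cis_mult cis_divide x_def flip: cis_conv_exp add: mult.assoc)
        (simp add: cis_conv_exp mult_exp_exp algebra_simps)
    have "cis (x s a b d i) = cis (x t a b d i)"
      using arg_cong[OF eq, of "\<lambda>A. (mat_adjoint ?T * (A * ?T)) $$ (i, i)"] unfolding diag gx .
    then have "sin (x s a b d i) = sin (x t a b d i) \<and> cos (x s a b d i) = cos (x t a b d i)"
      by (simp add: cis.ctr complex_eq_iff)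
    then obtain n :: int where n: "x s a b d i = x t a b d i + 2 * of_int n * pi"
      using sin_cos_eq_iff[of "x s a b d i" "x t a b d i"] by auto
    have "((a, b, d), i, i) \<in> I" using i bound[of a b d] by (auto simp: I_def)
    then have "\<lfloor>x s a b d i / (2 * pi)\<rfloor> = \<lfloor>x t a b d i / (2 * pi)\<rfloor>"
      using fun_cong[OF st(3), of "((a, b, d), i, i)"] by (simp add: g_def)
    moreover have "x s a b d i / (2 * pi) = x t a b d i / (2 * pi) + of_int n"
      unfolding n by (simp add: field_simps)
    ultimately have "n = 0" by simp
    then have "(s - t) * ?l i = (\<theta> t a - \<theta> s a) + (\<theta> t b - \<theta> s b) - (\<theta> t d - \<theta> s d)"
      using n by (simp add: x_def algebra_simps)
    then have "?l i = ((\<theta> t a - \<theta> s a) + (\<theta> t b - \<theta> s b) - (\<theta> t d - \<theta> s d)) / (s - t)"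
      using st(1) by (simp add: eq_divide_eq mult.commute)
    then show ?thesis by (simp only: add_divide_distrib diff_divide_distrib)
  qed
  then show ?thesis by (intro exI[of _ "\<lambda>a. (\<theta> t a - \<theta> s a) / (s - t)"]) blast
qed


lemma spec_power_const:
  assumes "unitary_mat n T" "\<And>i. i < n \<Longrightarrow> l i = r"
  shows "spec_power n T l z = exp (z * of_real r) \<cdot>\<^sub>m 1\<^sub>m n"
proof -
  note u = unitary_matD[OF assms(1)]
  have "mat_diag n (\<lambda>i. exp (z * of_real (l i))) = exp (z * of_real r) \<cdot>\<^sub>m 1\<^sub>m n"
    using assms(2) by (intro eq_matI) (auto simp: mat_diag_def)
  then show ?thesis
    using u by (simp add: spec_power_def mult_smult_distrib[of _ n n _ n] mult_smult_assoc_mat[of _ n n _ n])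
qed

text \<open>The assumptions are chosen to survive the exchange of \<open>C\<close> and
  \<open>C'\<close>. The one whose transfer is hard is \<open>representatives\<close>, which for
  \<open>C'\<close> follows from surjectivity of conjugation on classes.\<close>

locale conjugate_pair =
  fixes C C' :: "'a::finite mtc_data" and \<sigma> :: "complex \<Rightarrow> complex"
  assumes embedding: "complex_embedding algebraic_numbers \<sigma>"
    and conj: "conj_data \<sigma> C C'"
    and FR_CM: "FR_entries C \<subseteq> CM_numbers"
    and R: "R_dims C"
    and fusion: "fusion_rules C"
    and representatives: "\<And>x. x \<in> carrier (zero_form_group C) \<Longrightarrow> \<exists>g\<in>x. CM_sym g"
begin

sublocale \<sigma>: complex_embedding algebraic_numbers \<sigma>
  by (rule embedding)

abbreviation \<sigma>' :: "complex \<Rightarrow> complex" where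
  "\<sigma>' \<equiv> inv_into algebraic_numbers \<sigma>"

lemma fus_eq [simp]: "fus C' = fus C" and unt_eq [simp]: "unt C' = unt C" and piv_eq [simp]: "piv C' = piv C"
  using conj by (simp_all add: conj_data_def)

lemma R': "R_dims C'"
  by (rule conj_data_R_dims[OF conj R])

lemma \<sigma>_surj: "\<sigma> ` algebraic_numbers = algebraic_numbers"
  by (rule complex_embedding_algebraic_surj[OF embedding])

lemma embedding': "complex_embedding algebraic_numbers \<sigma>'"
  using \<sigma>.inverse_embedding by (simp only: \<sigma>_surj)

lemma \<sigma>'_\<sigma>: "x \<in> algebraic_numbers \<Longrightarrow> \<sigma>' (\<sigma> x) = x"
  by (rule inv_into_f_f[OF \<sigma>.inj])

lemma CM_sym_algebraic: "CM_sym g \<Longrightarrow> elements_mat (smat g a b c) \<subseteq> algebraic_numbers"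
  using CM_numbers_algebraic unfolding CM_sym_def by (meson subset_iff)

lemma FR_algebraic: "FR_entries C \<subseteq> algebraic_numbers"
  using FR_CM CM_numbers_algebraic by (meson subset_iff)

lemma elements_mat_adjoint: "elements_mat (mat_adjoint A) = cnj ` elements_mat A"
  unfolding elements_mat_eq by force

lemma map_mat_adjoint_CM:
  assumes "elements_mat A \<subseteq> CM_numbers" shows "map_mat \<sigma> (mat_adjoint A) = mat_adjoint (map_mat \<sigma> A)"
  by (rule map_mat_adjoint) (use assms embedding_cnj_CM[OF embedding] in blast)

text \<open>CM entries are used twice: \<sigma> commutes with \<open>K^g\<close> at the F and R
  symbols, which gives the equations, and with taking adjoints of the symmetry matrices, which gives
  unitarity.\<close>

lemma conj_sym_in_syms:
  assumes g: "g \<in> syms C" "CM_sym g" shows "conj_sym \<sigma> g \<in> syms C'"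
proof (rule lin_sym_unitary_in_syms)
  have el: "elements_mat (smat g a b c) \<subseteq> algebraic_numbers" for a b c by (rule CM_sym_algebraic[OF g(2)])
  have "lin_sym C' (sperm g) (Kc g) (\<lambda>a b c. map_mat \<sigma> (smat g a b c)) (\<lambda>a b c. map_mat \<sigma> (mat_adjoint (smat g a b c)))"
  proof (rule lin_sym_map[OF symsD(4)[OF g(1)] embedding el _ FR_algebraic _ conj R])
    show "elements_mat (mat_adjoint (smat g a b c)) \<subseteq> algebraic_numbers" for a b c
      using el[of a b c] by (auto simp: elements_mat_adjoint)
    show "\<sigma> (Kc g x) = Kc g (\<sigma> x)" if "x \<in> FR_entries C" for x
      using Kc_embedding[OF embedding] FR_CM that by blast
  qed
  then show "lin_sym C' (sperm g) (Kc (conj_sym \<sigma> g)) (smat (conj_sym \<sigma> g)) (\<lambda>a b c. map_mat \<sigma> (mat_adjoint (smat g a b c)))"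
    by simp
  show "unitary_mat (fus C' a b c) (smat (conj_sym \<sigma> g) a b c)" for a b c
  proof -
    note u = unitary_matD[OF symsD(1)[OF g(1), of a b c]]
    have ad: "elements_mat (mat_adjoint (smat g a b c)) \<subseteq> algebraic_numbers"
      using el[of a b c] by (auto simp: elements_mat_adjoint)
    have "map_mat \<sigma> (mat_adjoint (smat g a b c) * smat g a b c) = mat_adjoint (map_mat \<sigma> (smat g a b c)) * map_mat \<sigma> (smat g a b c)"
      using \<sigma>.map_mat_mult[OF mat_adjoint_carrier[OF u(1)] u(1) ad el] g(2)
      by (simp add: map_mat_adjoint_CM CM_sym_def)
    then show ?thesis using u by (intro unitary_matI) (simp_all add: \<sigma>.map_mat_one)
  qed
qed simp

lemma CM_sym_conj_sym: "CM_sym g \<Longrightarrow> CM_sym (conj_sym \<sigma> g)"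
  using embedding_CM_numbers[OF embedding] by (fastforce simp: CM_sym_def elements_mat_eq)

lemma conj_sym_comp:
  assumes "g \<in> syms C" "h \<in> syms C" "CM_sym g" "CM_sym h"
  shows "conj_sym \<sigma> (sym_comp g h) = sym_comp (conj_sym \<sigma> g) (conj_sym \<sigma> h)"
proof (intro sym.equality ext)
  fix a b c
  let ?p = "inv_into UNIV (sperm g)" and ?n = "fus C a b c"
  have c: "smat h (?p a) (?p b) (?p c) \<in> carrier_mat ?n ?n" "smat g a b c \<in> carrier_mat ?n ?n"
    using symsD(5)[OF assms(2), of "?p a" "?p b" "?p c"] symsD(5)[OF assms(1)] by (auto simp: fus_sperm_inverse[OF assms(1)])
  have h: "x \<in> CM_numbers" if "x \<in> elements_mat (smat h (?p a) (?p b) (?p c))" for x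
    using that assms(4) by (auto simp: CM_sym_def)
  have el: "elements_mat (map_mat (Kc g) (smat h (?p a) (?p b) (?p c))) \<subseteq> algebraic_numbers"
    using h Kc_CM_numbers CM_numbers_algebraic by (fastforce simp: elements_mat_eq)
  have "map_mat \<sigma> (map_mat (Kc g) (smat h (?p a) (?p b) (?p c))) = map_mat (Kc g) (map_mat \<sigma> (smat h (?p a) (?p b) (?p c)))"
    using h Kc_embedding[OF embedding] elements_matI by (intro eq_matI) auto
  then show "smat (conj_sym \<sigma> (sym_comp g h)) a b c = smat (sym_comp (conj_sym \<sigma> g) (conj_sym \<sigma> h)) a b c"
    using \<sigma>.map_mat_mult[OF map_carrier_mat[THEN iffD2, OF c(1)] c(2) el CM_sym_algebraic[OF assms(3)]]
    by (simp add: sym_comp_def)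
qed (auto simp: sym_comp_def)

lemma CM_sym_comp:
  assumes "g \<in> syms C" "h \<in> syms C" "CM_sym g" "CM_sym h"
  shows "CM_sym (sym_comp g h)"
  unfolding CM_sym_def
proof (intro allI)
  fix a b c
  let ?p = "inv_into UNIV (sperm g)" and ?n = "fus C a b c"
  have c: "map_mat (Kc g) (smat h (?p a) (?p b) (?p c)) \<in> carrier_mat ?n ?n" "smat g a b c \<in> carrier_mat ?n ?n"
    using symsD(5)[OF assms(2), of "?p a" "?p b" "?p c"] symsD(5)[OF assms(1)] by (auto simp: fus_sperm_inverse[OF assms(1)])
  have "elements_mat (map_mat (Kc g) (smat h (?p a) (?p b) (?p c))) \<subseteq> CM_numbers"
    using assms(4) Kc_CM_numbers elements_matI[of _ "smat h (?p a) (?p b) (?p c)"] by (fastforce simp: elements_mat_eq CM_sym_def)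
  then show "elements_mat (smat (sym_comp g h) a b c) \<subseteq> CM_numbers"
    using CM.elements_mat_mult[OF c] assms(3) by (simp add: sym_comp_def CM_sym_def)
qed

text \<open>On every nonzero fusion space the gauge factor is a quotient of two matrix entries,
  hence a CM number. The individual phases must be CM numbers as well, since their images under
  \<sigma> form the conjugate gauge transformation; the fusion rules supply this.\<close>

lemma CM_nat_iso_gauge:
  assumes "g \<in> syms C" "CM_sym g" "CM_sym h" "\<And>a. cmod (\<gamma> a) = 1"
    and h: "\<And>a b c. smat h a b c = gauge \<gamma> a b c \<cdot>\<^sub>m smat g a b c"
  shows "\<gamma> a \<in> CM_numbers"
proof (rule gauge_phases_CM[OF fusion assms(4)])
  fix a b c assume n: "fus C a b c \<noteq> 0"
  obtain i where i: "i < fus C a b c" "smat g a b c $$ (i, 0) \<noteq> 0"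
    using unitary_mat_nonzero_entry[OF symsD(1)[OF assms(1)] n] by blast
  have "smat g a b c \<in> carrier_mat (fus C a b c) (fus C a b c)" by (rule symsD(5)[OF assms(1)])
  then have d: "i < dim_row (smat g a b c)" "0 < dim_col (smat g a b c)" using i(1) n by auto
  then have "smat g a b c $$ (i, 0) \<in> elements_mat (smat g a b c)" "smat h a b c $$ (i, 0) \<in> elements_mat (smat h a b c)"
    by (auto intro!: elements_matI simp: h simp del: index_smult_mat(1))
  then have "smat g a b c $$ (i, 0) \<in> CM_numbers" "smat h a b c $$ (i, 0) \<in> CM_numbers"
    using assms(2,3) unfolding CM_sym_def by blast+
  moreover have "gauge \<gamma> a b c = smat h a b c $$ (i, 0) / smat g a b c $$ (i, 0)"
    using d i(2) by (simp add: h)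
  ultimately show "gauge \<gamma> a b c \<in> CM_numbers" using CM.divide_mem by simp
qed

lemma gauge_embedding:
  assumes "\<And>a. \<gamma> a \<in> CM_numbers"
  shows "gauge (\<lambda>a. \<sigma> (\<gamma> a)) a b c = \<sigma> (gauge \<gamma> a b c)" "gauge \<gamma> a b c \<in> algebraic_numbers"
proof -
  have "\<gamma> x \<in> algebraic_numbers" for x using assms CM_numbers_algebraic by blast
  then show "gauge (\<lambda>a. \<sigma> (\<gamma> a)) a b c = \<sigma> (gauge \<gamma> a b c)" "gauge \<gamma> a b c \<in> algebraic_numbers"
    unfolding gauge_def using \<sigma>.mult_mem \<sigma>.divide_mem by (simp_all add: \<sigma>.hom_mult \<sigma>.hom_divide)
qed

lemma conj_sym_nat_iso:
  assumes "(g, h) \<in> nat_iso C" "CM_sym g" "CM_sym h"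
  shows "(conj_sym \<sigma> g, conj_sym \<sigma> h) \<in> nat_iso C'"
proof -
  obtain \<gamma> where \<gamma>: "\<And>a. cmod (\<gamma> a) = 1" "\<And>a b c. smat h a b c = gauge \<gamma> a b c \<cdot>\<^sub>m smat g a b c"
    and gh: "g \<in> syms C" "h \<in> syms C" "anti g = anti h" "sperm g = sperm h"
    using assms(1) by (auto simp: nat_iso_iff)
  have CM: "\<gamma> a \<in> CM_numbers" for a using CM_nat_iso_gauge[OF gh(1) assms(2,3) \<gamma>] .
  have "map_mat \<sigma> (smat h a b c) = gauge (\<lambda>a. \<sigma> (\<gamma> a)) a b c \<cdot>\<^sub>m map_mat \<sigma> (smat g a b c)" for a b c
    using CM_sym_algebraic[OF assms(2), of a b c] elements_matI[of _ "smat g a b c"] gauge_embedding[of \<gamma>, OF CM]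
    by (intro eq_matI) (auto simp: \<gamma>(2) \<sigma>.hom_mult subset_iff)
  moreover have "cmod (\<sigma> (\<gamma> a)) = 1" for a by (rule cmod_embedding_CM[OF embedding CM \<gamma>(1)])
  ultimately show ?thesis
    using gh conj_sym_in_syms assms(2,3) unfolding nat_iso_iff
    by (intro conjI exI[of _ "\<lambda>a. \<sigma> (\<gamma> a)"]) auto
qed


lemma FR_CM': "FR_entries C' \<subseteq> CM_numbers"
proof -
  have "FR_entries C' \<subseteq> \<sigma> ` FR_entries C"
  proof
    fix x assume "x \<in> FR_entries C'"
    then consider a b c d i j where "x = Fsym C' a b c d i j" "i \<in> left_idx C a b c d" "j \<in> right_idx C a b c d"
      | a b c i j where "x = Rsym C' a b c $$ (i, j)" "i < dim_row (Rsym C' a b c)" "j < dim_col (Rsym C' a b c)"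
      unfolding FR_entries_def elements_mat_eq left_idx_def right_idx_def fus_eq by blast
    then show "x \<in> \<sigma> ` FR_entries C"
    proof cases
      case 1
      then have "x = \<sigma> (Fsym C a b c d i j)" using conj by (auto simp: conj_data_def)
      then show ?thesis using FR_entriesI(1)[OF 1(2,3)] by blast
    next
      case 2
      have "Rsym C' a b c = map_mat \<sigma> (Rsym C a b c)" using conj by (simp add: conj_data_def)
      then have "x = \<sigma> (Rsym C a b c $$ (i, j))" "i < dim_row (Rsym C a b c)" "j < dim_col (Rsym C a b c)" using 2 by auto
      then show ?thesis using FR_entriesI(2)[OF elements_matI, of i C a b c j] by (metis imageI)
    qed
  qed
  then show ?thesis using FR_CM embedding_CM_numbers[OF embedding] by blast
qed

text \<open>Stated for any \<rho> that agrees with the inverse of \<sigma> on CM numbers, to cover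
  both an extension of that inverse to transcendental numbers and its twist by conjugation.\<close>

lemma conj_data_inverse:
  assumes \<rho>: "\<And>z. z \<in> CM_numbers \<Longrightarrow> \<rho> z = \<sigma>' z"
  shows "conj_data \<rho> C' C"
proof -
  have inv: "\<rho> (\<sigma> x) = x" if "x \<in> FR_entries C" for x
    using \<rho>[OF embedding_CM_numbers[OF embedding]] FR_CM FR_algebraic \<sigma>'_\<sigma> that by (metis subsetD)
  show ?thesis
    unfolding conj_data_def
  proof (intro conjI allI ballI)
    fix a b c d i j assume "i \<in> left_idx C' a b c d" "j \<in> right_idx C' a b c d"
    then have ij: "i \<in> left_idx C a b c d" "j \<in> right_idx C a b c d" by (simp_all add: left_idx_def right_idx_def)
    then have "Fsym C' a b c d i j = \<sigma> (Fsym C a b c d i j)" using conj by (simp add: conj_data_def)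
    then show "Fsym C a b c d i j = \<rho> (Fsym C' a b c d i j)" using inv[OF FR_entriesI(1)[OF ij]] by simp
  next
    fix a b c
    have "Rsym C' a b c = map_mat \<sigma> (Rsym C a b c)" using conj by (simp add: conj_data_def)
    then show "Rsym C a b c = map_mat \<rho> (Rsym C' a b c)"
      using inv[OF FR_entriesI(2)[OF elements_matI]] by (intro eq_matI) auto
  qed simp_all
qed

text \<open>Every symmetry of \<open>C'\<close>, with possibly transcendental matrices \<open>U'\<close>, comes from one of \<open>C\<close>. An
  extension \<open>\<tau>\<close> of the inverse of \<open>\<sigma>\<close> maps \<open>U'\<close> to a solution \<open>U\<close> of the symmetry equations of \<open>C\<close>, which
  need not be unitary; conjugating \<open>\<tau>\<close> by complex conjugation shows that the inverse adjoint of \<open>U\<close> is a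
  solution as well. So \<open>Q = U\<^sup>* U\<close> is a positive symmetry with trivial permutation, and so are its powers.
  The unitary ones have representatives over the countable field of CM numbers, hence \<open>Q\<close> is a gauge
  transformation, and rescaling \<open>U\<close> by its square root gives a unitary symmetry.\<close>

lemma conj_sym_surj:
  assumes g': "g' \<in> syms C'"
  shows "\<exists>g\<in>syms C. CM_sym g \<and> (g', conj_sym \<sigma> g) \<in> nat_iso C'"
proof -
  let ?p = "sperm g'" and ?k = "Kc g'" and ?U' = "smat g'"
  note u' = unitary_matD[OF symsD(1)[OF g', simplified]]
  \<comment> \<open>Closed under conjugation, so that \<tau> and its twist are both defined at all
    entries of the matrices and of their adjoints.\<close>
  define B where "B = (\<Union>a b c. elements_mat (?U' a b c)) \<union> cnj ` (\<Union>a b c. elements_mat (?U' a b c))"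
  have B1: "elements_mat (?U' a b c) \<subseteq> B" for a b c unfolding B_def by blast
  have B2: "cnj ` elements_mat (?U' a b c) \<subseteq> B" for a b c
    unfolding B_def by (intro le_supI2 image_mono) blast
  have B_cnj: "cnj x \<in> B" if "x \<in> B" for x
  proof -
    have closed: "cnj y \<in> Y \<union> cnj ` Y" if "y \<in> Y \<union> cnj ` Y" for y and Y :: "complex set"
      using that by (elim UnE imageE) auto
    show ?thesis using that unfolding B_def by (rule closed)
  qed
  have "countable B"
    unfolding B_def by (intro countable_Un countable_image countable_UN) (auto simp: elements_mat_def)
  then obtain E \<tau> where E: "complex_embedding E \<tau>" "countable E" "algebraic_numbers \<union> B \<subseteq> E"
    and \<tau>_ext: "\<And>z. z \<in> algebraic_numbers \<Longrightarrow> \<tau> z = \<sigma>' z"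
    using complex_embedding.extend_to_countable[OF embedding' countable_algebraic_numbers] by metis
  interpret \<tau>: complex_embedding E \<tau> by fact
  define \<tau>2 where "\<tau>2 = (\<lambda>x. cnj (\<tau> (cnj x)))"
  have \<tau>2: "complex_embedding (cnj ` E) \<tau>2" unfolding \<tau>2_def by (rule \<tau>.conjugate_embedding)
  have lin: "lin_sym C' ?p ?k ?U' (\<lambda>a b c. mat_adjoint (?U' a b c))" by (rule symsD(4)[OF g'])
  have solution: "lin_sym C ?p ?k (\<lambda>a b c. map_mat \<rho> (?U' a b c)) (\<lambda>a b c. map_mat \<rho> (mat_adjoint (?U' a b c)))"
    if \<rho>: "complex_embedding F \<rho>" "algebraic_numbers \<union> B \<subseteq> F" "\<And>z. z \<in> CM_numbers \<Longrightarrow> \<rho> z = \<sigma>' z" for F \<rho>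
  proof (rule lin_sym_map[OF lin \<rho>(1) _ _ _ _ conj_data_inverse[OF \<rho>(3)] R'])
    show "elements_mat (?U' a b c) \<subseteq> F" for a b c using \<rho>(2) B1[of a b c] by (meson le_sup_iff order_trans)
    show "elements_mat (mat_adjoint (?U' a b c)) \<subseteq> F" for a b c
      unfolding elements_mat_adjoint using \<rho>(2) B2[of a b c] by (meson le_sup_iff order_trans)
    show "FR_entries C' \<subseteq> F" using FR_CM' CM_numbers_algebraic \<rho>(2) by blast
    show "\<rho> (?k x) = ?k (\<rho> x)" if x: "x \<in> FR_entries C'" for x
      using \<rho>(3)[OF subsetD[OF FR_CM' x]] \<rho>(3)[OF Kc_CM_numbers[OF subsetD[OF FR_CM' x], of g']] Kc_embedding[OF embedding' subsetD[OF FR_CM' x], of g'] by simp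
  qed
  define U where "U = (\<lambda>a b c. map_mat \<tau> (?U' a b c))"
  define V where "V = (\<lambda>a b c. map_mat \<tau> (mat_adjoint (?U' a b c)))"
  define W where "W = (\<lambda>a b c. map_mat \<tau>2 (?U' a b c))"
  have sym_U: "lin_sym C ?p ?k U V"
    unfolding U_def V_def using \<tau>_ext CM_numbers_algebraic by (intro solution[OF E(1,3)]) blast
  have "lin_sym C ?p ?k W (\<lambda>a b c. map_mat \<tau>2 (mat_adjoint (?U' a b c)))"
    unfolding W_def
  proof (rule solution[OF \<tau>2])
    show "algebraic_numbers \<union> B \<subseteq> cnj ` E"
    proof
      fix x assume "x \<in> algebraic_numbers \<union> B"
      then have "cnj x \<in> algebraic_numbers \<union> B" using B_cnj by auto
      then have "cnj x \<in> E" using E(3) by blast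
      then show "x \<in> cnj ` E" by (metis complex_cnj_cnj imageI)
    qed
    show "\<tau>2 z = \<sigma>' z" if "z \<in> CM_numbers" for z
      using \<tau>_ext[OF CM_numbers_algebraic[OF cnj_CM_numbers[OF that]]] embedding_cnj_CM[OF embedding' that]
      by (simp add: \<tau>2_def)
  qed
  \<comment> \<open>So \<open>W\<close> is the inverse adjoint of \<open>U\<close>, and the quotient
    of the two solutions is the Gram matrix of \<open>U\<close>.\<close>
  moreover have "map_mat \<tau>2 (mat_adjoint (?U' a b c)) = mat_adjoint (U a b c)" for a b c
    by (rule eq_matI) (auto simp: \<tau>2_def U_def)
  ultimately have sym_W: "lin_sym C ?p ?k W (\<lambda>a b c. mat_adjoint (U a b c))" by simp
  note Uc = inverse_pairD[OF lin_symD(3)[OF sym_U]]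
  have "\<exists>T (l :: nat \<Rightarrow> real). unitary_mat (fus C a b c) T \<and> mat_adjoint (U a b c) * U a b c = spec_power (fus C a b c) T l 1" for a b c
    using gram_matrix_spectral[OF Uc(1,2,4)[of a b c]] by (simp add: spec_power_def)
  then obtain T l where T: "\<And>a b c. unitary_mat (fus C a b c) (T a b c)"
    and Q: "\<And>a b c. mat_adjoint (U a b c) * U a b c = spec_power (fus C a b c) (T a b c) (l a b c :: nat \<Rightarrow> real) 1"
    by metis
  let ?P = "\<lambda>z a b c. spec_power (fus C a b c) (T a b c) (l a b c) z"
  have sym_P: "lin_sym C id id (?P z) (?P (- z))" for z
    by (rule lin_sym_spec_power[OF lin_sym_quotient[OF sym_U sym_W R] R T Q])
  \<comment> \<open>Imaginary powers are unitary symmetries of \<open>C\<close> with trivial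
    permutation; each has a CM representative by assumption, which differs from it by a gauge
    transformation.\<close>
  have orbit: "\<exists>\<gamma>. (\<forall>a. cmod (\<gamma> a) = 1) \<and> (\<forall>a b c. elements_mat (gauge \<gamma> a b c \<cdot>\<^sub>m ?P (\<i> * of_real t) a b c) \<subseteq> CM_numbers)" for t :: real
  proof -
    define g where "g = \<lparr>anti = False, sperm = id, smat = ?P (\<i> * of_real t)\<rparr>"
    have "Kc g = id" by (auto simp: Kc_def g_def)
    moreover have "unitary_mat (fus C a b c) (?P (\<i> * of_real t) a b c)" for a b c
      by (rule unitary_matI) (simp_all add: spec_power_carrier[OF T] spec_power_adjoint[OF T] spec_power_mult[OF T] spec_power_zero[OF T])
    ultimately have g: "g \<in> syms C"
      using sym_P[of "\<i> * of_real t"] by (intro lin_sym_unitary_in_syms[of C id g]) (auto simp: g_def)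
    then obtain h where h: "h \<in> sym_class C g" "CM_sym h" using representatives[OF sym_class_in_carrier] by blast
    then obtain \<gamma> where "\<forall>a. cmod (\<gamma> a) = 1" "\<forall>a b c. smat h a b c = gauge \<gamma> a b c \<cdot>\<^sub>m smat g a b c"
      by (auto simp: nat_iso_iff)
    then show ?thesis using h(2) unfolding CM_sym_def by (intro exI[of _ \<gamma>]) (simp add: g_def)
  qed
  have "countable CM_numbers"
    using CM_numbers_algebraic by (intro countable_subset[OF _ countable_algebraic_numbers]) blast
  from countable_orbit_imp_coboundary[OF T this orbit]
  obtain r where r: "\<And>a b d i. i < fus C a b d \<Longrightarrow> l a b d i = r a + r b - r d" by blast
  \<comment> \<open>By \<open>r\<close> the Gram matrix is the scalar
    \<open>exp (r a + r b - r c)\<close> on each fusion space, so its inverse square root is the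
    gauge factor of \<open>exp (- r a / 2)\<close>.\<close>
  define \<kappa> where "\<kappa> = (\<lambda>a. complex_of_real (exp (- r a / 2)))"
  have \<kappa>: "\<kappa> a \<noteq> 0" for a by (simp add: \<kappa>_def)
  define v where "v = \<lparr>anti = anti g', sperm = ?p, smat = \<lambda>a b c. gauge \<kappa> a b c \<cdot>\<^sub>m U a b c\<rparr>"
  have v: "v \<in> syms C"
  proof (rule lin_sym_unitary_in_syms)
    have "Kc v = ?k" by (rule Kc_cong) (simp add: v_def)
    then show "lin_sym C ?p (Kc v) (smat v) (\<lambda>a b c. inverse (gauge \<kappa> a b c) \<cdot>\<^sub>m V a b c)"
      using lin_sym_gauge[OF sym_U \<kappa> R] by (simp add: v_def)
    fix a b c
    let ?n = "fus C a b c" and ?x = "gauge \<kappa> a b c"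
    have adj: "mat_adjoint (?x \<cdot>\<^sub>m U a b c) = ?x \<cdot>\<^sub>m mat_adjoint (U a b c)"
      by (rule eq_matI) (auto simp: gauge_def \<kappa>_def)
    have x: "?x * ?x * exp (of_real (r a + r b - r c)) = 1"
      by (simp add: gauge_def \<kappa>_def exp_of_real exp_minus exp_diff exp_add field_simps flip: of_real_mult of_real_divide)
        (simp flip: exp_add of_real_exp)
    have "mat_adjoint (?x \<cdot>\<^sub>m U a b c) * (?x \<cdot>\<^sub>m U a b c) = (?x * ?x) \<cdot>\<^sub>m (mat_adjoint (U a b c) * U a b c)"
      unfolding adj using Uc(1)[of a b c]
      by (simp add: mult_smult_distrib[of _ ?n ?n _ ?n] mult_smult_assoc_mat[of _ ?n ?n _ ?n] smult_smult_mat)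
    also have "\<dots> = 1\<^sub>m ?n"
      unfolding Q using spec_power_const[where z = 1, OF T r, of a b c] x by (simp add: smult_smult_mat smult_one_mat)
    finally show "unitary_mat ?n (smat v a b c)"
      using Uc(1)[of a b c] by (intro unitary_matI) (simp_all add: v_def)
  qed (simp add: v_def)
  then obtain h where h: "h \<in> sym_class C v" "CM_sym h" using representatives[OF sym_class_in_carrier] by blast
  then obtain \<gamma> where \<gamma>: "\<And>a. cmod (\<gamma> a) = 1" "\<And>a b c. smat h a b c = gauge \<gamma> a b c \<cdot>\<^sub>m smat v a b c"
    and h_eq: "h \<in> syms C" "anti h = anti g'" "sperm h = ?p"
    by (auto simp: nat_iso_iff v_def)
  define \<delta> where "\<delta> = (\<lambda>a. \<gamma> a * \<kappa> a)"
  have \<delta>_nz: "\<delta> a \<noteq> 0" for a using \<kappa> \<gamma>(1)[of a] by (auto simp: \<delta>_def)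
  have h_U: "smat h a b c = gauge \<delta> a b c \<cdot>\<^sub>m U a b c" for a b c
    by (simp add: \<gamma>(2) v_def \<delta>_def gauge_simps smult_smult_mat)
  \<comment> \<open>A second extension runs backwards: \<rho> inverts \<tau> and is also defined at
    the rescalings \<delta>, which may be transcendental. It undoes \<tau> on the entries of the
    original matrices and equals \<sigma> on algebraic numbers, so applying it to the entries of
    \<open>h\<close> compares the conjugate of \<open>h\<close> with \<open>g'\<close>.\<close>
  have "countable (range \<delta>)" by simp
  then obtain F \<rho> where F: "complex_embedding F \<rho>" "\<tau> ` E \<union> range \<delta> \<subseteq> F" and \<rho>_ext: "\<And>z. z \<in> \<tau> ` E \<Longrightarrow> \<rho> z = inv_into E \<tau> z"
    using complex_embedding.extend_to_countable[OF \<tau>.inverse_embedding countable_image[OF E(2)]] by metis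
  interpret \<rho>: complex_embedding F \<rho> by fact
  have \<rho>_\<tau>: "\<rho> (\<tau> z) = z" if "z \<in> E" for z
    using that \<rho>_ext[of "\<tau> z"] inv_into_f_f[OF \<tau>.inj that] by simp
  have \<rho>_\<sigma>: "\<rho> z = \<sigma> z" if "z \<in> algebraic_numbers" for z
  proof -
    have mem: "\<sigma> z \<in> algebraic_numbers" using that \<sigma>_surj by blast
    have "\<tau> (\<sigma> z) = z" using \<tau>_ext[OF mem] \<sigma>'_\<sigma>[OF that] by simp
    then show ?thesis using \<rho>_\<tau>[of "\<sigma> z"] E(3) mem by auto
  qed
  define \<mu> where "\<mu> = (\<lambda>a. \<rho> (\<delta> a))"
  have \<delta>_F: "\<delta> a \<in> F" for a using F(2) by auto
  have \<mu>_nz: "\<mu> a \<noteq> 0" for a using \<rho>.hom_eq_0_iff[OF \<delta>_F] \<delta>_nz by (simp add: \<mu>_def)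
  have \<rho>_gauge: "\<rho> (gauge \<delta> a b c) = gauge \<mu> a b c" "gauge \<delta> a b c \<in> F" for a b c
    unfolding gauge_def \<mu>_def using \<delta>_F by (simp_all add: \<rho>.hom_mult \<rho>.hom_divide \<rho>.mult_mem \<rho>.divide_mem)
  have main: "map_mat \<sigma> (smat h a b c) = gauge \<mu> a b c \<cdot>\<^sub>m ?U' a b c" for a b c
  proof (rule eq_matI)
    fix i j assume "i < dim_row (gauge \<mu> a b c \<cdot>\<^sub>m ?U' a b c)" "j < dim_col (gauge \<mu> a b c \<cdot>\<^sub>m ?U' a b c)"
    then have ij: "i < dim_row (?U' a b c)" "j < dim_col (?U' a b c)" by auto
    then have mem: "?U' a b c $$ (i, j) \<in> E" using elements_matI[OF ij] E(3) B1[of a b c] by (meson Un_iff subset_iff)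
    have hij: "smat h a b c $$ (i, j) = gauge \<delta> a b c * \<tau> (?U' a b c $$ (i, j))"
      using ij by (simp add: h_U U_def)
    have "smat h a b c $$ (i, j) \<in> algebraic_numbers"
      using CM_sym_algebraic[OF h(2), of a b c] elements_matI[of i "smat h a b c" j] ij by (auto simp: h_U U_def)
    then have "\<sigma> (smat h a b c $$ (i, j)) = \<rho> (gauge \<delta> a b c * \<tau> (?U' a b c $$ (i, j)))"
      using \<rho>_\<sigma> hij by metis
    also have "\<dots> = gauge \<mu> a b c * ?U' a b c $$ (i, j)"
      using \<rho>.hom_mult[of "gauge \<delta> a b c" "\<tau> (?U' a b c $$ (i, j))"] \<rho>_gauge F(2) mem \<rho>_\<tau>[OF mem] by auto
    finally show "map_mat \<sigma> (smat h a b c) $$ (i, j) = (gauge \<mu> a b c \<cdot>\<^sub>m ?U' a b c) $$ (i, j)"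
      using ij by (simp add: h_U U_def)
  qed (auto simp: h_U U_def)
  \<comment> \<open>The numbers \<mu> may have any modulus, but on nonzero fusion spaces their gauge
    factors relate two unitary matrices and have modulus one. Dividing each \<mu> by its modulus
    leaves these factors unchanged.\<close>
  define \<mu>1 where "\<mu>1 = (\<lambda>a. \<mu> a / of_real (cmod (\<mu> a)))"
  have "map_mat \<sigma> (smat h a b c) = gauge \<mu>1 a b c \<cdot>\<^sub>m ?U' a b c" for a b c
  proof (cases "fus C a b c = 0")
    case True
    have "?U' a b c \<in> carrier_mat 0 0" using symsD(5)[OF g', of a b c] True by simp
    then show ?thesis unfolding main by (intro eq_matI) auto
  next
    case False
    have uni: "unitary_mat (fus C a b c) (gauge \<mu> a b c \<cdot>\<^sub>m ?U' a b c)"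
      using symsD(1)[OF conj_sym_in_syms[OF h_eq(1) h(2)], of a b c] main by simp
    have "cmod (gauge \<mu> a b c) = 1"
      using smult_unitary_cmod[OF symsD(1)[OF g', of a b c, simplified] uni False] .
    moreover have "gauge (\<lambda>a. of_real (cmod (\<mu> a))) a b c = of_real (cmod (gauge \<mu> a b c))"
      by (simp add: gauge_def norm_mult norm_divide)
    ultimately have "gauge (\<lambda>a. of_real (cmod (\<mu> a))) a b c = (1 :: complex)" by simp
    then have "gauge \<mu>1 a b c = gauge \<mu> a b c" unfolding \<mu>1_def by (simp add: gauge_simps)
    then show ?thesis using main by simp
  qed
  moreover have "cmod (\<mu>1 a) = 1" for a using \<mu>_nz[of a] by (simp add: \<mu>1_def norm_divide)
  ultimately have "(g', conj_sym \<sigma> h) \<in> nat_iso C'"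
    using g' conj_sym_in_syms[OF h_eq(1) h(2)] h_eq unfolding nat_iso_iff by (intro conjI exI[of _ \<mu>1]) auto
  then show ?thesis using h_eq(1) h(2) by blast
qed

end

section \<open>Transport of cohomology classes\<close>

lemma transport3_apply:
  assumes "g \<in> carrier G'" "h \<in> carrier G'" "k \<in> carrier G'"
  shows "transport3 G G' \<phi> id \<beta> (g, h, k) =
    \<beta> (inv_into (carrier G) \<phi> g, inv_into (carrier G) \<phi> h, inv_into (carrier G) \<phi> k)"
  using assms by (simp add: transport3_def Let_def)

context
  fixes G :: "'g monoid" and G' :: "'h monoid" and A :: "'b monoid"
    and \<phi> :: "'g \<Rightarrow> 'h" and \<rho> :: "'g \<Rightarrow> 'b \<Rightarrow> 'b" and \<rho>' :: "'h \<Rightarrow> 'b \<Rightarrow> 'b"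
  assumes bij: "bij_betw \<phi> (carrier G) (carrier G')"
    and hom: "\<And>g h. g \<in> carrier G \<Longrightarrow> h \<in> carrier G \<Longrightarrow> \<phi> (g \<otimes>\<^bsub>G\<^esub> h) = \<phi> g \<otimes>\<^bsub>G'\<^esub> \<phi> h"
    and closed: "\<And>g h. g \<in> carrier G \<Longrightarrow> h \<in> carrier G \<Longrightarrow> g \<otimes>\<^bsub>G\<^esub> h \<in> carrier G"
    and act: "\<And>g. g \<in> carrier G \<Longrightarrow> \<rho>' (\<phi> g) = \<rho> g"
begin

private lemma inv_\<phi>: "g \<in> carrier G \<Longrightarrow> inv_into (carrier G) \<phi> (\<phi> g) = g"
  using bij by (simp add: bij_betw_inv_into_left)

private lemma \<phi>_mem: "g \<in> carrier G \<Longrightarrow> \<phi> g \<in> carrier G'"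
  using bij by (auto simp: bij_betw_def)

private lemma \<phi>_surj: "x \<in> carrier G' \<Longrightarrow> \<exists>g\<in>carrier G. x = \<phi> g"
  using bij by (auto simp: bij_betw_def)

private abbreviation "tr \<equiv> transport3 G G' \<phi> (id :: 'b \<Rightarrow> 'b)"

private lemma tr_\<phi>: "g \<in> carrier G \<Longrightarrow> h \<in> carrier G \<Longrightarrow> k \<in> carrier G \<Longrightarrow> tr \<beta> (\<phi> g, \<phi> h, \<phi> k) = \<beta> (g, h, k)"
  by (simp add: transport3_apply \<phi>_mem inv_\<phi>)

lemma transport3_cochains3:
  assumes "\<beta> \<in> carrier (cochains3 G A)" shows "tr \<beta> \<in> carrier (cochains3 G' A)"
  unfolding cochains3_def carrier_product_group
proof (rule PiE_I)
  fix x assume "x \<in> carrier G' \<times> carrier G' \<times> carrier G'"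
  then obtain g h k where "g \<in> carrier G" "h \<in> carrier G" "k \<in> carrier G" "x = (\<phi> g, \<phi> h, \<phi> k)"
    using \<phi>_surj by (auto, metis)
  then show "tr \<beta> x \<in> carrier A" using assms by (auto simp: tr_\<phi> cochains3_def)
next
  fix x assume "x \<notin> carrier G' \<times> carrier G' \<times> carrier G'"
  then show "tr \<beta> x = undefined" by (cases x) (auto simp: transport3_def Let_def)
qed

lemma transport3_kernel:
  assumes "\<beta> \<in> kernel (cochains3 G A) (cochains4 G A) (coboundary3 G A \<rho>)"
  shows "tr \<beta> \<in> kernel (cochains3 G' A) (cochains4 G' A) (coboundary3 G' A \<rho>')"
proof -
  have \<beta>: "\<beta> \<in> carrier (cochains3 G A)"
    and cocycle: "coboundary3 G A \<rho> \<beta> = \<one>\<^bsub>cochains4 G A\<^esub>"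
    using assms by (auto simp: kernel_def)
  have "coboundary3 G' A \<rho>' (tr \<beta>) = \<one>\<^bsub>cochains4 G' A\<^esub>"
  proof
    fix x
    show "coboundary3 G' A \<rho>' (tr \<beta>) x = \<one>\<^bsub>cochains4 G' A\<^esub> x"
    proof (cases "x \<in> carrier G' \<times> carrier G' \<times> carrier G' \<times> carrier G'")
      case True
      then obtain g h k l where ghkl: "g \<in> carrier G" "h \<in> carrier G" "k \<in> carrier G" "l \<in> carrier G"
        and x: "x = (\<phi> g, \<phi> h, \<phi> k, \<phi> l)"
        using \<phi>_surj by (auto, metis)
      have "coboundary3 G' A \<rho>' (tr \<beta>) x = coboundary3 G A \<rho> \<beta> (g, h, k, l)"
        using ghkl by (simp add: x coboundary3_def \<phi>_mem tr_\<phi> act closed flip: hom)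
      then show ?thesis using ghkl by (simp add: cocycle cochains4_def x \<phi>_mem)
    next
      case False
      then show ?thesis by (cases x) (auto simp: coboundary3_def cochains4_def)
    qed
  qed
  then show ?thesis using transport3_cochains3[OF \<beta>] by (simp add: kernel_def)
qed

private lemma transport3_coboundary2:
  assumes "b \<in> carrier (cochains2 G A)"
  shows "\<exists>b'\<in>carrier (cochains2 G' A). \<forall>g\<in>carrier G. \<forall>h\<in>carrier G. \<forall>k\<in>carrier G.
    coboundary2 G' A \<rho>' b' (\<phi> g, \<phi> h, \<phi> k) = coboundary2 G A \<rho> b (g, h, k)"
proof
  let ?b' = "\<lambda>(g, h)\<in>carrier G' \<times> carrier G'. b (inv_into (carrier G) \<phi> g, inv_into (carrier G) \<phi> h)"
  have b': "?b' (\<phi> g, \<phi> h) = b (g, h)" if "g \<in> carrier G" "h \<in> carrier G" for g h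
    using that by (simp add: \<phi>_mem inv_\<phi>)
  show "?b' \<in> carrier (cochains2 G' A)"
    unfolding cochains2_def carrier_product_group
  proof (rule PiE_I)
    fix x assume "x \<in> carrier G' \<times> carrier G'"
    then obtain g h where gh: "g \<in> carrier G" "h \<in> carrier G" "x = (\<phi> g, \<phi> h)"
      using \<phi>_surj by (auto, metis)
    then show "?b' x \<in> carrier A" using assms unfolding gh(3) b'[OF gh(1,2)] by (auto simp: cochains2_def)
  qed auto
  show "\<forall>g\<in>carrier G. \<forall>h\<in>carrier G. \<forall>k\<in>carrier G. coboundary2 G' A \<rho>' ?b' (\<phi> g, \<phi> h, \<phi> k) = coboundary2 G A \<rho> b (g, h, k)"
    unfolding coboundary2_def
    by (simp add: \<phi>_mem inv_\<phi> act closed flip: hom)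
qed

text \<open>Transport carries coboundaries to coboundaries, so a coset lands inside a single coset.
  The inclusion is enough here; equality of Postnikov classes is obtained by transporting
  back.\<close>

lemma transport3_H3:
  assumes c: "c \<in> carrier (H3 G A \<rho>)"
  shows "\<exists>c'\<in>carrier (H3 G' A \<rho>'). tr ` c \<subseteq> c'"
proof -
  let ?M = "(cochains3 G A)\<lparr>carrier := kernel (cochains3 G A) (cochains4 G A) (coboundary3 G A \<rho>)\<rparr>"
  let ?M' = "(cochains3 G' A)\<lparr>carrier := kernel (cochains3 G' A) (cochains4 G' A) (coboundary3 G' A \<rho>')\<rparr>"
  let ?B = "coboundary2 G A \<rho> ` carrier (cochains2 G A)" and ?B' = "coboundary2 G' A \<rho>' ` carrier (cochains2 G' A)"
  obtain \<beta> where \<beta>: "\<beta> \<in> kernel (cochains3 G A) (cochains4 G A) (coboundary3 G A \<rho>)" "c = ?B #>\<^bsub>?M\<^esub> \<beta>"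
    using c by (auto simp: H3_def FactGroup_def RCOSETS_def)
  have "?B' #>\<^bsub>?M'\<^esub> tr \<beta> \<in> carrier (H3 G' A \<rho>')"
    using transport3_kernel[OF \<beta>(1)] by (auto simp: H3_def FactGroup_def RCOSETS_def)
  moreover have "tr ` c \<subseteq> ?B' #>\<^bsub>?M'\<^esub> tr \<beta>"
  proof
    fix y assume "y \<in> tr ` c"
    then obtain b where b: "b \<in> carrier (cochains2 G A)"
      and y: "y = tr (coboundary2 G A \<rho> b \<otimes>\<^bsub>cochains3 G A\<^esub> \<beta>)"
      by (auto simp: \<beta>(2) r_coset_def)
    obtain b' where b': "b' \<in> carrier (cochains2 G' A)"
      "\<And>g h k. g \<in> carrier G \<Longrightarrow> h \<in> carrier G \<Longrightarrow> k \<in> carrier G \<Longrightarrow>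
        coboundary2 G' A \<rho>' b' (\<phi> g, \<phi> h, \<phi> k) = coboundary2 G A \<rho> b (g, h, k)"
      using transport3_coboundary2[OF b] by blast
    have "y = coboundary2 G' A \<rho>' b' \<otimes>\<^bsub>cochains3 G' A\<^esub> tr \<beta>"
    proof
      fix x
      show "y x = (coboundary2 G' A \<rho>' b' \<otimes>\<^bsub>cochains3 G' A\<^esub> tr \<beta>) x"
      proof (cases "x \<in> carrier G' \<times> carrier G' \<times> carrier G'")
        case True
        then obtain g h k where ghk: "g \<in> carrier G" "h \<in> carrier G" "k \<in> carrier G" and x: "x = (\<phi> g, \<phi> h, \<phi> k)"
          using \<phi>_surj by (auto, metis)
        show ?thesis unfolding y x using ghk b'(2)[OF ghk] by (simp add: tr_\<phi> cochains3_def \<phi>_mem)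
      next
        case False
        then show ?thesis by (cases x) (auto simp: y transport3_def Let_def cochains3_def)
      qed
    qed
    then show "y \<in> ?B' #>\<^bsub>?M'\<^esub> tr \<beta>" using b'(1) by (auto simp: r_coset_def)
  qed
  ultimately show ?thesis by blast
qed

end

lemma H3_extensional:
  assumes "c \<in> carrier (H3 G A \<rho>)" "\<beta> \<in> c"
  shows "\<beta> \<in> extensional (carrier G \<times> carrier G \<times> carrier G)"
  using assms by (auto simp: H3_def FactGroup_def RCOSETS_def r_coset_def cochains3_def)

lemma transport3_inverse:
  assumes "bij_betw \<phi> (carrier G) (carrier G')" "\<beta> \<in> extensional (carrier G' \<times> carrier G' \<times> carrier G')"
    and \<psi>: "bij_betw \<psi> (carrier G') (carrier G)" "\<And>g. g \<in> carrier G \<Longrightarrow> \<psi> (\<phi> g) = g"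
  shows "transport3 G G' \<phi> id (transport3 G' G \<psi> id \<beta>) = \<beta>"
proof
  fix x
  have inv: "inv_into (carrier G) \<phi> y \<in> carrier G" "inv_into (carrier G') \<psi> (inv_into (carrier G) \<phi> y) = y" if y: "y \<in> carrier G'" for y
  proof -
    obtain g where g: "g \<in> carrier G" "y = \<phi> g" using y assms(1) by (auto simp: bij_betw_def)
    then have "inv_into (carrier G) \<phi> y = g" using assms(1) by (simp add: bij_betw_inv_into_left)
    moreover have "inv_into (carrier G') \<psi> g = y"
      using bij_betw_inv_into_left[OF \<psi>(1) y] \<psi>(2)[OF g(1)] g(2) by simp
    ultimately show "inv_into (carrier G) \<phi> y \<in> carrier G" "inv_into (carrier G') \<psi> (inv_into (carrier G) \<phi> y) = y"
      using g by simp_all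
  qed
  show "transport3 G G' \<phi> id (transport3 G' G \<psi> id \<beta>) x = \<beta> x"
  proof (cases "x \<in> carrier G' \<times> carrier G' \<times> carrier G'")
    case True
    then show ?thesis using inv by (cases x) (auto simp: transport3_apply)
  next
    case False
    then have "transport3 G G' \<phi> id (transport3 G' G \<psi> id \<beta>) x = undefined"
      by (cases x) (auto simp: transport3_def Let_def)
    then show ?thesis using extensional_arb[OF assms(2) False] by simp
  qed
qed

lemma perm_action_class:
  assumes g: "g \<in> syms C"
  shows "perm_action C (sym_class C g) = restrict (sperm g) (carrier (one_form_group C))"
proof -
  have "sperm h = sperm g" if "h \<in> sym_class C g" for h using that by (auto simp: nat_iso_iff)
  then have "sperm ` sym_class C g = {sperm g}" using sym_class_self[OF g] by blast
  then show ?thesis by (simp add: perm_action_def)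
qed

section \<open>The isomorphism of 0-form symmetry groups\<close>

context conjugate_pair
begin

lemma CM_representative:
  assumes "x \<in> carrier (zero_form_group C)"
  obtains g where "g \<in> syms C" "CM_sym g" "x = sym_class C g"
  using representatives[OF assms] zero_form_group_memD[OF assms] by blast

text \<open>Surjectivity of conjugation gives every symmetry class of \<open>C'\<close> a CM
  representative; the other assumptions pass to the exchanged pair directly.\<close>

lemma swap: "conjugate_pair C' C \<sigma>'"
proof (rule conjugate_pair.intro)
  show "fusion_rules C'" using fusion unfolding fusion_rules_def fus_eq unt_eq .
  show "\<exists>g\<in>x. CM_sym g" if x: "x \<in> carrier (zero_form_group C')" for x
  proof -
    obtain g' where g': "g' \<in> syms C'" "x = sym_class C' g'" using x by (rule carrier_zero_form_groupE)
    obtain g where g: "CM_sym g" "(g', conj_sym \<sigma> g) \<in> nat_iso C'" using conj_sym_surj[OF g'(1)] by blast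
    then show ?thesis using g' CM_sym_conj_sym[OF g(1)] by blast
  qed
qed (rule embedding' conj_data_inverse FR_CM' R' refl)+

text \<open>A class may contain members with entries that are not CM numbers, where conjugation by
  \<sigma> need not give a symmetry; hence the choice of a CM member, of which the result is
  independent by \<open>class_map_class\<close>.\<close>

definition class_map :: "'a sym set \<Rightarrow> 'a sym set" where
  "class_map x = sym_class C' (conj_sym \<sigma> (SOME g. g \<in> x \<and> CM_sym g))"

lemma class_map_class:
  assumes "g \<in> syms C" "CM_sym g"
  shows "class_map (sym_class C g) = sym_class C' (conj_sym \<sigma> g)"
proof -
  define h where "h = (SOME h. h \<in> sym_class C g \<and> CM_sym h)"
  have "h \<in> sym_class C g \<and> CM_sym h"
    unfolding h_def by (rule someI[of _ g]) (use assms sym_class_self in auto)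
  then have "(conj_sym \<sigma> g, conj_sym \<sigma> h) \<in> nat_iso C'" using conj_sym_nat_iso assms(2) by auto
  then show ?thesis unfolding class_map_def h_def[symmetric] using equiv_class_eq[OF equiv_nat_iso] by metis
qed

lemma conj_sym_inverse: "CM_sym g \<Longrightarrow> conj_sym \<sigma>' (conj_sym \<sigma> g) = g"
  using \<sigma>.map_mat_inv_into[OF CM_sym_algebraic] by (intro sym.equality ext) auto

lemma class_map_in_carrier:
  assumes "x \<in> carrier (zero_form_group C)" shows "class_map x \<in> carrier (zero_form_group C')"
  using assms
  by (rule CM_representative) (simp add: class_map_class sym_class_in_carrier conj_sym_in_syms)

lemma class_map_inverse:
  assumes "x \<in> carrier (zero_form_group C)"
  shows "conjugate_pair.class_map C \<sigma>' (class_map x) = x"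
proof -
  interpret swap: conjugate_pair C' C \<sigma>' by (rule swap)
  obtain g where g: "g \<in> syms C" "CM_sym g" "x = sym_class C g" using assms by (rule CM_representative)
  show ?thesis
    using g by (simp add: class_map_class swap.class_map_class conj_sym_in_syms CM_sym_conj_sym conj_sym_inverse)
qed

lemma bij_class_map: "bij_betw class_map (carrier (zero_form_group C)) (carrier (zero_form_group C'))"
proof -
  interpret swap: conjugate_pair C' C \<sigma>' by (rule swap)
  \<comment> \<open>Exchanging twice would return the inverse of \<open>\<sigma>'\<close>, a
    function tied to \<sigma> on algebraic numbers only. Writing \<open>y\<close> as an image, by
    surjectivity, reduces this side to the other one.\<close>
  have "class_map (swap.class_map y) = y" if y: "y \<in> carrier (zero_form_group C')" for y
  proof -
    obtain g' where g': "g' \<in> syms C'" "y = sym_class C' g'" using y by (rule carrier_zero_form_groupE)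
    obtain g where g: "g \<in> syms C" "CM_sym g" "(g', conj_sym \<sigma> g) \<in> nat_iso C'" using conj_sym_surj[OF g'(1)] by blast
    then have "y = class_map (sym_class C g)"
      using g' equiv_class_eq[OF equiv_nat_iso g(3)] by (simp add: class_map_class)
    then show ?thesis using class_map_inverse[OF sym_class_in_carrier[OF g(1)]] by simp
  qed
  then show ?thesis
    using class_map_inverse class_map_in_carrier swap.class_map_in_carrier
    by (intro bij_betw_byWitness[where f' = swap.class_map]) auto
qed

lemma class_map_mult:
  assumes "x \<in> carrier (zero_form_group C)" "y \<in> carrier (zero_form_group C)"
  shows "class_map (x \<otimes>\<^bsub>zero_form_group C\<^esub> y) = class_map x \<otimes>\<^bsub>zero_form_group C'\<^esub> class_map y"
proof -
  obtain g where g: "g \<in> syms C" "CM_sym g" "x = sym_class C g" using assms(1) by (rule CM_representative)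
  obtain h where h: "h \<in> syms C" "CM_sym h" "y = sym_class C h" using assms(2) by (rule CM_representative)
  show ?thesis
    using g h by (simp add: mult_sym_class[OF _ _ R] mult_sym_class[OF _ _ R'] class_map_class sym_comp_in_syms[OF _ _ R]
        CM_sym_comp conj_sym_comp conj_sym_in_syms)
qed

lemma CM_sym_id: "CM_sym (sym_id C)"
  using CM.elements_mat_one by (simp add: CM_sym_def sym_id_def)

lemma conj_sym_id: "conj_sym \<sigma> (sym_id C) = sym_id C'"
  by (intro sym.equality ext) (auto simp: sym_id_def \<sigma>.map_mat_one)

lemma class_map_one: "class_map \<one>\<^bsub>zero_form_group C\<^esub> = \<one>\<^bsub>zero_form_group C'\<^esub>"
  by (simp add: one_zero_form_group class_map_class sym_id_in_syms[OF R] CM_sym_id conj_sym_id)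

lemma one_form_group_eq: "one_form_group C' = one_form_group C"
  by (simp add: one_form_group_def)

lemma perm_action_class_map:
  assumes "x \<in> carrier (zero_form_group C)"
  shows "perm_action C' (class_map x) = perm_action C x"
proof -
  obtain g where g: "g \<in> syms C" "CM_sym g" "x = sym_class C g" using assms by (rule CM_representative)
  show ?thesis
    using g by (simp add: class_map_class perm_action_class conj_sym_in_syms one_form_group_eq)
qed

end

section \<open>The Postnikov class\<close>

lemma smat_sym_comp_gauge:
  assumes g: "g \<in> syms C" "g' \<in> syms C" and h: "h \<in> syms C" "h' \<in> syms C"
    and eq: "anti g = anti g'" "sperm g = sperm g'"
    and \<gamma>: "\<And>a b c. smat g' a b c = gauge \<gamma> a b c \<cdot>\<^sub>m smat g a b c"
    and \<delta>: "\<And>a b c. smat h' a b c = gauge \<delta> a b c \<cdot>\<^sub>m smat h a b c"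
  shows "smat (sym_comp g' h') a b c =
    gauge (\<lambda>a. \<gamma> a * Kc g (\<delta> (inv_into UNIV (sperm g) a))) a b c \<cdot>\<^sub>m smat (sym_comp g h) a b c"
proof -
  let ?p = "inv_into UNIV (sperm g)" and ?n = "fus C a b c"
  have c: "map_mat (Kc g) (smat h (?p a) (?p b) (?p c)) \<in> carrier_mat ?n ?n" "smat g a b c \<in> carrier_mat ?n ?n"
    using symsD(5)[OF h(1), of "?p a" "?p b" "?p c"] symsD(5)[OF g(1)] by (auto simp: fus_sperm_inverse[OF g(1)])
  have "smat (sym_comp g' h') a b c = (Kc g (gauge \<delta> (?p a) (?p b) (?p c)) * gauge \<gamma> a b c) \<cdot>\<^sub>m smat (sym_comp g h) a b c"
    using c by (simp add: sym_comp_def \<gamma> \<delta> Kc_cong[OF eq(1)[symmetric]] eq(2)[symmetric] map_mat_smult smult_smult_mat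
        mult_smult_distrib[of _ ?n ?n _ ?n] mult_smult_assoc_mat[of _ ?n ?n _ ?n] mult.commute)
  then show ?thesis by (simp add: gauge_simps gauge_def Kc_def mult.commute)
qed

text \<open>The equation for the phases says that the representative \<open>k\<close> of a product
  equals the composite up to a gauge factor. The second form is free of inverses, which makes it
  easy to rescale and to conjugate.\<close>

lemma phases_equation_iff:
  assumes g: "g \<in> syms C" and h: "h \<in> syms C" and k: "k \<in> syms C"
  shows "(gauge \<gamma> a b c) \<cdot>\<^sub>m 1\<^sub>m (fus C a b c) =
      mat_inv (smat g a b c) *
      map_mat (Kc g) (mat_inv (smat h (inv_into UNIV (sperm g) a) (inv_into UNIV (sperm g) b) (inv_into UNIV (sperm g) c))) *
      smat k a b c \<longleftrightarrow>
    smat k a b c = gauge \<gamma> a b c \<cdot>\<^sub>m smat (sym_comp g h) a b c"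
proof -
  let ?p = "inv_into UNIV (sperm g)" and ?n = "fus C a b c"
  let ?H = "map_mat (Kc g) (smat h (?p a) (?p b) (?p c))" and ?G = "smat g a b c" and ?K = "smat k a b c" and ?x = "gauge \<gamma> a b c"
  have uh: "unitary_mat ?n (smat h (?p a) (?p b) (?p c))"
    using symsD(1)[OF h, of "?p a" "?p b" "?p c"] by (simp add: fus_sperm_inverse[OF g])
  note G = unitary_matD[OF symsD(1)[OF g, of a b c]] and H = unitary_matD[OF unitary_map_mat_Kc[OF uh, of g]]
  have K: "?K \<in> carrier_mat ?n ?n" by (rule symsD(5)[OF k])
  note assoc = assoc_mult_mat[of _ ?n ?n _ ?n _ ?n] mult_carrier_mat[of _ ?n ?n _ ?n]
  have inv: "mat_inv ?G = mat_adjoint ?G" "map_mat (Kc g) (mat_inv (smat h (?p a) (?p b) (?p c))) = mat_adjoint ?H"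
    using G(4) unitary_matD(4)[OF uh] by (simp_all add: map_mat_Kc_adjoint)
  have l: "(?H * ?G) * ((mat_adjoint ?G * mat_adjoint ?H) * ?K) = ?K"
  proof -
    have "(?H * ?G) * ((mat_adjoint ?G * mat_adjoint ?H) * ?K) = ?H * ((?G * mat_adjoint ?G) * (mat_adjoint ?H * ?K))"
      using G(1) H(1) K by (simp add: assoc)
    also have "\<dots> = (?H * mat_adjoint ?H) * ?K"
      using G(1,3) H(1) K assoc_mult_mat[of ?H ?n ?n "mat_adjoint ?H" ?n ?K ?n]
      by (simp add: left_mult_one_mat[of _ ?n ?n] mult_carrier_mat[of _ ?n ?n _ ?n])
    also have "\<dots> = ?K" using H(3) K by (simp add: left_mult_one_mat[of _ ?n ?n])
    finally show ?thesis .
  qed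
  have r: "(mat_adjoint ?G * mat_adjoint ?H) * (?H * ?G) = 1\<^sub>m ?n"
  proof -
    have "(mat_adjoint ?G * mat_adjoint ?H) * (?H * ?G) = mat_adjoint ?G * ((mat_adjoint ?H * ?H) * ?G)"
      using G(1) H(1) by (simp add: assoc)
    also have "\<dots> = 1\<^sub>m ?n" using G H by (simp add: left_mult_one_mat[of _ ?n ?n])
    finally show ?thesis .
  qed
  have HG: "?H * ?G \<in> carrier_mat ?n ?n" "mat_adjoint ?G * mat_adjoint ?H \<in> carrier_mat ?n ?n"
    using G(1) H(1) by (simp_all add: assoc)
  have comp: "smat (sym_comp g h) a b c = ?H * ?G" by (simp add: sym_comp_def)
  show ?thesis
    unfolding inv comp
  proof
    assume "?x \<cdot>\<^sub>m 1\<^sub>m ?n = mat_adjoint ?G * mat_adjoint ?H * ?K"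
    then have "?K = (?H * ?G) * (?x \<cdot>\<^sub>m 1\<^sub>m ?n)" using l by simp
    then show "?K = ?x \<cdot>\<^sub>m (?H * ?G)"
      using HG(1) by (simp add: mult_smult_distrib[OF HG(1), of _ ?n] right_mult_one_mat[OF HG(1)])
  next
    assume "?K = ?x \<cdot>\<^sub>m (?H * ?G)"
    then show "?x \<cdot>\<^sub>m 1\<^sub>m ?n = mat_adjoint ?G * mat_adjoint ?H * ?K"
      by (simp add: mult_smult_distrib[OF HG(2) HG(1)] r)
  qed
qed

lemma smat_eq_zero_dim:
  assumes "A \<in> carrier_mat n n" "B \<in> carrier_mat n n" "n = 0" shows "A = B"
  using assms by (intro eq_matI) auto

text \<open>The condition on nonzero fusion spaces extends to all of them, because matrices on empty
  spaces are equal.\<close>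

lemma normalized_phases_iff:
  assumes s: "\<And>x. x \<in> carrier (zero_form_group C) \<Longrightarrow> s x \<in> syms C" and R: "R_dims C"
  shows "normalized_phases C s \<gamma> \<longleftrightarrow> (\<forall>g\<in>carrier (zero_form_group C). \<forall>h\<in>carrier (zero_form_group C).
     \<gamma> (unt C) g h = 1 \<and>
     (\<forall>a. cmod (\<gamma> a g h) = 1 \<and> \<gamma> a \<one>\<^bsub>zero_form_group C\<^esub> h = 1 \<and> \<gamma> a g \<one>\<^bsub>zero_form_group C\<^esub> = 1) \<and>
     (\<forall>a b c. smat (s (g \<otimes>\<^bsub>zero_form_group C\<^esub> h)) a b c =
        gauge (\<lambda>a. \<gamma> a g h) a b c \<cdot>\<^sub>m smat (sym_comp (s g) (s h)) a b c))"
proof -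
  let ?G = "zero_form_group C"
  interpret G: monoid ?G by (rule zero_form_group_monoid[OF R])
  have "(\<forall>a b c. fus C a b c \<noteq> 0 \<longrightarrow>
      (\<gamma> a g h * \<gamma> b g h / \<gamma> c g h) \<cdot>\<^sub>m 1\<^sub>m (fus C a b c) =
      mat_inv (smat (s g) a b c) *
      map_mat (Kc (s g)) (mat_inv (smat (s h) (inv_into UNIV (sperm (s g)) a) (inv_into UNIV (sperm (s g)) b) (inv_into UNIV (sperm (s g)) c))) *
      smat (s (g \<otimes>\<^bsub>?G\<^esub> h)) a b c) \<longleftrightarrow>
    (\<forall>a b c. smat (s (g \<otimes>\<^bsub>?G\<^esub> h)) a b c = gauge (\<lambda>a. \<gamma> a g h) a b c \<cdot>\<^sub>m smat (sym_comp (s g) (s h)) a b c)"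
    if "g \<in> carrier ?G" "h \<in> carrier ?G" for g h
  proof -
    note gh = s[OF that(1)] s[OF that(2)] s[OF G.m_closed[OF that]]
    have zero: "smat (s (g \<otimes>\<^bsub>?G\<^esub> h)) a b c = gauge (\<lambda>a. \<gamma> a g h) a b c \<cdot>\<^sub>m smat (sym_comp (s g) (s h)) a b c"
      if "fus C a b c = 0" for a b c
      using symsD(5)[OF gh(3), of a b c] symsD(5)[OF sym_comp_in_syms[OF gh(1,2) R], of a b c] that
      by (intro smat_eq_zero_dim[of _ "fus C a b c"]) (rule smult_carrier_mat | assumption)+
    have ge: "\<gamma> a g h * \<gamma> b g h / \<gamma> c g h = gauge (\<lambda>a. \<gamma> a g h) a b c" for a b c
      by (simp add: gauge_def)
    show ?thesis
      unfolding ge phases_equation_iff[OF gh] using zero by blast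
  qed
  then show ?thesis unfolding normalized_phases_def Let_def by auto
qed


lemma Kc_simps [simp]:
  "Kc g (x * y) = Kc g x * Kc g y" "Kc g (x / y) = Kc g x / Kc g y" "Kc g x = 0 \<longleftrightarrow> x = 0" "Kc g 1 = 1"
  by (simp_all add: Kc_def)

text \<open>The coboundary of a coboundary is trivial, written out for the change of \<Omega> under
  rescaled representatives. \<open>A\<close>, \<open>B\<close>, \<open>D\<close> stand for the
  rescalings of h, k, hk after the appropriate conjugations and relabellings, \<open>E\<close>,
  \<open>H\<close>, \<open>F\<close> for those of g, gh, ghk.\<close>

lemma coboundary_cancel:
  fixes A B D E F H x y z w :: complex
  assumes "A \<noteq> 0" "B \<noteq> 0" "D \<noteq> 0" "E \<noteq> 0" "F \<noteq> 0" "H \<noteq> 0"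
  shows "(x * (A * B / D)) * (y * (E * D / F)) / ((z * (H * B / F)) * (w * (E * A / H))) = x * y / (z * w)"
proof -
  have "(x * (A * B / D)) * (y * (E * D / F)) = (x * y) * (A * B * E / F)" using assms by (simp add: field_simps)
  moreover have "(z * (H * B / F)) * (w * (E * A / H)) = (z * w) * (A * B * E / F)" using assms by (simp add: field_simps)
  moreover have c: "A * B * E / F \<noteq> 0" using assms by simp
  ultimately show ?thesis by (simp only: nonzero_mult_divide_mult_cancel_right[OF c])
qed

definition normalized_sym :: "'a mtc_data \<Rightarrow> 'a sym \<Rightarrow> bool" where
  "normalized_sym C g \<longleftrightarrow> (\<forall>a c. smat g (unt C) a c = 1\<^sub>m (fus C (unt C) a c) \<and> smat g a (unt C) c = 1\<^sub>m (fus C a (unt C) c))"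

lemma normalized_section_iff:
  "normalized_section C s \<longleftrightarrow> (\<forall>x\<in>carrier (zero_form_group C). s x \<in> x \<and> normalized_sym C (s x)) \<and>
     s \<one>\<^bsub>zero_form_group C\<^esub> = sym_id C"
  by (simp add: normalized_section_def normalized_sym_def)

lemma normalized_sym_id: "normalized_sym C (sym_id C)"
  by (simp add: normalized_sym_def sym_id_def)

lemma section_sym_comp:
  assumes s: "\<And>x. x \<in> carrier (zero_form_group C) \<Longrightarrow> s x \<in> x" and R: "R_dims C"
    and gh: "g \<in> carrier (zero_form_group C)" "h \<in> carrier (zero_form_group C)"
  shows "anti (s (g \<otimes>\<^bsub>zero_form_group C\<^esub> h)) = anti (sym_comp (s g) (s h))"
    "sperm (s (g \<otimes>\<^bsub>zero_form_group C\<^esub> h)) = sperm (s g) \<circ> sperm (s h)"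
proof -
  interpret G: monoid "zero_form_group C" by (rule zero_form_group_monoid[OF R])
  note g = zero_form_group_memD[OF gh(1) s[OF gh(1)]] and h = zero_form_group_memD[OF gh(2) s[OF gh(2)]]
  have "g \<otimes>\<^bsub>zero_form_group C\<^esub> h = sym_class C (sym_comp (s g) (s h))"
    using mult_sym_class[OF g(1) h(1) R] g(2) h(2) by simp
  then have "(sym_comp (s g) (s h), s (g \<otimes>\<^bsub>zero_form_group C\<^esub> h)) \<in> nat_iso C"
    using s[OF G.m_closed[OF gh]] by auto
  then show "anti (s (g \<otimes>\<^bsub>zero_form_group C\<^esub> h)) = anti (sym_comp (s g) (s h))"
    "sperm (s (g \<otimes>\<^bsub>zero_form_group C\<^esub> h)) = sperm (s g) \<circ> sperm (s h)"
    by (simp_all add: nat_iso_iff sym_comp_def)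
qed

section \<open>CM sections and their conjugates\<close>

context conjugate_pair
begin

lemma fus_unit: "fus C (unt C) a b = of_bool (a = b)" "fus C a (unt C) b = of_bool (a = b)"
  using fusion by (simp_all add: fusion_rules_def)

text \<open>On spaces with a unit leg, a CM member of the class differs from the normalized one by
  the phase of the unit alone, which is itself a matrix entry of the CM member. Dividing by it
  normalizes and stays within CM numbers.\<close>

lemma normalized_CM_representative:
  assumes x: "x \<in> carrier (zero_form_group C)" and g': "g' \<in> x" "normalized_sym C g'"
  shows "\<exists>g\<in>x. CM_sym g \<and> normalized_sym C g"
proof -
  obtain g where g: "g \<in> x" "CM_sym g" using representatives[OF x] by blast
  note gs = zero_form_group_memD[OF x g(1)] and gs' = zero_form_group_memD[OF x g'(1)]
  have "(g', g) \<in> nat_iso C" using g(1) gs'(2) by auto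
  then obtain \<delta> where \<delta>: "\<And>a. cmod (\<delta> a) = 1" "\<And>a b c. smat g a b c = gauge \<delta> a b c \<cdot>\<^sub>m smat g' a b c"
    by (auto simp: nat_iso_iff)
  have nz: "\<delta> a \<noteq> 0" for a using \<delta>(1)[of a] by auto
  let ?u = "unt C"
  have "smat g ?u ?u ?u $$ (0, 0) = \<delta> ?u"
    using g'(2) nz by (simp add: \<delta>(2) normalized_sym_def fus_unit gauge_def)
  moreover have "smat g ?u ?u ?u $$ (0, 0) \<in> CM_numbers"
    using g(2) symsD(5)[OF gs(1), of ?u ?u ?u] elements_matI[of 0 "smat g ?u ?u ?u" 0]
    by (auto simp: CM_sym_def fus_unit)
  ultimately have u: "inverse (\<delta> ?u) \<in> CM_numbers" using CM.inverse_mem by simp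
  \<comment> \<open>A constant rescaling c has gauge factor c c / c = c, so it multiplies all
    matrices alike.\<close>
  define h where "h = g\<lparr>smat := \<lambda>a b c. gauge (\<lambda>_. inverse (\<delta> ?u)) a b c \<cdot>\<^sub>m smat g a b c\<rparr>"
  have gauge_u: "gauge (\<lambda>_. inverse (\<delta> ?u)) a b c = inverse (\<delta> ?u)" for a b c
    using nz by (simp add: gauge_def)
  have cm: "cmod (inverse (\<delta> ?u)) = 1" using \<delta>(1) by (simp add: norm_inverse)
  have "h \<in> syms C" unfolding h_def by (rule gauge_in_syms[OF gs(1) cm R])
  then have "(g, h) \<in> nat_iso C"
    unfolding nat_iso_iff using gs(1) cm by (intro conjI exI[of _ "\<lambda>_. inverse (\<delta> ?u)"]) (auto simp: h_def)
  then have "h \<in> x" using gs(2) by auto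
  moreover have "CM_sym h"
    using g(2) CM.mult_mem[OF u] by (fastforce simp: CM_sym_def h_def gauge_u elements_mat_eq)
  moreover have "normalized_sym C h"
  proof -
    have "smat h ?u a c = 1\<^sub>m (fus C ?u a c) \<and> smat h a ?u c = 1\<^sub>m (fus C a ?u c)" for a c
    proof (cases "a = c")
      case True
      have "smat h ?u a c = (inverse (\<delta> ?u) * gauge \<delta> ?u a c) \<cdot>\<^sub>m 1\<^sub>m (fus C ?u a c)"
        "smat h a ?u c = (inverse (\<delta> ?u) * gauge \<delta> a ?u c) \<cdot>\<^sub>m 1\<^sub>m (fus C a ?u c)"
        using g'(2) by (simp_all add: h_def gauge_u \<delta>(2) smult_smult_mat normalized_sym_def)
      then show ?thesis using nz True by (simp add: gauge_def smult_one_mat)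
    next
      case False
      then show ?thesis
        using symsD(5)[OF \<open>h \<in> syms C\<close>, of ?u a c] symsD(5)[OF \<open>h \<in> syms C\<close>, of a ?u c]
        by (auto simp: fus_unit intro!: smat_eq_zero_dim[of _ 0])
    qed
    then show ?thesis by (simp add: normalized_sym_def)
  qed
  ultimately show ?thesis by blast
qed

text \<open>The section and phases behind a given cocycle are arbitrary, so \<sigma> cannot be
  applied to them. Passing to CM representatives changes the phases by a coboundary and leaves
  \<Omega> as it is; the new phases compare CM symmetries and are therefore CM numbers.\<close>

lemma CM_section:
  assumes s: "normalized_section C s" and \<gamma>: "normalized_phases C s \<gamma>"
  obtains s0 \<gamma>0 where "normalized_section C s0" "normalized_phases C s0 \<gamma>0"
    "\<And>x. x \<in> carrier (zero_form_group C) \<Longrightarrow> CM_sym (s0 x)"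
    "\<And>a g h. g \<in> carrier (zero_form_group C) \<Longrightarrow> h \<in> carrier (zero_form_group C) \<Longrightarrow> \<gamma>0 a g h \<in> CM_numbers"
    "\<And>a g h k. g \<in> carrier (zero_form_group C) \<Longrightarrow> h \<in> carrier (zero_form_group C) \<Longrightarrow> k \<in> carrier (zero_form_group C) \<Longrightarrow>
      Omega C s0 \<gamma>0 a g h k = Omega C s \<gamma> a g h k"
proof -
  let ?G = "zero_form_group C"
  interpret G: monoid ?G by (rule zero_form_group_monoid[OF R])
  have s_mem: "s x \<in> x" "normalized_sym C (s x)" if "x \<in> carrier ?G" for x
    using s that by (auto simp: normalized_section_iff)
  have s_one: "s \<one>\<^bsub>?G\<^esub> = sym_id C" using s by (simp add: normalized_section_iff)
  have id_one: "sym_id C \<in> \<one>\<^bsub>?G\<^esub>" using s_mem(1)[OF G.one_closed] s_one by simp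
  have "\<exists>g\<in>x. CM_sym g \<and> normalized_sym C g \<and> (x = \<one>\<^bsub>?G\<^esub> \<longrightarrow> g = sym_id C)" if x: "x \<in> carrier ?G" for x
  proof (cases "x = \<one>\<^bsub>?G\<^esub>")
    case True
    then show ?thesis using id_one CM_sym_id normalized_sym_id by blast
  next
    case False
    then show ?thesis using normalized_CM_representative[OF x s_mem[OF x]] by blast
  qed
  then obtain s0 where s0: "\<And>x. x \<in> carrier ?G \<Longrightarrow> s0 x \<in> x" "\<And>x. x \<in> carrier ?G \<Longrightarrow> CM_sym (s0 x)"
    "\<And>x. x \<in> carrier ?G \<Longrightarrow> normalized_sym C (s0 x)" "s0 \<one>\<^bsub>?G\<^esub> = sym_id C"
    using G.one_closed by metis
  have syms: "s x \<in> syms C" "s0 x \<in> syms C" if "x \<in> carrier ?G" for x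
    using zero_form_group_memD(1)[OF that] s_mem(1)[OF that] s0(1)[OF that] by auto
  have "\<exists>\<delta>. (\<forall>a. cmod (\<delta> a) = 1) \<and> (\<forall>a b c. smat (s x) a b c = gauge \<delta> a b c \<cdot>\<^sub>m smat (s0 x) a b c) \<and>
      anti (s0 x) = anti (s x) \<and> sperm (s0 x) = sperm (s x) \<and> (x = \<one>\<^bsub>?G\<^esub> \<longrightarrow> \<delta> = (\<lambda>_. 1))" if x: "x \<in> carrier ?G" for x
  proof (cases "x = \<one>\<^bsub>?G\<^esub>")
    case True
    then show ?thesis by (intro exI[of _ "\<lambda>_. 1"]) (simp add: s_one s0(4) gauge_simps smult_one_mat)
  next
    case False
    have "(s0 x, s x) \<in> nat_iso C" using s_mem(1)[OF x] zero_form_group_memD(2)[OF x s0(1)[OF x]] by auto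
    then show ?thesis using False unfolding nat_iso_iff by blast
  qed
  then have "\<forall>x\<in>carrier ?G. \<exists>\<delta>. (\<forall>a. cmod (\<delta> a) = 1) \<and> (\<forall>a b c. smat (s x) a b c = gauge \<delta> a b c \<cdot>\<^sub>m smat (s0 x) a b c) \<and>
      anti (s0 x) = anti (s x) \<and> sperm (s0 x) = sperm (s x) \<and> (x = \<one>\<^bsub>?G\<^esub> \<longrightarrow> \<delta> = (\<lambda>_. 1))"
    by (rule ballI)
  from bchoice[OF this] obtain \<delta> where *: "\<forall>x\<in>carrier ?G. (\<forall>a. cmod (\<delta> x a) = 1) \<and>
      (\<forall>a b c. smat (s x) a b c = gauge (\<delta> x) a b c \<cdot>\<^sub>m smat (s0 x) a b c) \<and>
      anti (s0 x) = anti (s x) \<and> sperm (s0 x) = sperm (s x) \<and> (x = \<one>\<^bsub>?G\<^esub> \<longrightarrow> \<delta> x = (\<lambda>_. 1))" ..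
  have \<delta>: "cmod (\<delta> x a) = 1" "smat (s x) a b c = gauge (\<delta> x) a b c \<cdot>\<^sub>m smat (s0 x) a b c"
    and same: "anti (s0 x) = anti (s x)" "sperm (s0 x) = sperm (s x)" if "x \<in> carrier ?G" for x a b c
    using bspec[OF * that] by simp_all
  have \<delta>_one: "\<delta> \<one>\<^bsub>?G\<^esub> = (\<lambda>_. 1)" using bspec[OF * G.one_closed] by simp
  have \<delta>_nz: "\<delta> x a \<noteq> 0" if "x \<in> carrier ?G" for x a using \<delta>(1)[OF that, of a] by auto
  have same_Kc: "Kc (s0 x) = Kc (s x)" if "x \<in> carrier ?G" for x by (rule Kc_cong[OF same(1)[OF that]])
  have \<delta>_unit: "\<delta> x (unt C) = 1" if x: "x \<in> carrier ?G" for x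
    using \<delta>(2)[OF x, of "unt C" "unt C" "unt C"] s_mem(2)[OF x] s0(3)[OF x] \<delta>_nz[OF x]
    by (auto simp: normalized_sym_def fus_unit gauge_def dest!: arg_cong[of _ _ "\<lambda>A. A $$ (0, 0)"])
  let ?p = "\<lambda>x. inv_into UNIV (sperm (s x))"
  \<comment> \<open>A permutation preserving the fusion rules fixes the unit, which keeps the new
    phases normalized there.\<close>
  have p_unit: "?p x (unt C) = unt C" if x: "x \<in> carrier ?G" for x
  proof -
    have "fus C (?p x (unt C)) (unt C) (unt C) = fus C (unt C) (sperm (s x) (unt C)) (sperm (s x) (unt C))"
      using fus_sperm_inverse[OF syms(1)[OF x], of "unt C" "sperm (s x) (unt C)" "sperm (s x) (unt C)"]
      by (simp add: sperm_inverse[OF syms(1)[OF x]])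
    then show ?thesis by (simp add: fus_unit of_bool_def split: if_splits)
  qed
  \<comment> \<open>Obtained by expressing \<open>s\<close> through \<open>s0\<close> and \<delta>
    in the equation for \<gamma> and solving for the factor between \<open>s0\<close> of the product
    and the composite of \<open>s0 g\<close> and \<open>s0 h\<close>.\<close>
  define \<gamma>0 where "\<gamma>0 = (\<lambda>a g h. \<gamma> a g h * (\<delta> g a * Kc (s g) (\<delta> h (?p g a)) / \<delta> (g \<otimes>\<^bsub>?G\<^esub> h) a))"
  have \<gamma>D: "\<gamma> (unt C) g h = 1" "cmod (\<gamma> a g h) = 1" "\<gamma> a \<one>\<^bsub>?G\<^esub> h = 1" "\<gamma> a g \<one>\<^bsub>?G\<^esub> = 1"
    "smat (s (g \<otimes>\<^bsub>?G\<^esub> h)) a b c = gauge (\<lambda>a. \<gamma> a g h) a b c \<cdot>\<^sub>m smat (sym_comp (s g) (s h)) a b c"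
    if "g \<in> carrier ?G" "h \<in> carrier ?G" for g h a b c
    using bspec[OF bspec[OF iffD1[OF normalized_phases_iff[where s = s, OF syms(1) R] \<gamma>] that(1)] that(2)] by simp_all
  have \<gamma>0_cmod: "cmod (\<gamma>0 a g h) = 1" if "g \<in> carrier ?G" "h \<in> carrier ?G" for a g h
    using that \<gamma>D(2) \<delta>(1) by (simp add: \<gamma>0_def norm_mult norm_divide)
  have \<gamma>0_eq: "smat (s0 (g \<otimes>\<^bsub>?G\<^esub> h)) a b c = gauge (\<lambda>a. \<gamma>0 a g h) a b c \<cdot>\<^sub>m smat (sym_comp (s0 g) (s0 h)) a b c"
    if gh: "g \<in> carrier ?G" "h \<in> carrier ?G" for a b c g h
  proof -
    have ghc: "g \<otimes>\<^bsub>?G\<^esub> h \<in> carrier ?G" using gh by simp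
    have nz: "gauge (\<delta> (g \<otimes>\<^bsub>?G\<^esub> h)) a b c \<noteq> 0" using \<delta>_nz[OF ghc] by (simp add: gauge_def)
    have "gauge (\<delta> (g \<otimes>\<^bsub>?G\<^esub> h)) a b c \<cdot>\<^sub>m smat (s0 (g \<otimes>\<^bsub>?G\<^esub> h)) a b c =
      gauge (\<lambda>a. \<gamma> a g h) a b c \<cdot>\<^sub>m smat (sym_comp (s g) (s h)) a b c"
      using \<gamma>D(5)[OF gh] \<delta>(2)[OF ghc] by simp
    also have "smat (sym_comp (s g) (s h)) a b c =
      gauge (\<lambda>a. \<delta> g a * Kc (s0 g) (\<delta> h (inv_into UNIV (sperm (s0 g)) a))) a b c \<cdot>\<^sub>m smat (sym_comp (s0 g) (s0 h)) a b c"
      using gh by (intro smat_sym_comp_gauge[of "s0 g" C] syms \<delta>(2) same)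
    finally have "inverse (gauge (\<delta> (g \<otimes>\<^bsub>?G\<^esub> h)) a b c) \<cdot>\<^sub>m (gauge (\<delta> (g \<otimes>\<^bsub>?G\<^esub> h)) a b c \<cdot>\<^sub>m smat (s0 (g \<otimes>\<^bsub>?G\<^esub> h)) a b c) =
      gauge (\<lambda>a. \<gamma>0 a g h) a b c \<cdot>\<^sub>m smat (sym_comp (s0 g) (s0 h)) a b c"
      using gh by (simp add: \<gamma>0_def gauge_simps smult_smult_mat same same_Kc field_simps)
    then show ?thesis using nz by (simp add: smult_smult_mat smult_one_mat)
  qed
  have sec: "normalized_section C s0" using s0 by (simp add: normalized_section_iff)
  have phases: "normalized_phases C s0 \<gamma>0"
  proof (rule normalized_phases_iff[THEN iffD2, OF _ R], rule syms(2), assumption, intro ballI conjI allI)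
    fix g h a b c assume gh: "g \<in> carrier ?G" "h \<in> carrier ?G"
    show "\<gamma>0 (unt C) g h = 1" using gh by (simp add: \<gamma>0_def \<gamma>D(1) \<delta>_unit p_unit)
    show "cmod (\<gamma>0 a g h) = 1" by (rule \<gamma>0_cmod[OF gh])
    show "\<gamma>0 a \<one>\<^bsub>?G\<^esub> h = 1"
      using gh \<delta>_nz[OF gh(2)] by (simp add: \<gamma>0_def \<gamma>D(3)[OF gh] \<delta>_one s_one) (simp add: sym_id_def)
    show "\<gamma>0 a g \<one>\<^bsub>?G\<^esub> = 1" using gh \<delta>_nz[OF gh(1)] by (simp add: \<gamma>0_def \<gamma>D(4)[OF gh] \<delta>_one)
    show "smat (s0 (g \<otimes>\<^bsub>?G\<^esub> h)) a b c = gauge (\<lambda>a. \<gamma>0 a g h) a b c \<cdot>\<^sub>m smat (sym_comp (s0 g) (s0 h)) a b c"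
      by (rule \<gamma>0_eq[OF gh])
  qed
  have \<gamma>0_CM: "\<gamma>0 a g h \<in> CM_numbers" if gh: "g \<in> carrier ?G" "h \<in> carrier ?G" for a g h
    using gh
    by (intro CM_nat_iso_gauge[of "sym_comp (s0 g) (s0 h)" "s0 (g \<otimes>\<^bsub>?G\<^esub> h)" "\<lambda>a. \<gamma>0 a g h"])
      (simp_all add: sym_comp_in_syms[OF syms(2) syms(2) R] CM_sym_comp syms s0 \<gamma>0_cmod \<gamma>0_eq)
  have Omega_eq: "Omega C s0 \<gamma>0 a g h k = Omega C s \<gamma> a g h k"
    if ghk: "g \<in> carrier ?G" "h \<in> carrier ?G" "k \<in> carrier ?G" for a g h k
  proof -
    have Kgh: "Kc (s (g \<otimes>\<^bsub>?G\<^esub> h)) x = Kc (s g) (Kc (s h) x)" for x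
      using section_sym_comp(1)[OF s_mem(1) R ghk(1,2)] Kc_cong[of "s (g \<otimes>\<^bsub>?G\<^esub> h)" "sym_comp (s g) (s h)"] by simp
    have pgh: "?p (g \<otimes>\<^bsub>?G\<^esub> h) x = ?p h (?p g x)" for x
      using section_sym_comp(2)[OF s_mem(1) R ghk(1,2)] inv_into_comp[OF symsD(2)[OF syms(1)[OF ghk(1)]] symsD(2)[OF syms(1)[OF ghk(2)]]]
      by simp
    have assoc: "g \<otimes>\<^bsub>?G\<^esub> h \<otimes>\<^bsub>?G\<^esub> k = g \<otimes>\<^bsub>?G\<^esub> (h \<otimes>\<^bsub>?G\<^esub> k)" using ghk by (rule G.m_assoc)
    show ?thesis
      unfolding Omega_def Let_def \<gamma>0_def Kc_simps Kgh pgh assoc same_Kc[OF ghk(1)] same(2)[OF ghk(1)]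
      by (rule coboundary_cancel) (use ghk \<delta>_nz in simp_all)
  qed
  show ?thesis
    by (rule that[of s0 \<gamma>0]) (simp_all add: sec phases s0(2) \<gamma>0_CM Omega_eq)
qed


lemma map_mat_smult_algebraic:
  assumes "x \<in> algebraic_numbers" "elements_mat A \<subseteq> algebraic_numbers"
  shows "map_mat \<sigma> (x \<cdot>\<^sub>m A) = \<sigma> x \<cdot>\<^sub>m map_mat \<sigma> A"
  using assms elements_matI[of _ A] by (intro eq_matI) (auto simp: \<sigma>.hom_mult subset_iff)

text \<open>Every ingredient of \<Omega> is now a CM number, where \<sigma> commutes with
  \<open>K^g\<close>; this lets \<sigma> pass through the twisted first factor.\<close>

lemma conj_section:
  assumes s: "normalized_section C s" and \<gamma>: "normalized_phases C s \<gamma>"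
    and CM: "\<And>x. x \<in> carrier (zero_form_group C) \<Longrightarrow> CM_sym (s x)"
      "\<And>a g h. g \<in> carrier (zero_form_group C) \<Longrightarrow> h \<in> carrier (zero_form_group C) \<Longrightarrow> \<gamma> a g h \<in> CM_numbers"
  obtains s' \<gamma>' where "normalized_section C' s'" "normalized_phases C' s' \<gamma>'"
    "\<And>a g h k. g \<in> carrier (zero_form_group C) \<Longrightarrow> h \<in> carrier (zero_form_group C) \<Longrightarrow> k \<in> carrier (zero_form_group C) \<Longrightarrow>
      Omega C' s' \<gamma>' a (class_map g) (class_map h) (class_map k) = \<sigma> (Omega C s \<gamma> a g h k)"
proof -
  let ?G = "zero_form_group C" and ?G' = "zero_form_group C'"
  interpret G: monoid ?G by (rule zero_form_group_monoid[OF R])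
  interpret G': monoid ?G' by (rule zero_form_group_monoid[OF R'])
  let ?i = "inv_into (carrier ?G) class_map"
  have i: "?i (class_map x) = x" if "x \<in> carrier ?G" for x
    using bij_betw_inv_into_left[OF bij_class_map that] .
  have surj: "\<exists>x\<in>carrier ?G. y = class_map x" if "y \<in> carrier ?G'" for y
    using that bij_class_map by (auto simp: bij_betw_def)
  have s_mem: "s x \<in> x" "normalized_sym C (s x)" if "x \<in> carrier ?G" for x
    using s that by (auto simp: normalized_section_iff)
  have syms: "s x \<in> syms C" "x = sym_class C (s x)" if "x \<in> carrier ?G" for x
    using zero_form_group_memD[OF that s_mem(1)[OF that]] by auto
  define s' where "s' = (\<lambda>y. conj_sym \<sigma> (s (?i y)))"
  define \<gamma>' where "\<gamma>' = (\<lambda>a x y. \<sigma> (\<gamma> a (?i x) (?i y)))"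
  have s'_eq: "s' (class_map x) = conj_sym \<sigma> (s x)" if "x \<in> carrier ?G" for x using that by (simp add: s'_def i)
  have \<gamma>'_eq: "\<gamma>' a (class_map g) (class_map h) = \<sigma> (\<gamma> a g h)" if "g \<in> carrier ?G" "h \<in> carrier ?G" for a g h
    using that by (simp add: \<gamma>'_def i)
  have s'_syms: "s' (class_map x) \<in> syms C'" if "x \<in> carrier ?G" for x
    using that by (simp add: s'_eq conj_sym_in_syms syms CM)
  have \<gamma>D: "\<gamma> (unt C) g h = 1" "cmod (\<gamma> a g h) = 1" "\<gamma> a \<one>\<^bsub>?G\<^esub> h = 1" "\<gamma> a g \<one>\<^bsub>?G\<^esub> = 1"
    "smat (s (g \<otimes>\<^bsub>?G\<^esub> h)) a b c = gauge (\<lambda>a. \<gamma> a g h) a b c \<cdot>\<^sub>m smat (sym_comp (s g) (s h)) a b c"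
    if "g \<in> carrier ?G" "h \<in> carrier ?G" for g h a b c
    using bspec[OF bspec[OF iffD1[OF normalized_phases_iff[where s = s, OF syms(1) R] \<gamma>] that(1)] that(2)] by simp_all
  have sec: "normalized_section C' s'"
    unfolding normalized_section_iff
  proof (intro conjI ballI)
    fix y assume "y \<in> carrier ?G'"
    then obtain x where x: "x \<in> carrier ?G" "y = class_map x" using surj by blast
    have "class_map x = sym_class C' (s' y)"
      using class_map_class[OF syms(1)[OF x(1)] CM(1)[OF x(1)]] syms(2)[OF x(1)] s'_eq[OF x(1)] x(2) by simp
    then show "s' y \<in> y" using sym_class_self[OF s'_syms[OF x(1)]] x(2) by simp
    show "normalized_sym C' (s' y)"
      using s_mem(2)[OF x(1)] by (simp add: normalized_sym_def x(2) s'_eq[OF x(1)] \<sigma>.map_mat_one)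
  next
    show "s' \<one>\<^bsub>?G'\<^esub> = sym_id C'"
      using s'_eq[OF G.one_closed] s by (simp add: class_map_one normalized_section_iff conj_sym_id)
  qed
  have phases: "normalized_phases C' s' \<gamma>'"
  proof (rule normalized_phases_iff[THEN iffD2, OF _ R'])
    show "s' y \<in> syms C'" if "y \<in> carrier ?G'" for y using surj[OF that] s'_syms by blast
    show "\<forall>g\<in>carrier ?G'. \<forall>h\<in>carrier ?G'. \<gamma>' (unt C') g h = 1 \<and>
     (\<forall>a. cmod (\<gamma>' a g h) = 1 \<and> \<gamma>' a \<one>\<^bsub>?G'\<^esub> h = 1 \<and> \<gamma>' a g \<one>\<^bsub>?G'\<^esub> = 1) \<and>
     (\<forall>a b c. smat (s' (g \<otimes>\<^bsub>?G'\<^esub> h)) a b c = gauge (\<lambda>a. \<gamma>' a g h) a b c \<cdot>\<^sub>m smat (sym_comp (s' g) (s' h)) a b c)"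
    proof (intro ballI conjI allI)
      fix x y a b c assume "x \<in> carrier ?G'" "y \<in> carrier ?G'"
      then obtain g h where gh: "g \<in> carrier ?G" "h \<in> carrier ?G" and xy: "x = class_map g" "y = class_map h"
        using surj by blast
      show "\<gamma>' (unt C') x y = 1" using gh by (simp add: xy \<gamma>'_eq \<gamma>D(1) \<sigma>.hom_one)
      show "cmod (\<gamma>' a x y) = 1" using gh by (simp add: xy \<gamma>'_eq cmod_embedding_CM[OF embedding] CM \<gamma>D(2))
      show "\<gamma>' a \<one>\<^bsub>?G'\<^esub> y = 1" "\<gamma>' a x \<one>\<^bsub>?G'\<^esub> = 1"
        using gh \<gamma>D(3,4)[OF gh] by (simp_all add: xy \<gamma>'_eq \<sigma>.hom_one flip: class_map_one)
      have comp: "CM_sym (sym_comp (s g) (s h))" using gh by (simp add: CM_sym_comp syms CM)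
      have "smat (s' (x \<otimes>\<^bsub>?G'\<^esub> y)) a b c = map_mat \<sigma> (smat (s (g \<otimes>\<^bsub>?G\<^esub> h)) a b c)"
        using gh by (simp add: xy s'_eq flip: class_map_mult)
      also have "\<dots> = gauge (\<lambda>a. \<sigma> (\<gamma> a g h)) a b c \<cdot>\<^sub>m map_mat \<sigma> (smat (sym_comp (s g) (s h)) a b c)"
        using gauge_embedding[of "\<lambda>a. \<gamma> a g h" a b c, OF CM(2)[OF gh]]
        by (simp add: \<gamma>D(5)[OF gh] map_mat_smult_algebraic CM_sym_algebraic[OF comp])
      also have "map_mat \<sigma> (smat (sym_comp (s g) (s h)) a b c) = smat (sym_comp (s' x) (s' y)) a b c"
        using arg_cong[OF conj_sym_comp[OF syms(1)[OF gh(1)] syms(1)[OF gh(2)] CM(1)[OF gh(1)] CM(1)[OF gh(2)]],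
            of "\<lambda>g. smat g a b c"]
        by (simp add: xy s'_eq[OF gh(1)] s'_eq[OF gh(2)])
      finally show "smat (s' (x \<otimes>\<^bsub>?G'\<^esub> y)) a b c = gauge (\<lambda>a. \<gamma>' a x y) a b c \<cdot>\<^sub>m smat (sym_comp (s' x) (s' y)) a b c"
        using gh by (simp add: xy \<gamma>'_eq)
    qed
  qed
  have Omega_eq: "Omega C' s' \<gamma>' a (class_map g) (class_map h) (class_map k) = \<sigma> (Omega C s \<gamma> a g h k)"
    if ghk: "g \<in> carrier ?G" "h \<in> carrier ?G" "k \<in> carrier ?G" for a g h k
  proof -
    have cl: "g \<otimes>\<^bsub>?G\<^esub> h \<in> carrier ?G" "h \<otimes>\<^bsub>?G\<^esub> k \<in> carrier ?G" using ghk by simp_all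
    let ?b = "inv_into UNIV (sperm (s g)) a"
    have alg: "\<gamma> x y z \<in> algebraic_numbers" "Kc (s g) (\<gamma> x y z) \<in> algebraic_numbers"
      "\<sigma> (Kc (s g) (\<gamma> x y z)) = Kc (s g) (\<sigma> (\<gamma> x y z))"
      if "y \<in> carrier ?G" "z \<in> carrier ?G" for x y z
      using CM(2)[OF that, of x] Kc_CM_numbers[OF CM(2)[OF that, of x], of "s g"] CM_numbers_algebraic
        Kc_embedding[OF embedding CM(2)[OF that, of x], of "s g"] by blast+
    have "Omega C' s' \<gamma>' a (class_map g) (class_map h) (class_map k) =
      Kc (s g) (\<sigma> (\<gamma> ?b h k)) * \<sigma> (\<gamma> a g (h \<otimes>\<^bsub>?G\<^esub> k)) / (\<sigma> (\<gamma> a (g \<otimes>\<^bsub>?G\<^esub> h) k) * \<sigma> (\<gamma> a g h))"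
      using ghk cl by (simp add: Omega_def Let_def s'_eq \<gamma>'_eq flip: class_map_mult)
    also have "\<dots> = \<sigma> (Omega C s \<gamma> a g h k)"
      using alg ghk cl by (simp add: Omega_def Let_def \<sigma>.hom_mult \<sigma>.hom_divide \<sigma>.mult_mem del: mem_Collect_eq)
    finally show ?thesis .
  qed
  show ?thesis by (rule that[of s' \<gamma>']) (simp_all add: sec phases Omega_eq)
qed

section \<open>Conjugation of quantum dimensions and braiding phases\<close>

lemma dual_fusion: "fus C a (dual C a) (unt C) = 1" "fus C (dual C a) a (unt C) = 1"
proof -
  obtain b where b: "\<And>c. fus C a c (unt C) = of_bool (c = b)"
    using fusion unfolding fusion_rules_def by metis
  then have "dual C a = b" unfolding dual_def by (intro the_equality) (auto simp: of_bool_def split: if_splits)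
  then show "fus C a (dual C a) (unt C) = 1" using b by simp
  then show "fus C (dual C a) a (unt C) = 1" using fusion unfolding fusion_rules_def by metis
qed

lemma qdim_conj: "qdim C' a = \<sigma> (qdim C a)" "qdim C a \<in> algebraic_numbers"
proof -
  have dual: "dual C' a = dual C a" by (simp add: dual_def)
  have idx: "(unt C, 0, 0) \<in> left_idx C a (dual C a) a a" "(unt C, 0, 0) \<in> right_idx C a (dual C a) a a"
    by (simp_all add: left_idx_def right_idx_def dual_fusion fus_unit)
  have mem: "F11 C a \<in> algebraic_numbers"
    unfolding F11_def using FR_entriesI(1)[OF idx] FR_algebraic by blast
  have "F11 C' a = \<sigma> (F11 C a)"
    using conj idx unfolding F11_def dual unt_eq conj_data_def by blast
  then show "qdim C' a = \<sigma> (qdim C a)" "qdim C a \<in> algebraic_numbers"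
    unfolding qdim_def piv_eq using \<sigma>.divide_mem[OF \<sigma>.of_int_mem mem] \<sigma>.hom_divide[OF \<sigma>.of_int_mem mem] by (simp_all add: \<sigma>.hom_of_int)
qed

text \<open>The total quantum dimension, a square root that \<open>\<sigma>\<close> need not respect, cancels.\<close>

lemma Smat_ratio_conj:
  "Smat C' a b * Smat C' (unt C') (unt C') / (Smat C' (unt C') b * Smat C' (unt C') a) =
    \<sigma> (Smat C a b * Smat C (unt C) (unt C) / (Smat C (unt C) b * Smat C (unt C) a))"
proof -
  define num where "num = (\<lambda>C (a :: 'a) b. \<Sum>c\<in>UNIV. qdim C c * (\<Sum>i<fus C b a c. (Rsym C a b c * Rsym C b a c) $$ (i, i)))"
  define dd where "dd = (\<lambda>C :: 'a mtc_data. \<Sum>c\<in>UNIV. (qdim C c)\<^sup>2)"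
  have S: "Smat D a b = num D a b / csqrt (dd D)" for D a b by (simp add: Smat_def num_def dd_def)
  \<comment> \<open>If the sum of squared dimensions vanishes, division by zero makes all entries of
    \<open>Smat\<close> and their quotient 0; hence the separate value.\<close>
  have ratio: "Smat D a b * Smat D u u / (Smat D u b * Smat D u a) =
    (if dd D = 0 then 0 else num D a b * num D u u / (num D u b * num D u a))" for D a b u
    by (simp add: S)
  have trace: "(Rsym C' a b c * Rsym C' b a c) $$ (i, i) = \<sigma> ((Rsym C a b c * Rsym C b a c) $$ (i, i)) \<and>
      (Rsym C a b c * Rsym C b a c) $$ (i, i) \<in> algebraic_numbers" if i: "i < fus C b a c" for a b c i
  proof -
    have Rc: "Rsym C a b c \<in> carrier_mat (fus C b a c) (fus C a b c)" "Rsym C b a c \<in> carrier_mat (fus C a b c) (fus C b a c)"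
      using R by (simp_all add: R_dims_def)
    have el: "elements_mat (Rsym C x y z) \<subseteq> algebraic_numbers" for x y z
      using FR_entriesI(2) FR_algebraic by (intro subsetI) (rule subsetD)
    have "Rsym C' a b c * Rsym C' b a c = map_mat \<sigma> (Rsym C a b c * Rsym C b a c)"
      using conj \<sigma>.map_mat_mult[OF Rc el el] by (simp add: conj_data_def)
    moreover have "(Rsym C a b c * Rsym C b a c) $$ (i, i) \<in> elements_mat (Rsym C a b c * Rsym C b a c)"
      using Rc i by (intro elements_matI) auto
    ultimately show ?thesis using \<sigma>.elements_mat_mult[OF Rc el el] Rc i by (auto simp del: index_mult_mat(1) mem_Collect_eq)
  qed
  have num: "num C' a b = \<sigma> (num C a b)" "num C a b \<in> algebraic_numbers" for a b
  proof -
    have inner: "(\<Sum>i<fus C b a c. (Rsym C' a b c * Rsym C' b a c) $$ (i, i)) = \<sigma> (\<Sum>i<fus C b a c. (Rsym C a b c * Rsym C b a c) $$ (i, i))"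
      "(\<Sum>i<fus C b a c. (Rsym C a b c * Rsym C b a c) $$ (i, i)) \<in> algebraic_numbers" for c
      using trace[of _ b a c] \<sigma>.hom_sum[of "{..<fus C b a c}" "\<lambda>i. (Rsym C a b c * Rsym C b a c) $$ (i, i)"]
        \<sigma>.sum_mem[of "{..<fus C b a c}" "\<lambda>i. (Rsym C a b c * Rsym C b a c) $$ (i, i)"]
      by (simp_all del: index_mult_mat(1) mem_Collect_eq)
    have mem: "qdim C c * (\<Sum>i<fus C b a c. (Rsym C a b c * Rsym C b a c) $$ (i, i)) \<in> algebraic_numbers" for c
      by (rule \<sigma>.mult_mem[OF qdim_conj(2) inner(2)])
    show "num C a b \<in> algebraic_numbers" unfolding num_def by (rule \<sigma>.sum_mem[OF mem])
    have "num C' a b = (\<Sum>c\<in>UNIV. \<sigma> (qdim C c * (\<Sum>i<fus C b a c. (Rsym C a b c * Rsym C b a c) $$ (i, i))))"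
      unfolding num_def fus_eq inner(1) qdim_conj(1) \<sigma>.hom_mult[OF qdim_conj(2) inner(2)] ..
    also have "\<dots> = \<sigma> (num C a b)" unfolding num_def by (rule \<sigma>.hom_sum[OF mem, symmetric])
    finally show "num C' a b = \<sigma> (num C a b)" .
  qed
  have "dd C' = \<sigma> (dd C)" "dd C \<in> algebraic_numbers"
    using \<sigma>.hom_sum[of UNIV "\<lambda>c. (qdim C c)\<^sup>2"] \<sigma>.sum_mem[of UNIV "\<lambda>c. (qdim C c)\<^sup>2"] \<sigma>.power_mem[OF qdim_conj(2)]
    by (simp_all add: dd_def qdim_conj(1) \<sigma>.hom_power[OF qdim_conj(2)] del: mem_Collect_eq)
  then have dd: "dd C' = 0 \<longleftrightarrow> dd C = 0" using \<sigma>.hom_eq_0_iff by simp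
  show ?thesis
    unfolding ratio dd unt_eq num(1) using num(2)
    by (simp add: \<sigma>.hom_zero \<sigma>.hom_mult \<sigma>.hom_divide \<sigma>.mult_mem del: mem_Collect_eq)
qed

section \<open>Transport of the Postnikov class\<close>

lemma transport_cocycle:
  assumes "\<beta> \<in> postnikov_cocycles C"
  shows "transport3 (zero_form_group C) (zero_form_group C') class_map id \<beta> \<in> postnikov_cocycles C'"
proof -
  let ?G = "zero_form_group C" and ?G' = "zero_form_group C'" and ?A = "one_form_group C"
  let ?t = "transport3 ?G ?G' class_map id \<beta>"
  interpret G: monoid ?G by (rule zero_form_group_monoid[OF R])
  obtain s \<gamma> where \<beta>: "\<beta> \<in> carrier (cochains3 ?G ?A)" and s: "normalized_section C s" "normalized_phases C s \<gamma>"
    and Om: "\<forall>g\<in>carrier ?G. \<forall>h\<in>carrier ?G. \<forall>k\<in>carrier ?G. \<forall>a.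
      Omega C s \<gamma> a g h k = Smat C a (\<beta> (g, h, k)) * Smat C (unt C) (unt C) / (Smat C (unt C) (\<beta> (g, h, k)) * Smat C (unt C) a)"
    using assms unfolding postnikov_cocycles_def Let_def mem_Collect_eq by (elim conjE exE)
  note eq = Om[rule_format]
  obtain s0 \<gamma>0 where s0: "normalized_section C s0" "normalized_phases C s0 \<gamma>0"
    "\<And>x. x \<in> carrier ?G \<Longrightarrow> CM_sym (s0 x)"
    "\<And>a g h. g \<in> carrier ?G \<Longrightarrow> h \<in> carrier ?G \<Longrightarrow> \<gamma>0 a g h \<in> CM_numbers"
    and eq0: "\<And>a g h k. g \<in> carrier ?G \<Longrightarrow> h \<in> carrier ?G \<Longrightarrow> k \<in> carrier ?G \<Longrightarrow>
      Omega C s0 \<gamma>0 a g h k = Omega C s \<gamma> a g h k"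
    by (rule CM_section[OF s]) (rule that)
  obtain s' \<gamma>' where s': "normalized_section C' s'" "normalized_phases C' s' \<gamma>'"
    and eq': "\<And>a g h k. g \<in> carrier ?G \<Longrightarrow> h \<in> carrier ?G \<Longrightarrow> k \<in> carrier ?G \<Longrightarrow>
      Omega C' s' \<gamma>' a (class_map g) (class_map h) (class_map k) = \<sigma> (Omega C s0 \<gamma>0 a g h k)"
    by (rule conj_section[OF s0(1,2)]; (erule s0(3) | erule (1) s0(4) | rule that))
  have "Omega C' s' \<gamma>' a x y z = Smat C' a (?t (x, y, z)) * Smat C' (unt C') (unt C') / (Smat C' (unt C') (?t (x, y, z)) * Smat C' (unt C') a)"
    if xyz: "x \<in> carrier ?G'" "y \<in> carrier ?G'" "z \<in> carrier ?G'" for a x y z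
  proof -
    have surj: "\<exists>g\<in>carrier ?G. w = class_map g" if "w \<in> carrier ?G'" for w
      using that bij_class_map by (auto simp: bij_betw_def)
    obtain g where g: "g \<in> carrier ?G" "x = class_map g" using surj[OF xyz(1)] ..
    obtain h where h: "h \<in> carrier ?G" "y = class_map h" using surj[OF xyz(2)] ..
    obtain k where k: "k \<in> carrier ?G" "z = class_map k" using surj[OF xyz(3)] ..
    note ghk = g(1) h(1) k(1) g(2) h(2) k(2)
    have "?t (x, y, z) = \<beta> (g, h, k)"
      using ghk xyz bij_betw_inv_into_left[OF bij_class_map] by (simp add: transport3_apply)
    then show ?thesis
      using ghk eq'[OF ghk(1-3)] eq0[OF ghk(1-3)] eq[OF ghk(1-3)] Smat_ratio_conj by simp
  qed
  moreover have "?t \<in> carrier (cochains3 ?G' ?A)"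
    by (rule transport3_cochains3[OF bij_class_map class_map_mult _ _ \<beta>]) (simp_all add: perm_action_class_map)
  ultimately show ?thesis
    using s' unfolding postnikov_cocycles_def Let_def one_form_group_eq by blast
qed

text \<open>As the class is encoded by a union of cosets meeting \<open>postnikov_cocycles\<close>,
  it suffices that transport maps the coset of \<beta> into one coset and the cocycle in it to a
  cocycle of \<open>C'\<close>.\<close>

lemma transport_postnikov:
  assumes "\<beta> \<in> postnikov_class C"
  shows "transport3 (zero_form_group C) (zero_form_group C') class_map id \<beta> \<in> postnikov_class C'"
proof -
  let ?G = "zero_form_group C" and ?G' = "zero_form_group C'" and ?A = "one_form_group C"
  let ?t = "transport3 ?G ?G' class_map id"
  interpret G: monoid ?G by (rule zero_form_group_monoid[OF R])
  obtain c \<beta>0 where c: "c \<in> carrier (H3 ?G ?A (perm_action C))" "\<beta> \<in> c" "\<beta>0 \<in> c" "\<beta>0 \<in> postnikov_cocycles C"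
    using assms unfolding postnikov_class_def by blast
  have "\<exists>c'\<in>carrier (H3 ?G' ?A (perm_action C')). ?t ` c \<subseteq> c'"
    by (rule transport3_H3[OF bij_class_map class_map_mult _ _ c(1)]) (simp_all add: perm_action_class_map)
  then show ?thesis
    using c(2,3) transport_cocycle[OF c(4)] unfolding postnikov_class_def one_form_group_eq by blast
qed

lemma postnikov_class_extensional:
  "\<beta> \<in> postnikov_class C \<Longrightarrow> \<beta> \<in> extensional (carrier (zero_form_group C) \<times> carrier (zero_form_group C) \<times> carrier (zero_form_group C))"
  unfolding postnikov_class_def using H3_extensional by blast

lemma transport_postnikov_class:
  "transport3 (zero_form_group C) (zero_form_group C') class_map id ` postnikov_class C = postnikov_class C'"
proof
  show "transport3 (zero_form_group C) (zero_form_group C') class_map id ` postnikov_class C \<subseteq> postnikov_class C'"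
    using transport_postnikov by blast
  interpret swap: conjugate_pair C' C \<sigma>' by (rule swap)
  show "postnikov_class C' \<subseteq> transport3 (zero_form_group C) (zero_form_group C') class_map id ` postnikov_class C"
  proof
    fix \<beta> assume \<beta>: "\<beta> \<in> postnikov_class C'"
    \<comment> \<open>The preimage of \<beta> is its transport along the class map of the exchanged
      pair.\<close>
    have "transport3 (zero_form_group C) (zero_form_group C') class_map id
        (transport3 (zero_form_group C') (zero_form_group C) swap.class_map id \<beta>) = \<beta>"
      by (rule transport3_inverse[OF bij_class_map swap.postnikov_class_extensional[OF \<beta>] swap.bij_class_map class_map_inverse])
    then show "\<beta> \<in> transport3 (zero_form_group C) (zero_form_group C') class_map id ` postnikov_class C"
      using swap.transport_postnikov[OF \<beta>] by (metis imageI)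
  qed
qed

theorem two_group_isomorphic_conj:
  "two_group_isomorphic (two_group_symmetry C) (two_group_symmetry C')"
  unfolding two_group_isomorphic_def two_group_symmetry_def two_group.simps one_form_group_eq
proof (intro bexI[of _ class_map] bexI[of _ id] conjI ballI)
  show "class_map \<in> iso (zero_form_group C) (zero_form_group C')"
    using bij_class_map class_map_mult class_map_in_carrier by (auto simp: iso_def hom_def)
  show "id \<in> iso (one_form_group C) (one_form_group C)"
    by (auto simp: iso_def hom_def)
  show "id (perm_action C g a) = perm_action C' (class_map g) (id a)" if "g \<in> carrier (zero_form_group C)" for g a
    using perm_action_class_map[OF that] by simp
  show "transport3 (zero_form_group C) (zero_form_group C') class_map id ` postnikov_class C = postnikov_class C'"
    by (rule transport_postnikov_class)
qed

end

theorem theorem4p4: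
  fixes C :: "'a::finite mtc_data"
  assumes "modular_tensor_category C"
    and "\<exists>L. CM_field L \<and> FR_entries C \<subseteq> L \<and>
           (\<forall>x \<in> carrier (zero_form_group C). \<exists>g \<in> x. \<forall>a b c. elements_mat (smat g a b c) \<subseteq> L)"
  shows "\<forall>q \<in> Gal (Galois_field C).
           two_group_isomorphic (two_group_symmetry C) (two_group_symmetry (Galois_conjugate q C))"
proof
  fix q assume q: "q \<in> Gal (Galois_field C)"
  obtain L where L: "CM_field L" "FR_entries C \<subseteq> L"
    and reps: "\<And>x. x \<in> carrier (zero_form_group C) \<Longrightarrow> \<exists>g\<in>x. \<forall>a b c. elements_mat (smat g a b c) \<subseteq> L"
    using assms(2) by blast
  \<comment> \<open>From here on \<open>L\<close> is replaced by the field of all CM numbers, which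
    every embedding of the algebraic numbers maps into itself and which contains the phases.\<close>
  note L_CM = CM_field_subset_CM_numbers[OF L(1)]
  have gen: "FR_entries C \<subseteq> generate_field CC (FR_entries C)" "generate_field CC (FR_entries C) \<subseteq> algebraic_numbers"
  proof -
    show "FR_entries C \<subseteq> generate_field CC (FR_entries C)"
      by (auto intro: generate_field.incl)
    have "FR_entries C \<subseteq> algebraic_numbers" using L(2) L_CM CM_numbers_algebraic by blast
    then show "generate_field CC (FR_entries C) \<subseteq> algebraic_numbers"
      by (rule field.generate_field_min_subfield1[OF field_CC _ subfield_algebraic_numbers, rotated]) simp
  qed
  note K = normal_closure_algebraic[OF gen(2), folded Galois_field_def]
  obtain \<sigma> where \<sigma>: "complex_embedding algebraic_numbers \<sigma>" "\<And>x. x \<in> Galois_field C \<Longrightarrow> \<sigma> x = q x"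
    using extend_Gal[OF q K(1,3)] by blast
  have "conjugate_pair C (Galois_conjugate q C) \<sigma>"
  proof (rule conjugate_pair.intro[OF \<sigma>(1)])
    \<comment> \<open>\<open>Galois_conjugate\<close> applies q to all values; at the F and R
      entries q and \<sigma> agree, as these lie in \<open>Galois_field C\<close>.\<close>
    have FR: "\<sigma> x = q x" if "x \<in> FR_entries C" for x
      using \<sigma>(2) that gen(1) K(2) by blast
    show "conj_data \<sigma> C (Galois_conjugate q C)"
      unfolding conj_data_def
    proof (intro conjI allI ballI)
      show "Fsym (Galois_conjugate q C) a b c d i j = \<sigma> (Fsym C a b c d i j)"
        if "i \<in> left_idx C a b c d" "j \<in> right_idx C a b c d" for a b c d i j
        using FR[OF FR_entriesI(1)[OF that]] by (simp add: Galois_conjugate_def)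
      show "Rsym (Galois_conjugate q C) a b c = map_mat \<sigma> (Rsym C a b c)" for a b c
        using FR[OF FR_entriesI(2)[OF elements_matI[of _ "Rsym C a b c"]]]
        by (intro eq_matI) (auto simp: Galois_conjugate_def)
    qed (simp_all add: Galois_conjugate_def)
    show "FR_entries C \<subseteq> CM_numbers" using L(2) L_CM by blast
    show "R_dims C" "fusion_rules C" using assms(1) by (auto simp: modular_tensor_category_def R_dims_def)
    show "\<exists>g\<in>x. CM_sym g" if "x \<in> carrier (zero_form_group C)" for x
      using reps[OF that] L_CM unfolding CM_sym_def by blast
  qed
  then show "two_group_isomorphic (two_group_symmetry C) (two_group_symmetry (Galois_conjugate q C))"
    by (rule conjugate_pair.two_group_isomorphic_conj)
qed

end
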